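(* (i) If $\varphi$ is a majorant of upper type less than $1$ satisfying $$\int_0^1\frac{\varphi(t)}{t}\,dt<\infty,$$ then for every interpolating Blaschke product $B$ with zeros $\{a_j\}_{j\in\mathbb N}$ we have $$X_\varphi(\{a_j\})\subset K^\infty_B\big|_{\{a_j\}}.$$ (ii) Conversely, if $\varphi$ is a majorant with the property that $X_\varphi(\{a_j\})\subset K^\infty_B\big|_{\{a_j\}}$ for each interpolating Blaschke product $B$ with zeros $\{a_j\}_{j\in\mathbb N}$, then $$\int_0^1\frac{\varphi(t)}{t}\,dt<\infty.$$
   Context: $\mathbb D$ is the open unit disk in $\mathbb C$, $\mathbb T$ its boundary, and $m$ normalized arclength measure on $\mathbb T$. $H^\infty$ is the space of bounded holomorphic functions on $\mathbb D$, identified with their boundary functions (defined a.e. on $\mathbb T$), and $H^\infty_0=\{f\in H^\infty: f(0)=0\}$. Given a sequence $\{a_j\}_{j\in\mathbb N}$ in $\mathbb D$ with $\sum_j(1-|a_j|)<\infty$, the associated Blaschke product is $$B(z)=\prod_j b_j(z),\qquad b_j(z)=\frac{|a_j|}{a_j}\,\frac{a_j-z}{1-\overline{a_j}z},$$ with the convention $|a_j|/a_j=-1$ if $a_j=0$. $B$ is called an interpolating Blaschke product (with zeros $\{a_j\}$) if $\inf_j|B'(a_j)|\,(1-|a_j|)>0$. The star-invariant subspace $K^\infty_B$ is $K^\infty_B:=H^\infty\cap B\,\overline{H^\infty_0}$, i.e. the set of $f\in H^\infty$ for which there is $g\in H^\infty_0$ with $f=B\overline g$ a.e. on $\mathbb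 T$. For a function space $\mathcal X$ on $\mathbb D$, $\mathcal X\big|_{\{a_j\}}$ denotes the set of complex sequences $\{w_j\}$ for which there is $f\in\mathcal X$ with $f(a_j)=w_j$ for all $j\in\mathbb N$. A majorant is a nondecreasing continuous function $\varphi:(0,1]\to(0,\infty)$ such that $t\mapsto\varphi(t)/t$ is nonincreasing. A majorant $\varphi$ is of upper type less than $1$ if there are constants $C>0$ and $\gamma\in[0,1)$ such that $\varphi(st)\le Cs^\gamma\varphi(t)$ whenever $s\ge1$ and $0<t\le1/s$. For a majorant $\varphi$ and a sequence $\{a_j\}$ in $\mathbb D$, $X_\varphi(\{a_j\})$ denotes the set of all complex sequences $\{w_j\}\in\ell^\infty$ satisfying $$\sup_j\frac{|w_j|}{\varphi(1-|a_j|)}<\infty.$$ *)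

theory Defs
  imports "HOL-Analysis.Analysis"
begin

text \<open>The case \<open>a = 0\<close> follows the convention \<open>\<bar>a\<bar> / a = -1\<close>, so that the factor is \<open>z\<close>.\<close>

definition blaschke_factor :: "complex \<Rightarrow> complex \<Rightarrow> complex" where
  "blaschke_factor a z =
     (if a = 0 then -1 else of_real (norm a) / a) * ((a - z) / (1 - cnj a * z))"

definition blaschke_sequence :: "(nat \<Rightarrow> complex) \<Rightarrow> bool" where
  "blaschke_sequence a \<longleftrightarrow> (\<forall>j. a j \<in> ball 0 1) \<and> summable (\<lambda>j. 1 - norm (a j))"

text \<open>The library's infinite product allows finitely many vanishing factors, so this is also
  the intended value (namely 0) at the points \<open>a j\<close> of a Blaschke sequence.\<close>

definition blaschke_product :: "(nat \<Rightarrow> complex) \<Rightarrow> complex \<Rightarrow> complex" where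
  "blaschke_product a z = (\<Prod>j. blaschke_factor (a j) z)"

definition interpolating :: "(nat \<Rightarrow> complex) \<Rightarrow> bool" where
  "interpolating a \<longleftrightarrow> blaschke_sequence a \<and>
     (INF j. norm (deriv (blaschke_product a) (a j)) * (1 - norm (a j))) > 0"

text \<open>Elements of the spaces below are functions on all of \<open>\<complex>\<close>; only their values
  on the open unit disk matter.\<close>

definition Hinf :: "(complex \<Rightarrow> complex) set" where
  "Hinf = {f. f holomorphic_on ball 0 1 \<and> bounded (f ` ball 0 1)}"

definition Hinf0 :: "(complex \<Rightarrow> complex) set" where
  "Hinf0 = {f \<in> Hinf. f 0 = 0}"

text \<open>Normalized arclength measure on the unit circle.\<close>

definition circle_measure :: "complex measure" where
  "circle_measure =
     distr (uniform_measure lborel {-pi..pi}) (restrict_space borel (sphere 0 1)) cis"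

text \<open>\<open>boundary_value f \<zeta> u\<close>: the boundary function of \<open>f\<close> is defined at \<open>\<zeta>\<close>, with value \<open>u\<close>,
  as a radial limit.\<close>

definition boundary_value :: "(complex \<Rightarrow> complex) \<Rightarrow> complex \<Rightarrow> complex \<Rightarrow> bool" where
  "boundary_value f \<zeta> u \<longleftrightarrow> ((\<lambda>r. f (of_real r * \<zeta>)) \<longlongrightarrow> u) (at_left 1)"

text \<open>The star-invariant subspace of \<open>B\<close>: on the circle, \<open>f = B * cnj g\<close> almost everywhere.
  For bounded holomorphic functions the boundary values exist almost everywhere (Fatou), so
  requiring their existence here is no restriction.\<close>

definition Kinf :: "(complex \<Rightarrow> complex) \<Rightarrow> (complex \<Rightarrow> complex) set" where
  "Kinf B = {f \<in> Hinf. \<exists>g\<in>Hinf0. AE \<zeta> in circle_measure.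
     \<exists>u v w. boundary_value f \<zeta> u \<and> boundary_value B \<zeta> v \<and> boundary_value g \<zeta> w \<and> u = v * cnj w}"

definition trace_space :: "(complex \<Rightarrow> complex) set \<Rightarrow> (nat \<Rightarrow> complex) \<Rightarrow> (nat \<Rightarrow> complex) set" where
  "trace_space X a = {w. \<exists>f\<in>X. \<forall>j. f (a j) = w j}"

text \<open>Majorants are functions on \<open>(0, 1]\<close>; values elsewhere are irrelevant.\<close>

definition majorant :: "(real \<Rightarrow> real) \<Rightarrow> bool" where
  "majorant \<phi> \<longleftrightarrow> (\<forall>t\<in>{0<..1}. \<phi> t > 0) \<and> mono_on {0<..1} \<phi> \<and>
     continuous_on {0<..1} \<phi> \<and> antimono_on {0<..1} (\<lambda>t. \<phi> t / t)"

definition upper_type_less_1 :: "(real \<Rightarrow> real) \<Rightarrow> bool" where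
  "upper_type_less_1 \<phi> \<longleftrightarrow> (\<exists>C \<gamma>. C > 0 \<and> 0 \<le> \<gamma> \<and> \<gamma> < 1 \<and>
     (\<forall>s t. s \<ge> 1 \<and> 0 < t \<and> t \<le> 1 / s \<longrightarrow> \<phi> (s * t) \<le> C * s powr \<gamma> * \<phi> t))"

definition X_space :: "(real \<Rightarrow> real) \<Rightarrow> (nat \<Rightarrow> complex) \<Rightarrow> (nat \<Rightarrow> complex) set" where
  "X_space \<phi> a = {w. bounded (range w) \<and>
     bdd_above (range (\<lambda>j. norm (w j) / \<phi> (1 - norm (a j))))}"

end

theory Submission
  imports Defs "HOL-Complex_Analysis.Complex_Analysis"
begin

text \<open>
  Write \<open>h j = 1 - norm (a j)\<close>. For the first part the interpolating function is explicit:
  \<open>f = (\<Sum>j. c j * B / (z - a j))\<close> with \<open>c j = w j / B' (a j)\<close>, and \<open>f = B * cnj g\<close> on the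
  circle for \<open>g = (\<Sum>j. cnj (c j) * z / (1 - cnj (a j) * z))\<close>. Both are bounded once
  \<open>(\<Sum>j. \<phi> (h j) * h j / norm (\<zeta> - a j))\<close> is bounded on the circle; summing over dyadic annuli
  around \<open>\<zeta>\<close>, this follows from the Carleson condition for interpolating sequences and the
  convergence of \<open>(\<Sum>n. \<phi> ((1/2) ^ n))\<close>. That \<open>B\<close> has radial limits almost everywhere is
  obtained from a weak-type maximal inequality for the \<open>L\<^sup>2\<close> distance between \<open>B\<close> and its
  partial products.

  For the second part take \<open>a j = 1 - (1/8) ^ (j + 1)\<close> and \<open>w j = \<plusminus>\<phi> (h j)\<close> with the sign of
  \<open>B' (a j)\<close>. If \<open>f = B * cnj g\<close> interpolates \<open>w\<close>, then
  \<open>cnj (g x) = (\<Sum>j. w j / B' (a j) * x / (1 - x * a j))\<close> is a sum of positive terms, and letting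
  \<open>x\<close> tend to 1 bounds \<open>(\<Sum>j. \<phi> (h j))\<close> by the supremum of \<open>norm g\<close>.
\<close>

section \<open>Mean values and the Poisson kernel\<close>

text \<open>The formulas for \<open>f\<close> and \<open>g\<close> come from partial fractions. On
  the circle \<open>cnj z = 1 / z\<close>, so the conjugate of
  \<open>cnj (c j) * z / (1 - cnj (a j) * z)\<close> is \<open>c j / (z - a j)\<close>; thus
  \<open>f / B\<close> and \<open>cnj g\<close> agree term by term, and \<open>c j\<close> is the
  residue of \<open>f / B\<close> at \<open>a j\<close>. A bound on the circle passes to the disc
  without a maximum principle, because \<open>norm (1 - cnj a * z)\<close> loses at most a factor 2
  when \<open>z\<close> moves inward along a radius. The same domination yields radial limits of
  \<open>f\<close> and \<open>g\<close> at every circle point where \<open>B\<close> has one, so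
  only \<open>B\<close> needs an almost everywhere argument. Locally uniform convergence of the
  partial products inside the disc says nothing about the circle. The maximal inequality turns
  closeness in mean into uniform convergence along almost every whole radius, at the price of a
  subsequence \<open>n\<close>. Then the limit of \<open>B\<close> is also the limit of the partial
  products on the circle, hence unimodular. The converse relies on this: it divides by the limit,
  and it approximates \<open>f / B\<close> by quotients with finitely many poles.\<close>

definition angle_measure :: "real measure" where
  "angle_measure = uniform_measure lborel {-pi..pi}"

lemma space_angle_measure [simp]: "space angle_measure = UNIV"
  by (simp add: angle_measure_def)

lemma sets_angle_measure [simp, measurable_cong]: "sets angle_measure = sets borel"
  by (simp add: angle_measure_def)

lemma emeasure_angle_measure_UNIV: "emeasure angle_measure UNIV = 1"
proof -
  have "emeasure angle_measure UNIV = emeasure lborel {-pi..pi} / emeasure lborel {-pi..pi}"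
    unfolding angle_measure_def by (subst emeasure_uniform_measure) auto
  also have "\<dots> = ennreal (2 * pi) / ennreal (2 * pi)"
    by simp
  also have "\<dots> = 1"
    by (subst divide_ennreal) auto
  finally show ?thesis .
qed

interpretation angle: finite_measure angle_measure
  by standard (simp add: emeasure_angle_measure_UNIV)

interpretation angle_pair: pair_sigma_finite angle_measure angle_measure
  by standard

lemma measure_angle_measure_UNIV [simp]: "measure angle_measure UNIV = 1"
  by (simp add: measure_def emeasure_angle_measure_UNIV)

lemma integrable_angle_measure_continuous:
  fixes F :: "real \<Rightarrow> 'a::{banach, second_countable_topology}"
  assumes "continuous_on UNIV F"
  shows "integrable angle_measure F"
proof -
  have "compact (F ` {-pi..pi})"
    using assms by (intro compact_continuous_image) (auto intro: continuous_on_subset)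
  then obtain C where C: "\<And>\<theta>. \<theta> \<in> {-pi..pi} \<Longrightarrow> norm (F \<theta>) \<le> C"
    using compact_imp_bounded bounded_iff by (metis imageI)
  show ?thesis
  proof (rule angle.integrable_const_bound)
    show "F \<in> borel_measurable angle_measure"
      using borel_measurable_continuous_onI[OF assms] by simp
    show "AE \<theta> in angle_measure. norm (F \<theta>) \<le> C"
      unfolding angle_measure_def by (rule AE_uniform_measureI) (auto intro!: C)
  qed
qed

lemma integral_angle_measure:
  fixes F :: "real \<Rightarrow> complex"
  assumes "continuous_on UNIV F"
  shows "integral\<^sup>L angle_measure F = integral {-pi..pi} F / (2 * pi)"
proof -
  have F: "F \<in> borel_measurable borel"
    using assms by (rule borel_measurable_continuous_onI)
  have eq: "angle_measure = density lborel (\<lambda>x. ennreal (indicator {-pi..pi} x / (2 * pi)))"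
    unfolding angle_measure_def uniform_measure_def
  proof (intro density_cong)
    show "AE x in lborel. indicator {-pi..pi} x / emeasure lborel {-pi..pi}
            = ennreal (indicator {-pi..pi} x / (2 * pi))"
      by (intro AE_I2) (auto simp: indicator_def divide_ennreal[symmetric] simp del: ennreal_1
            simp flip: ennreal_1)
  qed auto
  then have "integral\<^sup>L angle_measure F = (\<integral>x. (indicator {-pi..pi} x / (2 * pi)) *\<^sub>R F x \<partial>lborel)"
    unfolding eq using F by (subst integral_density) auto
  also have "\<dots> = (\<integral>x. (1 / (2 * pi)) *\<^sub>R (indicator {-pi..pi} x *\<^sub>R F x) \<partial>lborel)"
    by (intro Bochner_Integration.integral_cong) (auto simp: indicator_def)
  also have "\<dots> = (1 / (2 * pi)) *\<^sub>R (LINT x:{-pi..pi}|lborel. F x)"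
    unfolding set_lebesgue_integral_def by (rule integral_scaleR_right)
  also have "(LINT x:{-pi..pi}|lborel. F x) = integral {-pi..pi} F"
    by (intro set_borel_integral_eq_integral borel_integrable_compact)
       (auto simp: set_integrable_def intro!: borel_integrable_compact continuous_on_subset[OF assms])
  finally show ?thesis
    by (simp add: scaleR_conv_of_real)
qed

text \<open>On the circle \<open>dz = \<i> * z * d\<theta>\<close>. The difference quotient
  \<open>q\<close> of \<open>h\<close> at 0 extends holomorphically over 0, and Cauchy's theorem for
  \<open>q\<close> says exactly that \<open>h - h 0\<close> has mean zero.\<close>

lemma mean_value_circle:
  assumes h: "h holomorphic_on ball 0 R" and r: "0 \<le> r" "r < R"
  shows "(\<integral>\<theta>. h (of_real r * cis \<theta>) \<partial>angle_measure) = h 0"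
proof (cases "r = 0")
  case False
  define q where "q z = (if z = 0 then deriv h 0 else (h z - h 0) / (z - 0))" for z
  have q: "q holomorphic_on ball 0 R"
    unfolding q_def by (rule pole_lemma[OF h]) (use r False in auto)
  \<comment> \<open>The path starts at angle \<open>-pi\<close> so that its parameter interval is
    the one that carries \<open>angle_measure\<close>.\<close>
  let ?g = "part_circlepath 0 r (-pi) pi"
  have "(q has_contour_integral 0) ?g"
  proof (rule Cauchy_theorem_disc_simple[OF q])
    have "path_image ?g \<subseteq> sphere 0 r"
      using r by (intro path_image_part_circlepath_subset) auto
    then show "path_image ?g \<subseteq> ball 0 R" using r by auto
    show "pathfinish ?g = pathstart ?g"
      by (simp add: exp_minus flip: cis_conv_exp)
  qed auto
  then have "((\<lambda>t. q (0 + r * cis t) * r * \<i> * cis t) has_integral 0) {-pi..pi}"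
    by (subst (asm) has_contour_integral_part_circlepath_iff) auto
  moreover have "q (0 + r * cis t) * r * \<i> * cis t = \<i> * (h (r * cis t) - h 0)" for t
    using False by (simp add: q_def)
  ultimately have "((\<lambda>t. \<i> * (h (r * cis t) - h 0)) has_integral 0) {-pi..pi}"
    by (simp only:)
  from has_integral_mult_right[OF this, of "-\<i>"]
  have "((\<lambda>t. h (r * cis t) - h 0) has_integral 0) {-pi..pi}"
    by (simp add: mult.assoc[symmetric])
  from has_integral_add[OF this has_integral_const_real[of "h 0"]]
  have "((\<lambda>t. h (r * cis t)) has_integral (2 * pi) *\<^sub>R h 0) {-pi..pi}"
    by simp
  moreover have "continuous_on UNIV (\<lambda>\<theta>. h (of_real r * cis \<theta>))"
    using r by (intro continuous_on_compose2[OF holomorphic_on_imp_continuous_on[OF h]])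
       (auto intro!: continuous_intros simp: norm_mult)
  ultimately show ?thesis
    by (subst integral_angle_measure) (auto simp: integral_unique scaleR_conv_of_real)
qed simp

text \<open>Split \<open>h\<close> into \<open>h - h z\<close> and the constant \<open>h z\<close>.
  The first part contributes the mean of \<open>w * q w\<close>, which is its value 0 at the origin;
  the second contributes \<open>h z\<close> times the mean of the Cauchy kernel, which is 1.\<close>

lemma Cauchy_integral_circle:
  assumes h: "h holomorphic_on ball 0 R" and R: "1 < R" and z: "norm z < 1"
  shows "(\<integral>\<theta>. h (cis \<theta>) * (cis \<theta> / (cis \<theta> - z)) \<partial>angle_measure) = h z"
proof -
  define q where "q w = (if w = z then deriv h z else (h w - h z) / (w - z))" for w
  have q: "q holomorphic_on ball 0 R"
    unfolding q_def by (rule pole_lemma[OF h]) (use R z in auto)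
  have ne: "cis \<theta> \<noteq> z" for \<theta>
    using z by (metis norm_cis less_irrefl)
  have cont_h: "continuous_on UNIV (\<lambda>\<theta>. h (cis \<theta>))"
    using R by (intro continuous_on_compose2[OF holomorphic_on_imp_continuous_on[OF h]])
       (auto intro!: continuous_intros simp: norm_mult)
  have cont_q: "continuous_on UNIV (\<lambda>\<theta>. q (cis \<theta>))"
    using R by (intro continuous_on_compose2[OF holomorphic_on_imp_continuous_on[OF q]])
       (auto intro!: continuous_intros simp: norm_mult)
  \<comment> \<open>On the circle the Cauchy kernel is the conjugate of a function holomorphic
    beyond the closed disc, so the mean value property applies to it as well.\<close>
  have "(\<integral>\<theta>. cis \<theta> / (cis \<theta> - z) \<partial>angle_measure)
      = (\<integral>\<theta>. cnj (1 / (1 - cnj z * cis \<theta>)) \<partial>angle_measure)"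
  proof (intro Bochner_Integration.integral_cong refl)
    fix \<theta>
    have "cis \<theta> - z = cis \<theta> * (1 - z * cis (-\<theta>))"
      by (simp add: algebra_simps cis_mult)
    then show "cis \<theta> / (cis \<theta> - z) = cnj (1 / (1 - cnj z * cis \<theta>))"
      by (simp add: cis_cnj)
  qed
  also have "\<dots> = cnj (\<integral>\<theta>. 1 / (1 - cnj z * (of_real 1 * cis \<theta>)) \<partial>angle_measure)"
    by (simp only: Bochner_Integration.integral_cnj of_real_1 mult_1)
  also have "(\<integral>\<theta>. 1 / (1 - cnj z * (of_real 1 * cis \<theta>)) \<partial>angle_measure) = 1 / (1 - cnj z * 0)"
  proof (cases "z = 0")
    case False
    show ?thesis
    proof (rule mean_value_circle)
      show "(\<lambda>w. 1 / (1 - cnj z * w)) holomorphic_on ball 0 (1 / norm z)"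
      proof (intro holomorphic_intros)
        fix w assume "w \<in> ball (0::complex) (1 / norm z)"
        then have "norm (cnj z * w) < 1" using False by (simp add: norm_mult field_simps)
        then show "1 - cnj z * w \<noteq> 0" by auto
      qed
      show "1 < 1 / norm z" using z False by simp
    qed auto
  qed simp
  finally have 1: "(\<integral>\<theta>. cis \<theta> / (cis \<theta> - z) \<partial>angle_measure) = 1" by simp
  have "(\<integral>\<theta>. (\<lambda>w. w * q w) (of_real 1 * cis \<theta>) \<partial>angle_measure) = 0 * q 0"
    by (rule mean_value_circle) (use R q in \<open>auto intro!: holomorphic_intros\<close>)
  then have 2: "(\<integral>\<theta>. cis \<theta> * q (cis \<theta>) \<partial>angle_measure) = 0" by simp
  have "(\<integral>\<theta>. h (cis \<theta>) * (cis \<theta> / (cis \<theta> - z)) \<partial>angle_measure)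
      = (\<integral>\<theta>. cis \<theta> * q (cis \<theta>) + h z * (cis \<theta> / (cis \<theta> - z)) \<partial>angle_measure)"
  proof (intro Bochner_Integration.integral_cong refl)
    fix \<theta>
    have "cis \<theta> * q (cis \<theta>) + h z * (cis \<theta> / (cis \<theta> - z))
        = cis \<theta> * ((h (cis \<theta>) - h z) + h z) / (cis \<theta> - z)"
      using ne by (simp add: q_def add_divide_distrib[symmetric] algebra_simps)
    then show "h (cis \<theta>) * (cis \<theta> / (cis \<theta> - z))
        = cis \<theta> * q (cis \<theta>) + h z * (cis \<theta> / (cis \<theta> - z))"
      by (simp add: mult.commute)
  qed
  also have "\<dots> = (\<integral>\<theta>. cis \<theta> * q (cis \<theta>) \<partial>angle_measure)
        + (\<integral>\<theta>. h z * (cis \<theta> / (cis \<theta> - z)) \<partial>angle_measure)"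
    using ne by (intro Bochner_Integration.integral_add integrable_angle_measure_continuous)
      (auto intro!: continuous_intros cont_q)
  also have "\<dots> = h z"
    using 1 2 by (simp add: integral_mult_right_zero del: times_divide_eq_right)
  finally show ?thesis .
qed

section \<open>The Poisson kernel: reproducing formula, semigroup law and comparison of
  radii\<close>

definition poisson_kernel :: "real \<Rightarrow> real \<Rightarrow> real" where
  "poisson_kernel r t = (1 - r\<^sup>2) / (norm (1 - of_real r * cis t))\<^sup>2"

lemma norm_of_real_cis_less_1: "0 \<le> r \<Longrightarrow> r < 1 \<Longrightarrow> norm (of_real r * cis t) < 1"
  by (simp add: norm_mult)

lemma of_real_cis_neq_1: "0 \<le> r \<Longrightarrow> r < 1 \<Longrightarrow> of_real r * cis t \<noteq> 1"
  using norm_of_real_cis_less_1[of r t] by (metis less_irrefl norm_one)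

lemma poisson_kernel_nonneg: "0 \<le> r \<Longrightarrow> r < 1 \<Longrightarrow> 0 \<le> poisson_kernel r t"
  by (simp add: poisson_kernel_def power_le_one)

text \<open>As the real part of a function holomorphic in \<open>r * cis t\<close>, the kernel can
  itself be fed into the Poisson formula; this is how the semigroup law arises.\<close>

lemma poisson_kernel_eq_Re:
  assumes "0 \<le> r" "r < 1"
  shows "poisson_kernel r t = Re ((1 + of_real r * cis t) / (1 - of_real r * cis t))"
proof -
  define w where "w = of_real r * cis t"
  have w: "norm w = r" "w \<noteq> 1"
    using assms of_real_cis_neq_1 by (auto simp: w_def norm_mult)
  have "(1 + w) / (1 - w) = (1 + w) * cnj (1 - w) / of_real ((norm (1 - w))\<^sup>2)"
    by (subst complex_div_cnj) simp
  moreover have "Re ((1 + w) * cnj (1 - w)) = 1 - (norm w)\<^sup>2"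
    unfolding cmod_power2 by (simp add: power2_eq_square algebra_simps)
  ultimately show ?thesis
    using w unfolding poisson_kernel_def w_def[symmetric]
    by (metis Re_divide_of_real)
qed

lemma poisson_kernel_minus: "poisson_kernel r (-t) = poisson_kernel r t"
proof -
  have "1 - of_real r * cis (-t) = cnj (1 - of_real r * cis t)"
    by (simp add: cis_cnj)
  then show ?thesis
    unfolding poisson_kernel_def by (metis complex_mod_cnj)
qed

lemma continuous_on_poisson_kernel:
  assumes "0 \<le> r" "r < 1" "continuous_on A f"
  shows "continuous_on A (\<lambda>t. poisson_kernel r (f t))"
  unfolding poisson_kernel_def
  using assms of_real_cis_neq_1 by (intro continuous_intros) auto

text \<open>At \<open>u\<close> on the circle the kernel is \<open>u / (u - z) + k u\<close>, where
  the first summand is the Cauchy kernel and \<open>k\<close> is holomorphic past the circle with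
  \<open>k 0 = 0\<close>. The Cauchy formula yields \<open>h z\<close>, and \<open>h * k\<close> has
  mean 0.\<close>

lemma poisson_integral_circle:
  assumes h: "h holomorphic_on ball 0 R" and R: "1 < R" and r: "0 \<le> r" "r < 1"
  shows "(\<integral>t. h (cis t) * poisson_kernel r (\<theta> - t) \<partial>angle_measure) = h (of_real r * cis \<theta>)"
proof -
  define z where "z = of_real r * cis \<theta>"
  have z: "norm z < 1" "norm z = r"
    using r by (auto simp: z_def norm_mult)
  define k where "k w = cnj z * w / (1 - cnj z * w)" for w
  \<comment> \<open>The radius \<open>2 / (1 + r)\<close> lies strictly between 1 and
    \<open>1 / r\<close>, and it still makes sense for \<open>r = 0\<close>. The same choice recurs
    below.\<close>
  have k: "k holomorphic_on ball 0 (2 / (1 + r))"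
    unfolding k_def
  proof (intro holomorphic_intros)
    fix w assume "w \<in> ball (0::complex) (2 / (1 + r))"
    then have "norm w * (1 + r) < 2" using r by (simp add: field_simps)
    then have "norm (cnj z * w) < 1"
      using z r mult_left_le[of r "norm w"] by (cases "norm w \<le> 1")
        (auto simp: norm_mult algebra_simps intro: mult_le_one)
    then show "1 - cnj z * w \<noteq> 0" by auto
  qed
  have ne: "cis t \<noteq> z" "1 \<noteq> cnj z * cis t" for t
  proof -
    have "norm (cis t) \<noteq> norm z" "norm (1::complex) \<noteq> norm (cnj z * cis t)"
      using z by (simp_all add: norm_mult)
    then show "cis t \<noteq> z" "1 \<noteq> cnj z * cis t" by metis+
  qed
  have cont_h: "continuous_on UNIV (\<lambda>\<theta>. h (cis \<theta>))"
    using R by (intro continuous_on_compose2[OF holomorphic_on_imp_continuous_on[OF h]])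
       (auto intro!: continuous_intros simp: norm_mult)
  have "(\<integral>t. (\<lambda>w. h w * k w) (of_real 1 * cis t) \<partial>angle_measure) = h 0 * k 0"
  proof (rule mean_value_circle)
    show "(\<lambda>w. h w * k w) holomorphic_on ball 0 (min R (2 / (1 + r)))"
      by (intro holomorphic_intros holomorphic_on_subset[OF h] holomorphic_on_subset[OF k]) auto
  qed (use R r in auto)
  then have 1: "(\<integral>t. h (cis t) * k (cis t) \<partial>angle_measure) = 0"
    by (simp add: k_def)
  have "(\<integral>t. h (cis t) * poisson_kernel r (\<theta> - t) \<partial>angle_measure)
      = (\<integral>t. h (cis t) * (cis t / (cis t - z)) + h (cis t) * k (cis t) \<partial>angle_measure)"
  proof (intro Bochner_Integration.integral_cong refl)
    fix t
    have eq: "of_real r * cis (\<theta> - t) = z * cnj (cis t)"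
      by (simp add: z_def cis_cnj cis_mult mult.assoc)
    have ct: "cis t * cnj (cis t) = 1"
      by (simp add: cis_cnj cis_mult)
    define u where "u = cis t"
    have u: "u \<noteq> 0" "cnj u = 1 / u" using ct by (auto simp: u_def field_simps)
    have u1: "cnj (1 - z / u) = 1 - cnj z * u" using u by simp
    have ne': "u \<noteq> z" "1 \<noteq> cnj z * u" using ne by (auto simp: u_def)
    have "complex_of_real (poisson_kernel r (\<theta> - t)) = (1 - z * cnj z) / ((1 - z / u) * (1 - cnj z * u))"
    proof -
      have "complex_of_real (1 - r\<^sup>2) = 1 - z * cnj z"
        unfolding z(2)[symmetric] of_real_diff complex_norm_square by simp
      moreover have "complex_of_real ((norm (1 - z * cnj u))\<^sup>2) = (1 - z / u) * (1 - cnj z * u)"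
        unfolding complex_norm_square using u u1 by simp
      ultimately show ?thesis
        unfolding poisson_kernel_def eq u_def[symmetric] of_real_divide by simp
    qed
    also have "\<dots> = u / (u - z) + k u"
      using ne' u(1) by (simp add: k_def field_simps)
    finally show "h (cis t) * poisson_kernel r (\<theta> - t)
        = h (cis t) * (cis t / (cis t - z)) + h (cis t) * k (cis t)"
      by (simp add: u_def algebra_simps)
  qed
  also have "\<dots> = (\<integral>t. h (cis t) * (cis t / (cis t - z)) \<partial>angle_measure)
      + (\<integral>t. h (cis t) * k (cis t) \<partial>angle_measure)"
    using ne unfolding k_def
    by (intro Bochner_Integration.integral_add integrable_angle_measure_continuous continuous_intros cont_h) auto
  also have "\<dots> = h z"
    using Cauchy_integral_circle[OF h R z(1)] 1 by simp
  finally show ?thesis by (simp add: z_def)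
qed

text \<open>The function \<open>h\<close> has the kernel of radius \<open>s\<close> as its real part
  on the circle. Its Poisson integral at radius \<open>r\<close> is its value at
  \<open>r * cis \<theta>\<close>, whose real part is the kernel of radius
  \<open>r * s\<close>.\<close>

lemma poisson_kernel_semigroup:
  assumes r: "0 \<le> r" "r < 1" and s: "0 \<le> s" "s < 1"
  shows "(\<integral>t. poisson_kernel r (\<theta> - t) * poisson_kernel s (\<theta>' - t) \<partial>angle_measure)
       = poisson_kernel (r * s) (\<theta> - \<theta>')"
proof -
  define h where "h w = (1 + of_real s * cis (-\<theta>') * w) / (1 - of_real s * cis (-\<theta>') * w)" for w
  have rs: "r * s < 1" using r s mult_left_le_one_le[of s r] by auto
  have h: "h holomorphic_on ball 0 (2 / (1 + s))"
    unfolding h_def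
  proof (intro holomorphic_intros)
    fix w assume "w \<in> ball (0::complex) (2 / (1 + s))"
    then have "norm w * (1 + s) < 2" using s by (simp add: field_simps)
    then have "norm (of_real s * cis (-\<theta>') * w) < 1"
      using s mult_left_le[of s "norm w"] by (cases "norm w \<le> 1")
        (auto simp: norm_mult algebra_simps intro: mult_le_one)
    then show "1 - of_real s * cis (-\<theta>') * w \<noteq> 0" by auto
  qed
  have cont_h: "continuous_on UNIV (\<lambda>\<theta>. h (cis \<theta>))"
    using s by (intro continuous_on_compose2[OF holomorphic_on_imp_continuous_on[OF h]])
       (auto intro!: continuous_intros simp: norm_mult)
  have "(\<integral>t. h (cis t) * poisson_kernel r (\<theta> - t) \<partial>angle_measure) = h (of_real r * cis \<theta>)"
    by (rule poisson_integral_circle[OF h]) (use r s in auto)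
  then have "Re (\<integral>t. h (cis t) * poisson_kernel r (\<theta> - t) \<partial>angle_measure) = Re (h (of_real r * cis \<theta>))"
    by simp
  also have "Re (\<integral>t. h (cis t) * poisson_kernel r (\<theta> - t) \<partial>angle_measure)
     = (\<integral>t. Re (h (cis t) * poisson_kernel r (\<theta> - t)) \<partial>angle_measure)"
    using r by (subst integral_Re) (auto intro!: integrable_angle_measure_continuous continuous_intros
        cont_h continuous_on_poisson_kernel)
  also have "\<dots> = (\<integral>t. poisson_kernel r (\<theta> - t) * poisson_kernel s (\<theta>' - t) \<partial>angle_measure)"
  proof (intro Bochner_Integration.integral_cong refl)
    fix t
    have "of_real s * cis (-\<theta>') * cis t = of_real s * cis (t - \<theta>')"
      by (simp add: cis_mult mult.assoc)
    then have "Re (h (cis t)) = poisson_kernel s (t - \<theta>')"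
      unfolding h_def by (simp only: poisson_kernel_eq_Re[OF s])
    then show "Re (h (cis t) * poisson_kernel r (\<theta> - t)) = poisson_kernel r (\<theta> - t) * poisson_kernel s (\<theta>' - t)"
      using poisson_kernel_minus[of s "t - \<theta>'"] by (simp add: mult.commute)
  qed
  also have "Re (h (of_real r * cis \<theta>)) = poisson_kernel (r * s) (\<theta> - \<theta>')"
  proof -
    have "of_real s * cis (-\<theta>') * (of_real r * cis \<theta>) = of_real (r * s) * cis (\<theta> - \<theta>')"
      by (simp add: cis_mult[symmetric] diff_conv_add_uminus del: add_uminus_conv_diff)
    then show ?thesis
      unfolding h_def using r s rs by (simp only: poisson_kernel_eq_Re mult_nonneg_nonneg)
  qed
  finally show ?thesis .
qed

text \<open>The removed piece \<open>(1 - s) * w\<close> is no longer than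
  \<open>1 - s * norm w\<close>, hence no longer than the distance from \<open>s * w\<close> to 1.
  The estimate compares Poisson kernels of different radii, and later dominates whole series along a
  radius by their size at its endpoint.\<close>

lemma norm_one_minus_le_twice:
  assumes "norm w \<le> 1" "0 \<le> s" "s \<le> 1"
  shows "norm (1 - w) \<le> 2 * norm (1 - of_real s * w :: complex)"
proof -
  have "1 - w = (1 - of_real s * w) - of_real (1 - s) * w"
    by (simp add: algebra_simps)
  then have "norm (1 - w) \<le> norm (1 - of_real s * w) + norm (of_real (1 - s) * w)"
    by (metis norm_triangle_ineq4)
  also have "norm (of_real (1 - s) * w) = (1 - s) * norm w"
    unfolding norm_mult norm_of_real using assms by simp
  also have "(1 - s) * norm w \<le> 1 - s * norm w"
    using assms by (simp add: algebra_simps)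
  also have "1 - s * norm w = norm (1::complex) - norm (of_real s * w)"
    unfolding norm_mult norm_of_real using assms by simp
  also have "\<dots> \<le> norm (1 - of_real s * w)" by (rule norm_triangle_ineq2)
  finally show ?thesis by simp
qed

text \<open>The denominators of the two single kernels are at most 4 times that of the product
  radius, and the numerators obey
  \<open>1 - (r * s)\<^sup>2 \<le> (1 - r\<^sup>2) + (1 - s\<^sup>2)\<close>. The point is to
  separate the radii: each summand depends on one of them only.\<close>

lemma poisson_kernel_mult_le:
  assumes r: "0 \<le> r" "r < 1" and s: "0 \<le> s" "s < 1"
  shows "poisson_kernel (r * s) t \<le> 4 * (poisson_kernel r t + poisson_kernel s t)"
proof -
  have half: "norm (1 - of_real r * cis t) \<le> 2 * norm (1 - of_real (r * s) * cis t)"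
    if rs: "0 \<le> r" "r < 1" "0 \<le> s" "s < 1" for r s
  proof -
    have "of_real s * (of_real r * cis t) = of_real (r * s) * cis t"
      by (simp add: mult.left_commute)
    moreover have "norm (of_real r * cis t) \<le> 1"
      using rs by (simp add: norm_mult)
    ultimately show ?thesis
      using norm_one_minus_le_twice[of "of_real r * cis t" s] rs by (simp only: less_imp_le)
  qed
  have rs: "0 \<le> r * s" "r * s < 1"
    using r s mult_left_le_one_le[of s r] by auto
  define d where "d = (norm (1 - of_real (r * s) * cis t))\<^sup>2"
  have d: "d > 0" using of_real_cis_neq_1[OF rs] by (auto simp: d_def)
  have le: "(1 - x\<^sup>2) / d \<le> 4 * poisson_kernel x t"
    if x: "0 \<le> x" "x < 1" "norm (1 - of_real x * cis t) \<le> 2 * norm (1 - of_real (r * s) * cis t)" for x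
  proof -
    have "(norm (1 - of_real x * cis t))\<^sup>2 \<le> (2 * norm (1 - of_real (r * s) * cis t))\<^sup>2"
      by (rule power_mono[OF x(3)]) auto
    then have "(norm (1 - of_real x * cis t))\<^sup>2 \<le> 4 * d"
      by (simp add: d_def power_mult_distrib)
    moreover have "(norm (1 - of_real x * cis t))\<^sup>2 > 0"
      using of_real_cis_neq_1[OF x(1,2)] by auto
    moreover have "1 - x\<^sup>2 \<ge> 0" using x by (simp add: power_le_one)
    ultimately have "(1 - x\<^sup>2) / (4 * d) \<le> (1 - x\<^sup>2) / (norm (1 - of_real x * cis t))\<^sup>2"
      using d by (intro divide_left_mono) auto
    then have "4 * ((1 - x\<^sup>2) / (4 * d)) \<le> 4 * ((1 - x\<^sup>2) / (norm (1 - of_real x * cis t))\<^sup>2)"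
      by (rule mult_left_mono) simp
    also have "4 * ((1 - x\<^sup>2) / (4 * d)) = (1 - x\<^sup>2) / d" using d by (simp add: divide_simps)
    finally show ?thesis unfolding poisson_kernel_def .
  qed
  have "r\<^sup>2 + s\<^sup>2 \<le> 1 + (r * s)\<^sup>2"
  proof -
    have "0 \<le> (1 - r\<^sup>2) * (1 - s\<^sup>2)"
      using r s by (intro mult_nonneg_nonneg) (auto simp: power_le_one)
    then show ?thesis by (simp add: algebra_simps power_mult_distrib)
  qed
  then have "(1 - (r * s)\<^sup>2) / d \<le> (1 - r\<^sup>2) / d + (1 - s\<^sup>2) / d"
    using d by (simp add: divide_right_mono flip: add_divide_distrib)
  also have "\<dots> \<le> 4 * poisson_kernel r t + 4 * poisson_kernel s t"
    using le[OF r half[OF r s]] le[OF s] half[OF s r] by (intro add_mono) (auto simp: mult.commute)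
  finally show ?thesis by (simp add: poisson_kernel_def d_def)
qed

section \<open>A radial maximal inequality\<close>

text \<open>Duality: where the radial maximal function exceeds \<open>l\<close>, select measurably a radius \<open>r \<theta>\<close>
  witnessing this. The adjoint of the averaging operator with kernel \<open>K \<theta> t = P\<^bsub>r \<theta>\<^esub>(\<theta> - t)\<close>,
  applied to the indicator of the exceptional set \<open>E\<close>, has squared \<open>L\<^sup>2\<close> norm at most
  \<open>8 * emeasure E\<close>, because the kernels satisfy a semigroup law and have mean 1.\<close>

lemma radial_maximal_inequality_aux:
  assumes d: "d holomorphic_on ball 0 R" and R: "1 < R"
    and \<rho>: "\<And>i::nat. 0 \<le> \<rho> i" "\<And>i. \<rho> i < 1" and l: "0 < l"
  shows "emeasure angle_measure {\<theta>. \<exists>i. l < norm (d (of_real (\<rho> i) * cis \<theta>))} * ennreal (l\<^sup>2)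
    \<le> 8 * (\<integral>\<^sup>+t. ennreal ((norm (d (cis t)))\<^sup>2) \<partial>angle_measure)"
proof -
  have cont: "continuous_on UNIV (\<lambda>\<theta>. d (of_real s * cis \<theta>))" if "0 \<le> s" "s \<le> 1" for s
    using R that by (intro continuous_on_compose2[OF holomorphic_on_imp_continuous_on[OF d]])
       (auto intro!: continuous_intros simp: norm_mult)
  have [measurable]: "(\<lambda>\<theta>. d (of_real (\<rho> i) * cis \<theta>)) \<in> borel_measurable borel" for i
    using \<rho> by (intro borel_measurable_continuous_onI cont) (auto simp: less_imp_le)
  have dm [measurable]: "(\<lambda>t. d (cis t)) \<in> borel_measurable borel"
    using cont[of 1] by (intro borel_measurable_continuous_onI) auto
  define Q where "Q i \<theta> \<longleftrightarrow> l < norm (d (of_real (\<rho> i) * cis \<theta>))" for i \<theta>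
  have [measurable]: "Measurable.pred borel (Q i)" for i
    unfolding Q_def by measurable
  define E where "E = {\<theta>. \<exists>i. Q i \<theta>}"
  have E [measurable]: "E \<in> sets borel"
    unfolding E_def by measurable
  \<comment> \<open>Because the radii form a sequence, taking the least admissible index is a
    measurable selection. Off \<open>E\<close> the value is arbitrary but still a radius in
    \<open>[0, 1)\<close>.\<close>
  define r where "r \<theta> = \<rho> (LEAST i. Q i \<theta>)" for \<theta>
  have r_meas [measurable]: "r \<in> borel_measurable borel"
  proof -
    have "(\<lambda>\<theta>. LEAST i. Q i \<theta>) \<in> borel \<rightarrow>\<^sub>M count_space UNIV" by measurable
    then show ?thesis unfolding r_def by (rule measurable_compose) simp
  qed
  have r: "0 \<le> r \<theta>" "r \<theta> < 1" for \<theta> using \<rho> by (auto simp: r_def)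
  have rE: "l < norm (d (of_real (r \<theta>) * cis \<theta>))" if "\<theta> \<in> E" for \<theta>
    using that LeastI_ex[of "\<lambda>i. Q i \<theta>"] by (auto simp: E_def r_def Q_def)
  define K where "K \<theta> t = ennreal (poisson_kernel (r \<theta>) (\<theta> - t))" for \<theta> t
  define I :: "real \<Rightarrow> ennreal" where "I = indicator E"
  define h where "h t = ennreal (norm (d (cis t)))" for t
  have [measurable]: "(\<lambda>(\<theta>, t). K \<theta> t) \<in> borel_measurable (borel \<Otimes>\<^sub>M borel)"
  proof -
    have [measurable]: "cis \<in> borel_measurable borel"
      by (intro borel_measurable_continuous_onI continuous_intros)
    show ?thesis
      unfolding K_def poisson_kernel_def by measurable
  qed
  have [measurable]: "I \<in> borel_measurable borel" "h \<in> borel_measurable borel"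
    unfolding I_def h_def by measurable
  have pair: "sets (angle_measure \<Otimes>\<^sub>M angle_measure) = sets (borel \<Otimes>\<^sub>M borel)"
    by (intro sets_pair_measure_cong) auto
  define G where "G t = (\<integral>\<^sup>+\<theta>. I \<theta> * K \<theta> t \<partial>angle_measure)" for t
  have [measurable]: "G \<in> borel_measurable borel"
  proof -
    have "G \<in> borel_measurable angle_measure"
      unfolding G_def by measurable
    then show ?thesis by simp
  qed
  have cont_pk: "continuous_on UNIV (\<lambda>t. poisson_kernel (r \<theta>) (\<theta>' - t))" for \<theta> \<theta>'
    using r by (intro continuous_on_poisson_kernel continuous_intros) auto
  have repr: "I \<theta> * ennreal l \<le> I \<theta> * (\<integral>\<^sup>+t. h t * K \<theta> t \<partial>angle_measure)" for \<theta>
  proof (cases "\<theta> \<in> E")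
    case True
    have "l \<le> norm (d (of_real (r \<theta>) * cis \<theta>))" using rE[OF True] by simp
    also have "\<dots> = norm (\<integral>t. d (cis t) * poisson_kernel (r \<theta>) (\<theta> - t) \<partial>angle_measure)"
      using poisson_integral_circle[OF d R r] by simp
    also have "\<dots> \<le> (\<integral>t. norm (d (cis t) * poisson_kernel (r \<theta>) (\<theta> - t)) \<partial>angle_measure)"
      by (rule integral_norm_bound)
    also have "(\<integral>t. norm (d (cis t) * poisson_kernel (r \<theta>) (\<theta> - t)) \<partial>angle_measure)
        = (\<integral>t. norm (d (cis t)) * poisson_kernel (r \<theta>) (\<theta> - t) \<partial>angle_measure)"
      using r by (simp add: norm_mult poisson_kernel_nonneg)
    finally have "ennreal l \<le> ennreal (\<integral>t. norm (d (cis t)) * poisson_kernel (r \<theta>) (\<theta> - t) \<partial>angle_measure)"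
      by (rule ennreal_leI)
    also have "\<dots> = (\<integral>\<^sup>+t. ennreal (norm (d (cis t)) * poisson_kernel (r \<theta>) (\<theta> - t)) \<partial>angle_measure)"
      using r cont[of 1]
      by (intro nn_integral_eq_integral[symmetric] integrable_angle_measure_continuous)
         (auto intro!: continuous_intros cont_pk simp: poisson_kernel_nonneg)
    also have "\<dots> = (\<integral>\<^sup>+t. h t * K \<theta> t \<partial>angle_measure)"
      using r by (simp add: h_def K_def ennreal_mult poisson_kernel_nonneg)
    finally show ?thesis using True by (simp add: I_def)
  qed (simp add: I_def)
  have KK: "(\<integral>\<^sup>+t. K \<theta> t * K \<theta>' t \<partial>angle_measure) \<le> 4 * K \<theta> \<theta>' + 4 * K \<theta>' \<theta>" for \<theta> \<theta>'
  proof -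
    have "(\<integral>\<^sup>+t. K \<theta> t * K \<theta>' t \<partial>angle_measure)
        = (\<integral>\<^sup>+t. ennreal (poisson_kernel (r \<theta>) (\<theta> - t) * poisson_kernel (r \<theta>') (\<theta>' - t)) \<partial>angle_measure)"
      using r by (simp add: K_def ennreal_mult poisson_kernel_nonneg)
    also have "\<dots> = ennreal (\<integral>t. poisson_kernel (r \<theta>) (\<theta> - t) * poisson_kernel (r \<theta>') (\<theta>' - t) \<partial>angle_measure)"
      using r by (intro nn_integral_eq_integral integrable_angle_measure_continuous)
         (auto intro!: continuous_intros cont_pk simp: poisson_kernel_nonneg)
    also have "\<dots> = ennreal (poisson_kernel (r \<theta> * r \<theta>') (\<theta> - \<theta>'))"
      using r by (simp add: poisson_kernel_semigroup)
    also have "\<dots> \<le> ennreal (4 * (poisson_kernel (r \<theta>) (\<theta> - \<theta>') + poisson_kernel (r \<theta>') (\<theta> - \<theta>')))"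
      using r by (intro ennreal_leI poisson_kernel_mult_le) auto
    also have "\<dots> = 4 * K \<theta> \<theta>' + 4 * K \<theta>' \<theta>"
      using r poisson_kernel_minus[of "r \<theta>'" "\<theta> - \<theta>'"]
      by (simp add: K_def ennreal_plus ennreal_mult distrib_left poisson_kernel_nonneg)
    finally show ?thesis .
  qed
  have K1: "(\<integral>\<^sup>+t. K \<theta> t \<partial>angle_measure) = 1" for \<theta>
  proof -
    have "complex_of_real (\<integral>t. poisson_kernel (r \<theta>) (\<theta> - t) \<partial>angle_measure) = 1"
      using poisson_integral_circle[of "\<lambda>_. 1" 2 "r \<theta>" \<theta>] r by simp
    then have "(\<integral>t. poisson_kernel (r \<theta>) (\<theta> - t) \<partial>angle_measure) = 1"
      using of_real_eq_1_iff by blast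
    moreover have "(\<integral>\<^sup>+t. K \<theta> t \<partial>angle_measure) = ennreal (\<integral>t. poisson_kernel (r \<theta>) (\<theta> - t) \<partial>angle_measure)"
      unfolding K_def using r
      by (intro nn_integral_eq_integral integrable_angle_measure_continuous)
         (auto intro!: continuous_intros cont_pk simp: poisson_kernel_nonneg)
    ultimately show ?thesis by simp
  qed
  have "(\<integral>\<^sup>+t. (G t)\<^sup>2 \<partial>angle_measure)
      = (\<integral>\<^sup>+t. (\<integral>\<^sup>+\<theta>. (\<integral>\<^sup>+\<theta>'. I \<theta> * K \<theta> t * (I \<theta>' * K \<theta>' t) \<partial>angle_measure) \<partial>angle_measure) \<partial>angle_measure)"
    unfolding G_def power2_eq_square
    by (simp add: nn_integral_cmult nn_integral_multc)
  also have "\<dots> = (\<integral>\<^sup>+\<theta>. (\<integral>\<^sup>+t. (\<integral>\<^sup>+\<theta>'. I \<theta> * K \<theta> t * (I \<theta>' * K \<theta>' t) \<partial>angle_measure) \<partial>angle_measure) \<partial>angle_measure)"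
    by (rule angle_pair.Fubini') measurable
  also have "\<dots> = (\<integral>\<^sup>+\<theta>. (\<integral>\<^sup>+\<theta>'. (\<integral>\<^sup>+t. I \<theta> * K \<theta> t * (I \<theta>' * K \<theta>' t) \<partial>angle_measure) \<partial>angle_measure) \<partial>angle_measure)"
    by (intro nn_integral_cong angle_pair.Fubini') measurable
  also have "\<dots> = (\<integral>\<^sup>+\<theta>. (\<integral>\<^sup>+\<theta>'. I \<theta> * I \<theta>' * (\<integral>\<^sup>+t. K \<theta> t * K \<theta>' t \<partial>angle_measure) \<partial>angle_measure) \<partial>angle_measure)"
    by (intro nn_integral_cong) (subst nn_integral_cmult[symmetric], measurable, simp add: mult_ac)
  also have "\<dots> \<le> (\<integral>\<^sup>+\<theta>. (\<integral>\<^sup>+\<theta>'. I \<theta> * I \<theta>' * (4 * K \<theta> \<theta>' + 4 * K \<theta>' \<theta>) \<partial>angle_measure) \<partial>angle_measure)"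
    by (intro nn_integral_mono mult_left_mono KK) auto
  \<comment> \<open>In each summand only the indicator of the variable that determines the radius is
    kept. The kernel can then be integrated over the other variable, where its mean is 1.\<close>
  also have "\<dots> \<le> (\<integral>\<^sup>+\<theta>. (\<integral>\<^sup>+\<theta>'. 4 * (I \<theta> * K \<theta> \<theta>') + 4 * (I \<theta>' * K \<theta>' \<theta>) \<partial>angle_measure) \<partial>angle_measure)"
    by (intro nn_integral_mono) (auto simp: I_def indicator_def distrib_left)
  also have "\<dots> = 4 * (\<integral>\<^sup>+\<theta>. (\<integral>\<^sup>+\<theta>'. I \<theta> * K \<theta> \<theta>' \<partial>angle_measure) \<partial>angle_measure)
       + 4 * (\<integral>\<^sup>+\<theta>. (\<integral>\<^sup>+\<theta>'. I \<theta>' * K \<theta>' \<theta> \<partial>angle_measure) \<partial>angle_measure)"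
    by (simp add: nn_integral_add nn_integral_cmult)
  also have "(\<integral>\<^sup>+\<theta>. (\<integral>\<^sup>+\<theta>'. I \<theta>' * K \<theta>' \<theta> \<partial>angle_measure) \<partial>angle_measure)
      = (\<integral>\<^sup>+\<theta>. (\<integral>\<^sup>+\<theta>'. I \<theta> * K \<theta> \<theta>' \<partial>angle_measure) \<partial>angle_measure)"
    by (rule angle_pair.Fubini') measurable
  also have "(\<integral>\<^sup>+\<theta>. (\<integral>\<^sup>+\<theta>'. I \<theta> * K \<theta> \<theta>' \<partial>angle_measure) \<partial>angle_measure) = (\<integral>\<^sup>+\<theta>. I \<theta> \<partial>angle_measure)"
    by (simp add: nn_integral_cmult K1)
  also have "\<dots> = emeasure angle_measure E"
    by (simp add: I_def)
  finally have G2: "(\<integral>\<^sup>+t. (G t)\<^sup>2 \<partial>angle_measure) \<le> 8 * emeasure angle_measure E"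
    by (simp flip: distrib_right)
  have "emeasure angle_measure E * ennreal l = (\<integral>\<^sup>+\<theta>. I \<theta> * ennreal l \<partial>angle_measure)"
    by (simp add: I_def nn_integral_multc)
  also have "\<dots> \<le> (\<integral>\<^sup>+\<theta>. I \<theta> * (\<integral>\<^sup>+t. h t * K \<theta> t \<partial>angle_measure) \<partial>angle_measure)"
    by (intro nn_integral_mono repr)
  also have "\<dots> = (\<integral>\<^sup>+\<theta>. (\<integral>\<^sup>+t. h t * (I \<theta> * K \<theta> t) \<partial>angle_measure) \<partial>angle_measure)"
    by (intro nn_integral_cong) (subst nn_integral_cmult[symmetric], measurable, simp add: mult_ac)
  also have "\<dots> = (\<integral>\<^sup>+t. (\<integral>\<^sup>+\<theta>. h t * (I \<theta> * K \<theta> t) \<partial>angle_measure) \<partial>angle_measure)"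
    by (rule angle_pair.Fubini') measurable
  also have "\<dots> = (\<integral>\<^sup>+t. h t * G t \<partial>angle_measure)"
    unfolding G_def by (intro nn_integral_cong nn_integral_cmult) measurable
  finally have "(emeasure angle_measure E * ennreal l)\<^sup>2 \<le> (\<integral>\<^sup>+t. h t * G t \<partial>angle_measure)\<^sup>2"
    by (rule power_mono) auto
  also have "\<dots> \<le> (\<integral>\<^sup>+t. (h t)\<^sup>2 \<partial>angle_measure) * (\<integral>\<^sup>+t. (G t)\<^sup>2 \<partial>angle_measure)"
    by (rule Cauchy_Schwarz_nn_integral) measurable
  also have "\<dots> \<le> (\<integral>\<^sup>+t. (h t)\<^sup>2 \<partial>angle_measure) * (8 * emeasure angle_measure E)"
    by (intro mult_left_mono G2) auto
  finally have main: "(emeasure angle_measure E * ennreal l)\<^sup>2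
      \<le> (\<integral>\<^sup>+t. (h t)\<^sup>2 \<partial>angle_measure) * (8 * emeasure angle_measure E)" .
  \<comment> \<open>The measure of \<open>E\<close> stands squared on the left of
    \<open>main\<close> and once on the right; it is finite, so one factor cancels unless it is
    zero.\<close>
  have "emeasure angle_measure E * ennreal (l\<^sup>2) \<le> 8 * (\<integral>\<^sup>+t. (h t)\<^sup>2 \<partial>angle_measure)"
  proof (cases "emeasure angle_measure E = 0")
    case False
    have fin: "emeasure angle_measure E \<noteq> top" by simp
    have "emeasure angle_measure E * (emeasure angle_measure E * ennreal (l\<^sup>2))
        \<le> emeasure angle_measure E * (8 * (\<integral>\<^sup>+t. (h t)\<^sup>2 \<partial>angle_measure))"
      using main l by (simp add: power2_eq_square ennreal_mult mult_ac)
    then show ?thesis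
      using False fin by (subst (asm) ennreal_mult_le_mult_iff) auto
  qed simp
  then show ?thesis
    by (simp add: E_def Q_def h_def ennreal_power)
qed

text \<open>Finitely many radii stay below some \<open>s < 1\<close>, and the dilate of
  \<open>d\<close> by \<open>s\<close> is holomorphic beyond the closed disc, so the previous lemma
  applies to it. The sets \<open>E n\<close> then increase to the full exceptional set.\<close>

lemma radial_maximal_inequality:
  assumes d: "d holomorphic_on ball 0 1"
    and A: "\<And>s. 0 \<le> s \<Longrightarrow> s < 1 \<Longrightarrow>
      (\<integral>\<^sup>+t. ennreal ((norm (d (of_real s * cis t)))\<^sup>2) \<partial>angle_measure) \<le> A"
    and \<rho>: "\<And>i::nat. 0 \<le> \<rho> i" "\<And>i. \<rho> i < 1" and l: "0 < l"
  shows "emeasure angle_measure {\<theta>. \<exists>i. l < norm (d (of_real (\<rho> i) * cis \<theta>))} * ennreal (l\<^sup>2) \<le> 8 * A"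
proof -
  define E where "E n = {\<theta>. \<exists>i\<le>n. l < norm (d (of_real (\<rho> i) * cis \<theta>))}" for n :: nat
  have cont: "continuous_on UNIV (\<lambda>\<theta>. d (of_real s * cis \<theta>))" if "0 \<le> s" "s < 1" for s
    using that by (intro continuous_on_compose2[OF holomorphic_on_imp_continuous_on[OF d]])
       (auto intro!: continuous_intros simp: norm_mult)
  have [measurable]: "(\<lambda>\<theta>. d (of_real (\<rho> i) * cis \<theta>)) \<in> borel_measurable borel" for i
    using \<rho> by (intro borel_measurable_continuous_onI cont)
  have E_sets [measurable]: "E n \<in> sets borel" for n
    unfolding E_def by measurable
  have bound: "emeasure angle_measure (E n) * ennreal (l\<^sup>2) \<le> 8 * A" for n
  proof -
    define s where "s = (1 + Max (\<rho> ` {..n})) / 2"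
    have Mx: "Max (\<rho> ` {..n}) < 1" using \<rho> by (subst Max_less_iff) auto
    have le: "\<rho> i \<le> Max (\<rho> ` {..n})" if "i \<le> n" for i using that by (intro Max_ge) auto
    have "0 \<le> Max (\<rho> ` {..n})" using \<rho>(1)[of 0] le[of 0] by (rule order_trans) simp
    with Mx have s: "0 < s" "s < 1" by (simp_all add: s_def)
    have lts: "\<rho> i < s" if "i \<le> n" for i
    proof -
      have "x < (1 + m) / 2" if "x \<le> m" "m < 1" for x m :: real using that by simp
      then show ?thesis using le[OF that] Mx unfolding s_def by blast
    qed
    \<comment> \<open>Rescaling by \<open>s\<close> turns the first radii into radii of the dilate,
      still below 1; \<open>min i n\<close> repeats the last of them to obtain an infinite
      sequence.\<close>
    define \<sigma> where "\<sigma> i = \<rho> (min i n) / s" for i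
    have "emeasure angle_measure {\<theta>. \<exists>i. l < norm ((\<lambda>z. d (of_real s * z)) (of_real (\<sigma> i) * cis \<theta>))} * ennreal (l\<^sup>2)
        \<le> 8 * (\<integral>\<^sup>+t. ennreal ((norm ((\<lambda>z. d (of_real s * z)) (cis t)))\<^sup>2) \<partial>angle_measure)"
    proof (rule radial_maximal_inequality_aux)
      show "(\<lambda>z. d (of_real s * z)) holomorphic_on ball 0 (1 / s)"
        using s by (intro holomorphic_on_compose_gen[OF _ d, unfolded o_def] holomorphic_intros)
           (auto simp: norm_mult field_simps)
      show "1 < 1 / s" using s by simp
      show "0 \<le> \<sigma> i" "\<sigma> i < 1" for i
        using \<rho> s lts[of "min i n"] by (auto simp: \<sigma>_def field_simps)
    qed (rule l)
    also have "\<dots> \<le> 8 * A" using s A[of s] by (intro mult_left_mono) auto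
    also have "{\<theta>. \<exists>i. l < norm ((\<lambda>z. d (of_real s * z)) (of_real (\<sigma> i) * cis \<theta>))} = E n"
    proof -
      have "of_real s * (of_real (\<sigma> i) * cis \<theta>) = of_real (\<rho> (min i n)) * cis \<theta>" for i \<theta>
        using s by (simp add: \<sigma>_def)
      then show ?thesis unfolding E_def by (auto, metis min.cobounded2, metis min.absorb1)
    qed
    finally show ?thesis .
  qed
  have "emeasure angle_measure (\<Union>n. E n) * ennreal (l\<^sup>2)
      = (SUP n. emeasure angle_measure (E n)) * ennreal (l\<^sup>2)"
    by (subst SUP_emeasure_incseq) (auto simp: incseq_def E_def intro: order_trans)
  also have "\<dots> = (SUP n. emeasure angle_measure (E n) * ennreal (l\<^sup>2))"
    by (rule SUP_mult_right_ennreal)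
  also have "\<dots> \<le> 8 * A"
    by (intro SUP_least bound)
  also have "(\<Union>n. E n) = {\<theta>. \<exists>i. l < norm (d (of_real (\<rho> i) * cis \<theta>))}"
    by (auto simp: E_def)
  finally show ?thesis .
qed

section \<open>Blaschke products\<close>

lemma one_minus_cnj_mult_neq_0: "norm a < 1 \<Longrightarrow> norm z \<le> 1 \<Longrightarrow> 1 - cnj a * z \<noteq> 0"
proof -
  assume "norm a < 1" "norm z \<le> 1"
  then have "norm (cnj a * z) < 1"
    using mult_left_le[of "norm z" "norm a"] by (simp add: norm_mult)
  then show ?thesis by auto
qed

lemma norm_blaschke_factor: "norm (blaschke_factor a z) = norm (a - z) / norm (1 - cnj a * z)"
  by (simp add: blaschke_factor_def norm_mult norm_divide)

lemma blaschke_factor_self [simp]: "blaschke_factor a a = 0"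
  by (simp add: blaschke_factor_def)

lemma blaschke_factor_0 [simp]: "blaschke_factor a 0 = of_real (norm a)"
  by (simp add: blaschke_factor_def)

text \<open>The basic identity of the pseudohyperbolic distance. It gives the bound by 1 in the disc
  and the modulus 1 on the circle, and later the lower bound that leads to the Carleson
  condition.\<close>

lemma one_minus_norm_blaschke_factor_sq:
  assumes "norm a < 1" "norm z \<le> 1"
  shows "1 - (norm (blaschke_factor a z))\<^sup>2
    = (1 - (norm a)\<^sup>2) * (1 - (norm z)\<^sup>2) / (norm (1 - cnj a * z))\<^sup>2"
proof -
  have "norm (1 - cnj a * z) \<noteq> 0" using one_minus_cnj_mult_neq_0[OF assms] by simp
  moreover have "(norm (1 - cnj a * z))\<^sup>2 - (norm (a - z))\<^sup>2 = (1 - (norm a)\<^sup>2) * (1 - (norm z)\<^sup>2)"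
    unfolding cmod_power2 by (simp add: power2_eq_square algebra_simps)
  ultimately show ?thesis
    by (simp add: norm_blaschke_factor power_divide diff_divide_distrib[symmetric] field_simps)
qed

lemma norm_blaschke_factor_le_1:
  assumes "norm a < 1" "norm z \<le> 1"
  shows "norm (blaschke_factor a z) \<le> 1"
proof -
  have "0 \<le> 1 - (norm (blaschke_factor a z))\<^sup>2"
    unfolding one_minus_norm_blaschke_factor_sq[OF assms] using assms
    by (intro divide_nonneg_nonneg mult_nonneg_nonneg) (auto simp: power_le_one)
  then show ?thesis by (simp add: power_le_one_iff abs_square_le_1)
qed

lemma norm_blaschke_factor_circle:
  assumes "norm a < 1" "norm z = 1"
  shows "norm (blaschke_factor a z) = 1"
  using one_minus_norm_blaschke_factor_sq[of a z] assms by (simp add: power2_eq_1_iff) 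
    (metis norm_ge_zero not_one_le_zero neg_0_le_iff_le)

text \<open>The unimodular constant \<open>u\<close> is normalized so that
  \<open>u * a = norm a\<close>. Hence \<open>1 - norm a\<close> splits off from the numerator of
  \<open>blaschke_factor a z - 1\<close>, and summability of these numbers makes the product
  converge.\<close>

lemma norm_blaschke_factor_minus_1_le:
  assumes a: "norm a < 1" and z: "norm z < 1"
  shows "norm (blaschke_factor a z - 1) \<le> (1 - norm a) * ((1 + norm z) / (1 - norm z))"
proof -
  define u where "u = (if a = 0 then -1 else of_real (norm a) / a)"
  have u: "norm u = 1" by (simp add: u_def norm_divide)
  have ne: "1 - cnj a * z \<noteq> 0" using one_minus_cnj_mult_neq_0[of a z] a z by simp
  have ua: "u * a = of_real (norm a)" by (simp add: u_def)
  have "u * a * cnj a = of_real (norm a) * cnj a" using ua by simp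
  moreover have "(complex_of_real (norm a))\<^sup>2 = a * cnj a"
    by (metis complex_norm_square of_real_power)
  ultimately have "u * (of_real (norm a))\<^sup>2 = of_real (norm a) * cnj a"
    by (simp only: mult.assoc)
  then have uc: "u * of_real (norm a) = cnj a"
    by (cases "a = 0") (auto simp: power2_eq_square)
  have "blaschke_factor a z - 1 = (u * (a - z) - (1 - cnj a * z)) / (1 - cnj a * z)"
    using ne by (simp add: blaschke_factor_def u_def[symmetric] field_simps)
  also have "u * (a - z) - (1 - cnj a * z) = - (of_real (1 - norm a) * (1 + u * z))"
    using ua by (simp add: algebra_simps uc[symmetric])
  finally have "norm (blaschke_factor a z - 1) = norm (- (of_real (1 - norm a) * (1 + u * z))) / norm (1 - cnj a * z)"
    by (simp only: norm_divide)
  also have "norm (- (of_real (1 - norm a) * (1 + u * z))) = (1 - norm a) * norm (1 + u * z)"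
    unfolding norm_minus_cancel norm_mult norm_of_real using a by simp
  also have "\<dots> / norm (1 - cnj a * z) = (1 - norm a) * (norm (1 + u * z) / norm (1 - cnj a * z))"
    by simp
  also have "\<dots> \<le> (1 - norm a) * ((1 + norm z) / (1 - norm z))"
  proof (intro mult_left_mono frac_le)
    show "norm (1 + u * z) \<le> 1 + norm z"
      using norm_triangle_ineq[of 1 "u * z"] u by (simp add: norm_mult)
    have "norm (cnj a * z) \<le> norm z"
      using a mult_left_le_one_le[of "norm z" "norm a"] by (simp add: norm_mult)
    then show "1 - norm z \<le> norm (1 - cnj a * z)"
      using norm_triangle_ineq2[of 1 "cnj a * z"] by simp
  qed (use a z in auto)
  finally show ?thesis .
qed

lemma holomorphic_on_blaschke_factor:
  assumes "norm a < 1"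
  shows "blaschke_factor a holomorphic_on ball 0 (2 / (1 + norm a))"
proof -
  have "1 - cnj a * w \<noteq> 0" if "w \<in> ball 0 (2 / (1 + norm a))" for w
  proof -
    have "norm w * (1 + norm a) < 2"
      using that assms by (simp add: pos_less_divide_eq add_pos_nonneg)
    then have "norm (cnj a * w) < 1"
      using assms mult_left_le[of "norm a" "norm w"] by (cases "norm w \<le> 1")
        (auto simp: norm_mult algebra_simps intro: mult_le_one)
    then show ?thesis by auto
  qed
  then show ?thesis
    unfolding blaschke_factor_def by (intro holomorphic_intros) auto
qed

lemma cball_subset_ball_blaschke_factor:
  assumes "norm a < 1"
  shows "cball 0 1 \<subseteq> ball (0::complex) (2 / (1 + norm a))"
proof -
  have "1 < 2 / (1 + norm a)"
    using assms by (simp add: pos_less_divide_eq add_pos_nonneg)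
  then show ?thesis by auto
qed

lemma has_field_derivative_blaschke_factor_self:
  assumes "norm a < 1"
  shows "(blaschke_factor a has_field_derivative
    - (if a = 0 then -1 else of_real (norm a) / a) / (1 - (norm a)\<^sup>2)) (at a)"
proof -
  have ne: "1 - cnj a * a \<noteq> 0" using one_minus_cnj_mult_neq_0[of a a] assms by simp
  have "complex_of_real (1 - (norm a)\<^sup>2) = 1 - cnj a * a"
    unfolding of_real_diff complex_norm_square by (simp add: mult.commute)
  moreover have "((\<lambda>z. (a - z) / (1 - cnj a * z)) has_field_derivative -1 / (1 - cnj a * a)) (at a)"
    using ne by (auto intro!: derivative_eq_intros simp: divide_simps)
  ultimately show ?thesis
    unfolding blaschke_factor_def
    using DERIV_cmult[of "\<lambda>z. (a - z) / (1 - cnj a * z)" "-1 / (1 - cnj a * a)" a UNIV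
        "if a = 0 then -1 else of_real (norm a) / a"]
    by (simp only: mult_minus1_right times_divide_eq_right of_real_diff of_real_1)
qed

section \<open>Partial products, their limit, and the derivative at the zeros\<close>

definition blaschke_partial :: "(nat \<Rightarrow> complex) \<Rightarrow> nat \<Rightarrow> complex \<Rightarrow> complex" where
  "blaschke_partial a N z = (\<Prod>j<N. blaschke_factor (a j) z)"

lemma norm_prod_blaschke_factor_le_1:
  assumes "\<And>j. j \<in> E \<Longrightarrow> norm (a j) < 1" "norm z \<le> 1"
  shows "norm (\<Prod>j\<in>E. blaschke_factor (a j) z) \<le> 1"
  unfolding prod_norm[symmetric] using assms
  by (intro prod_le_1) (auto intro: norm_blaschke_factor_le_1)

lemma norm_prod_blaschke_factor_antimono:
  assumes "\<And>j. j \<in> F \<Longrightarrow> norm (a j) < 1" "norm z \<le> 1" "finite F" "E \<subseteq> F"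
  shows "norm (\<Prod>j\<in>F. blaschke_factor (a j) z) \<le> norm (\<Prod>j\<in>E. blaschke_factor (a j) z)"
proof -
  have "norm (\<Prod>j\<in>F. blaschke_factor (a j) z)
      = norm (\<Prod>j\<in>F - E. blaschke_factor (a j) z) * norm (\<Prod>j\<in>E. blaschke_factor (a j) z)"
    unfolding norm_mult[symmetric] by (subst prod.subset_diff[OF assms(4,3)]) simp
  also have "\<dots> \<le> norm (\<Prod>j\<in>E. blaschke_factor (a j) z)"
    using assms by (intro mult_left_le_one_le norm_prod_blaschke_factor_le_1) auto
  finally show ?thesis .
qed

text \<open>The radius may depend on \<open>N\<close>: the poles \<open>1 / cnj (a j)\<close> can
  approach the circle as factors are added.\<close>

lemma holomorphic_on_blaschke_partial:
  assumes "\<And>j. norm (a j) < 1"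
  shows "\<exists>R>1. blaschke_partial a N holomorphic_on ball 0 R"
proof (induction N)
  case 0
  show ?case by (auto simp: blaschke_partial_def[abs_def] intro!: exI[of _ 2])
next
  case (Suc N)
  then obtain R where R: "R > 1" "blaschke_partial a N holomorphic_on ball 0 R" by blast
  have "(\<lambda>z. blaschke_partial a N z * blaschke_factor (a N) z)
      holomorphic_on ball 0 (min R (2 / (1 + norm (a N))))"
    by (intro holomorphic_intros holomorphic_on_subset[OF R(2)]
        holomorphic_on_subset[OF holomorphic_on_blaschke_factor[OF assms[of N]]]) auto
  moreover have "min R (2 / (1 + norm (a N))) > 1"
    using R assms[of N] by (auto simp: pos_less_divide_eq add_pos_nonneg)
  moreover have "blaschke_partial a (Suc N) = (\<lambda>z. blaschke_partial a N z * blaschke_factor (a N) z)"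
    by (simp add: blaschke_partial_def[abs_def])
  ultimately show ?case by metis
qed

context
  fixes a :: "nat \<Rightarrow> complex"
  assumes bs: "blaschke_sequence a"
begin

lemma blaschke_sequence_norm: "norm (a j) < 1"
  using bs by (simp add: blaschke_sequence_def)

lemma blaschke_sequence_summable: "summable (\<lambda>j. 1 - norm (a j))"
  using bs by (simp add: blaschke_sequence_def)

lemma norm_blaschke_partial_le_1: "norm z \<le> 1 \<Longrightarrow> norm (blaschke_partial a N z) \<le> 1"
  unfolding blaschke_partial_def by (intro norm_prod_blaschke_factor_le_1 blaschke_sequence_norm)

lemma norm_blaschke_partial_circle: "norm z = 1 \<Longrightarrow> norm (blaschke_partial a N z) = 1"
  unfolding blaschke_partial_def prod_norm[symmetric]
  by (intro prod.neutral ballI norm_blaschke_factor_circle blaschke_sequence_norm)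

lemma holomorphic_on_blaschke_partial_ball: "blaschke_partial a N holomorphic_on ball 0 1"
proof -
  obtain R where "R > 1" "blaschke_partial a N holomorphic_on ball 0 R"
    using holomorphic_on_blaschke_partial[of a, OF blaschke_sequence_norm] by blast
  then show ?thesis by (elim holomorphic_on_subset) auto
qed

lemma continuous_on_blaschke_partial: "continuous_on (cball 0 1) (blaschke_partial a N)"
proof -
  obtain R where "R > 1" "blaschke_partial a N holomorphic_on ball 0 R"
    using holomorphic_on_blaschke_partial[of a, OF blaschke_sequence_norm] by blast
  then show ?thesis
    by (intro continuous_on_subset[OF holomorphic_on_imp_continuous_on]) auto
qed

lemma blaschke_partial_uniform_limit:
  assumes r: "r < 1"
  shows "uniform_limit (cball 0 r) (blaschke_partial a) (blaschke_product a) sequentially"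
proof -
  have sum1: "norm (norm (blaschke_factor (a j) z - 1)) \<le> (1 - norm (a j)) * ((1 + r) / (1 - r))"
    if "z \<in> cball 0 r" for z j
  proof -
    have z: "norm z \<le> r" "norm z < 1" using that r by auto
    have "norm (blaschke_factor (a j) z - 1) \<le> (1 - norm (a j)) * ((1 + norm z) / (1 - norm z))"
      by (rule norm_blaschke_factor_minus_1_le[OF blaschke_sequence_norm z(2)])
    also have "\<dots> \<le> (1 - norm (a j)) * ((1 + r) / (1 - r))"
      using z r blaschke_sequence_norm[of j] by (intro mult_left_mono frac_le add_nonneg_nonneg)
        (auto intro: order_trans[OF norm_ge_zero z(1)])
    finally show ?thesis by simp
  qed
  have sum2: "summable (\<lambda>j. (1 - norm (a j)) * ((1 + r) / (1 - r)))"
    by (intro summable_mult2 blaschke_sequence_summable)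
  have "uniformly_convergent_on (cball 0 r) (\<lambda>N z. \<Prod>j<N. blaschke_factor (a j) z)"
  proof (rule uniformly_convergent_on_prod')
    fix n show "continuous_on (cball 0 r) (blaschke_factor (a n))"
    proof (rule continuous_on_subset)
      show "continuous_on (cball 0 1) (blaschke_factor (a n))"
        by (rule continuous_on_subset[OF holomorphic_on_imp_continuous_on[OF
              holomorphic_on_blaschke_factor[OF blaschke_sequence_norm]]
              cball_subset_ball_blaschke_factor[OF blaschke_sequence_norm]])
    qed (use r in auto)
    show "uniformly_convergent_on (cball 0 r) (\<lambda>N z. \<Sum>n<N. norm (blaschke_factor (a n) z - 1))"
      by (rule Weierstrass_m_test'[OF sum1 sum2])
  qed auto
  then have ul: "uniform_limit (cball 0 r) (\<lambda>N z. \<Prod>j<N. blaschke_factor (a j) z)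
      (\<lambda>z. lim (\<lambda>N. \<Prod>j<N. blaschke_factor (a j) z)) sequentially"
    by (simp add: uniformly_convergent_uniform_limit_iff)
  moreover have "lim (\<lambda>N. \<Prod>j<N. blaschke_factor (a j) z) = blaschke_product a z" if z: "z \<in> cball 0 r" for z
  proof -
    have "summable (\<lambda>j. norm (blaschke_factor (a j) z - 1))"
      by (rule summable_comparison_test'[OF sum2 sum1[OF z]])
    then have "convergent_prod (\<lambda>j. blaschke_factor (a j) z)"
      by (intro abs_convergent_prod_imp_convergent_prod) (simp add: abs_convergent_prod_conv_summable)
    then have "(\<lambda>N. \<Prod>j\<le>N. blaschke_factor (a j) z) \<longlonglongrightarrow> blaschke_product a z"
      unfolding blaschke_product_def by (rule convergent_prod_LIMSEQ)
    then have "(\<lambda>N. \<Prod>j<Suc N. blaschke_factor (a j) z) \<longlonglongrightarrow> blaschke_product a z"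
      by (simp only: lessThan_Suc_atMost)
    then have "(\<lambda>N. \<Prod>j<N. blaschke_factor (a j) z) \<longlonglongrightarrow> blaschke_product a z"
      by (rule filterlim_sequentially_Suc[THEN iffD1])
    then show ?thesis by (rule limI)
  qed
  ultimately show ?thesis
    unfolding blaschke_partial_def by (subst (asm) uniform_limit_cong'[OF refl]) auto
qed

lemma blaschke_partial_tendsto:
  assumes "norm z < 1"
  shows "(\<lambda>N. blaschke_partial a N z) \<longlonglongrightarrow> blaschke_product a z"
  by (rule tendsto_uniform_limitI[OF blaschke_partial_uniform_limit[of "norm z"]]) (use assms in auto)

lemma holomorphic_on_blaschke_product: "blaschke_product a holomorphic_on ball 0 1"
proof (rule holomorphic_uniform_sequence[OF open_ball holomorphic_on_blaschke_partial_ball])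
  fix z :: complex assume z: "z \<in> ball 0 1"
  define r where "r = (1 - norm z) / 2"
  have "norm w \<le> norm z + r" if "w \<in> cball z r" for w
    using that norm_triangle_ineq[of z "w - z"] by (auto simp: dist_norm norm_minus_commute)
  then have sub: "cball z r \<subseteq> cball 0 ((1 + norm z) / 2)"
    by (auto simp: r_def field_simps)
  then show "\<exists>d>0. cball z d \<subseteq> ball 0 1 \<and>
      uniform_limit (cball z d) (blaschke_partial a) (blaschke_product a) sequentially"
    using z by (intro exI[of _ r] conjI uniform_limit_on_subset[OF blaschke_partial_uniform_limit sub])
      (auto simp: r_def subset_eq)
qed

text \<open>All factors have norm at most 1 in the disc, so omitting any of them can only increase
  the modulus; this survives the limit. Singletons \<open>E\<close> give the vanishing at the zeros
  and, later, the bound on \<open>B / (z - a j)\<close>.\<close>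

lemma norm_blaschke_product_le:
  assumes "norm z < 1" "finite E"
  shows "norm (blaschke_product a z) \<le> norm (\<Prod>j\<in>E. blaschke_factor (a j) z)"
proof (rule tendsto_upperbound[OF tendsto_norm[OF blaschke_partial_tendsto[OF assms(1)]]])
  obtain M where M: "E \<subseteq> {..<M}" using assms(2) finite_nat_iff_bounded by blast
  show "\<forall>\<^sub>F N in sequentially. norm (blaschke_partial a N z) \<le> norm (\<Prod>j\<in>E. blaschke_factor (a j) z)"
    using eventually_ge_at_top[of M]
  proof eventually_elim
    case (elim N)
    show ?case unfolding blaschke_partial_def
      by (rule norm_prod_blaschke_factor_antimono) (use assms elim M blaschke_sequence_norm in auto)
  qed
qed auto

lemma blaschke_product_zero [simp]: "blaschke_product a (a j) = 0"
  using norm_blaschke_product_le[of "a j" "{j}"] blaschke_sequence_norm[of j] by simp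

text \<open>In the product rule only the term differentiating the factor of \<open>a j\<close>
  survives, since that factor vanishes at \<open>a j\<close>.\<close>

lemma deriv_blaschke_partial_self:
  assumes "j < N"
  shows "deriv (blaschke_partial a N) (a j) =
     - (if a j = 0 then -1 else of_real (norm (a j)) / a j) / (1 - (norm (a j))\<^sup>2) *
       (\<Prod>k\<in>{..<N} - {j}. blaschke_factor (a k) (a j))"
proof -
  define c where "c z = (\<Prod>k\<in>{..<N} - {j}. blaschke_factor (a k) z)" for z
  have eq: "blaschke_partial a N = (\<lambda>z. blaschke_factor (a j) z * c z)"
    unfolding blaschke_partial_def c_def using assms by (subst prod.remove[of _ j]) auto
  have "c holomorphic_on ball 0 1"
    unfolding c_def
  proof (intro holomorphic_intros)
    fix k show "blaschke_factor (a k) holomorphic_on ball 0 1"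
      by (rule holomorphic_on_subset[OF holomorphic_on_blaschke_factor[OF blaschke_sequence_norm]])
        (use cball_subset_ball_blaschke_factor[OF blaschke_sequence_norm[of k]] in auto)
  qed
  then have "(c has_field_derivative deriv c (a j)) (at (a j))"
    using blaschke_sequence_norm[of j] by (intro holomorphic_derivI[of _ "ball 0 1"]) auto
  from DERIV_mult[OF has_field_derivative_blaschke_factor_self[OF blaschke_sequence_norm[of j]] this]
  show ?thesis
    unfolding eq by (intro DERIV_imp_deriv) (simp add: c_def)
qed

lemma deriv_blaschke_partial_tendsto:
  assumes "norm z < 1"
  shows "(\<lambda>N. deriv (blaschke_partial a N) z) \<longlonglongrightarrow> deriv (blaschke_product a) z"
proof -
  define r where "r = (1 - norm z) / 2"
  have r: "r > 0" using assms by (simp add: r_def)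
  have "norm w \<le> norm z + r" if "w \<in> cball z r" for w
    using that norm_triangle_ineq[of z "w - z"] by (auto simp: dist_norm norm_minus_commute)
  then have sub: "cball z r \<subseteq> cball 0 ((1 + norm z) / 2)" 
    by (auto simp: r_def field_simps)
  then have sub1: "cball z r \<subseteq> ball 0 1" using assms by auto
  have ev: "\<forall>\<^sub>F N in sequentially. continuous_on (cball z r) (blaschke_partial a N) \<and>
     (\<forall>w\<in>ball z r. (blaschke_partial a N has_field_derivative deriv (blaschke_partial a N) w) (at w))"
    using sub1 by (intro always_eventually allI conjI ballI holomorphic_derivI[OF holomorphic_on_blaschke_partial_ball]
        continuous_on_subset[OF continuous_on_blaschke_partial]) (auto simp: subset_eq)
  have ul: "uniform_limit (cball z r) (blaschke_partial a) (blaschke_product a) sequentially"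
    by (rule uniform_limit_on_subset[OF blaschke_partial_uniform_limit sub]) (use assms in simp)
  obtain g' where g': "\<And>w. w \<in> ball z r \<Longrightarrow> (blaschke_product a has_field_derivative g' w) (at w)
      \<and> (\<lambda>N. deriv (blaschke_partial a N) w) \<longlonglongrightarrow> g' w"
    using has_complex_derivative_uniform_limit[OF ev ul _ r] by auto
  show ?thesis using g'[of z] r DERIV_imp_deriv by fastforce
qed

text \<open>Translates the derivative in the definition of \<open>interpolating\<close> into the
  product of the pseudohyperbolic distances from \<open>a j\<close> to the other zeros.\<close>

lemma norm_deriv_blaschke_product_tendsto:
  "(\<lambda>N. norm (\<Prod>k\<in>{..<N} - {j}. blaschke_factor (a k) (a j)))
    \<longlonglongrightarrow> norm (deriv (blaschke_product a) (a j)) * (1 - (norm (a j))\<^sup>2)"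
proof (rule Lim_transform_eventually)
  show "(\<lambda>N. norm (deriv (blaschke_partial a N) (a j)) * (1 - (norm (a j))\<^sup>2))
    \<longlonglongrightarrow> norm (deriv (blaschke_product a) (a j)) * (1 - (norm (a j))\<^sup>2)"
    by (intro tendsto_intros deriv_blaschke_partial_tendsto blaschke_sequence_norm)
  show "\<forall>\<^sub>F N in sequentially. norm (deriv (blaschke_partial a N) (a j)) * (1 - (norm (a j))\<^sup>2)
      = norm (\<Prod>k\<in>{..<N} - {j}. blaschke_factor (a k) (a j))"
    using eventually_gt_at_top[of j]
  proof eventually_elim
    case (elim N)
    have "(norm (a j))\<^sup>2 < 1" using blaschke_sequence_norm[of j] by (simp add: power_less_one_iff abs_square_less_1)
    then have "norm (1 - (complex_of_real (norm (a j)))\<^sup>2) = 1 - (norm (a j))\<^sup>2"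
      using norm_of_real[of "1 - (norm (a j))\<^sup>2", where 'a=complex] by simp
    moreover have "norm (if a j = 0 then -1 else of_real (norm (a j)) / a j) = 1"
      by (simp add: norm_divide)
    ultimately show ?case
      using \<open>(norm (a j))\<^sup>2 < 1\<close>
      unfolding deriv_blaschke_partial_self[OF elim] norm_mult norm_divide norm_minus_cancel by simp
  qed
qed

lemma norm_deriv_blaschke_product_le:
  assumes "finite E" "j \<notin> E"
  shows "norm (deriv (blaschke_product a) (a j)) * (1 - (norm (a j))\<^sup>2)
    \<le> norm (\<Prod>k\<in>E. blaschke_factor (a k) (a j))"
proof (rule tendsto_upperbound[OF norm_deriv_blaschke_product_tendsto])
  obtain M where M: "E \<subseteq> {..<M}" using assms(1) finite_nat_iff_bounded by blast
  show "\<forall>\<^sub>F N in sequentially. norm (\<Prod>k\<in>{..<N} - {j}. blaschke_factor (a k) (a j))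
      \<le> norm (\<Prod>k\<in>E. blaschke_factor (a k) (a j))"
    using eventually_ge_at_top[of M]
  proof eventually_elim
    case (elim N)
    show ?case
      by (rule norm_prod_blaschke_factor_antimono)
        (use assms elim M blaschke_sequence_norm less_imp_le[OF blaschke_sequence_norm] in auto)
  qed
qed auto

end

section \<open>Radial limits of Blaschke products\<close>

context
  fixes a :: "nat \<Rightarrow> complex"
  assumes bs: "blaschke_sequence a"
begin

text \<open>With \<open>T\<close> the quotient of the two partial products, \<open>norm T \<le> 1\<close> gives
  \<open>(norm (T - 1))\<^sup>2 \<le> 2 - 2 * Re T\<close>, whose mean is known from \<open>T 0\<close>.\<close>

lemma mean_norm_blaschke_partial_diff_sq:
  assumes s: "0 \<le> s" "s < 1" and NM: "N \<le> M"
  shows "(\<integral>t. (norm (blaschke_partial a M (of_real s * cis t) - blaschke_partial a N (of_real s * cis t)))\<^sup>2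
      \<partial>angle_measure) \<le> 2 * (\<Sum>k\<in>{N..<M}. 1 - norm (a k))"
proof -
  note hol = holomorphic_on_subset[OF holomorphic_on_blaschke_factor[OF blaschke_sequence_norm[OF bs]]
              subset_trans[OF ball_subset_cball cball_subset_ball_blaschke_factor[OF blaschke_sequence_norm[OF bs]]]]
  define T where "T z = (\<Prod>k\<in>{N..<M}. blaschke_factor (a k) z)" for z
  have T: "T holomorphic_on ball 0 1"
    unfolding T_def by (intro holomorphic_intros hol)
  have in_ball: "of_real s * cis t \<in> ball 0 1" for t
    using s by (simp add: norm_mult)
  have cont: "continuous_on UNIV (\<lambda>t. g (of_real s * cis t))" if "g holomorphic_on ball 0 1" for g
    using in_ball by (intro continuous_on_compose2[OF holomorphic_on_imp_continuous_on[OF that]] continuous_intros) auto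
  have MN: "blaschke_partial a M z = blaschke_partial a N z * T z" for z
    using NM unfolding blaschke_partial_def T_def
    by (subst prod.union_disjoint[symmetric]) (auto intro!: prod.cong)
  have pw: "(norm (blaschke_partial a M z - blaschke_partial a N z))\<^sup>2 \<le> 2 - 2 * Re (T z)" if "z \<in> ball 0 1" for z
  proof -
    have z: "norm z \<le> 1" using that by simp
    have T1: "norm (T z) \<le> 1"
      unfolding T_def using blaschke_sequence_norm[OF bs] z by (intro norm_prod_blaschke_factor_le_1)
    have "blaschke_partial a M z - blaschke_partial a N z = blaschke_partial a N z * (T z - 1)"
      by (simp add: MN algebra_simps)
    then have "norm (blaschke_partial a M z - blaschke_partial a N z) \<le> norm (T z - 1)"
      using norm_blaschke_partial_le_1[OF bs z, of N] by (simp add: norm_mult mult_left_le_one_le)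
    then have "(norm (blaschke_partial a M z - blaschke_partial a N z))\<^sup>2 \<le> (norm (T z - 1))\<^sup>2"
      by (rule power_mono) simp
    also have "\<dots> = (norm (T z))\<^sup>2 + 1 - 2 * Re (T z)"
      unfolding cmod_power2 by (simp add: power2_eq_square algebra_simps)
    also have "\<dots> \<le> 2 - 2 * Re (T z)"
      using T1 by (simp add: power_le_one)
    finally show ?thesis .
  qed
  have "(\<integral>t. (norm (blaschke_partial a M (of_real s * cis t) - blaschke_partial a N (of_real s * cis t)))\<^sup>2 \<partial>angle_measure)
      \<le> (\<integral>t. 2 - 2 * Re (T (of_real s * cis t)) \<partial>angle_measure)"
    by (intro Bochner_Integration.integral_mono integrable_angle_measure_continuous pw in_ball
        continuous_intros cont T holomorphic_on_blaschke_partial_ball[OF bs])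
  also have "\<dots> = Re (\<integral>t. 2 - 2 * T (of_real s * cis t) \<partial>angle_measure)"
    by (subst integral_Re[symmetric]) (auto intro!: integrable_angle_measure_continuous cont holomorphic_intros T)
  also have "(\<integral>t. 2 - 2 * T (of_real s * cis t) \<partial>angle_measure) = 2 - 2 * T 0"
  proof (rule mean_value_circle[OF _ s])
    show "(\<lambda>z. 2 - 2 * T z) holomorphic_on ball 0 1"
      by (intro holomorphic_intros T)
  qed
  also have "T 0 = of_real (\<Prod>k\<in>{N..<M}. 1 - (1 - norm (a k)))"
    by (simp add: T_def)
  also have "Re (2 - 2 * of_real (\<Prod>k\<in>{N..<M}. 1 - (1 - norm (a k))))
      = 2 - 2 * (\<Prod>k\<in>{N..<M}. 1 - (1 - norm (a k)))"
    by (simp del: of_real_prod)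
  also have "\<dots> \<le> 2 * (\<Sum>k\<in>{N..<M}. 1 - norm (a k))"
    using Weierstrass_prod_ineq[of "{N..<M}" "\<lambda>k. 1 - norm (a k)"] less_imp_le[OF blaschke_sequence_norm[OF bs]]
    by simp
  finally show ?thesis .
qed

lemma mean_norm_blaschke_product_diff_sq:
  assumes s: "0 \<le> s" "s < 1"
  shows "(\<integral>\<^sup>+t. ennreal ((norm (blaschke_product a (of_real s * cis t) - blaschke_partial a N (of_real s * cis t)))\<^sup>2)
      \<partial>angle_measure) \<le> ennreal (2 * (\<Sum>k. 1 - norm (a (k + N))))"
proof -
  have in_ball: "of_real s * cis t \<in> ball 0 1" for t
    using s by (simp add: norm_mult)
  have cont: "continuous_on UNIV (\<lambda>t. g (of_real s * cis t))" if "g holomorphic_on ball 0 1" for g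
    using in_ball by (intro continuous_on_compose2[OF holomorphic_on_imp_continuous_on[OF that]] continuous_intros) auto
  note hols = holomorphic_on_blaschke_partial_ball[OF bs] holomorphic_on_blaschke_product[OF bs]
  define F where "F M t = (norm (blaschke_partial a M (of_real s * cis t) - blaschke_partial a N (of_real s * cis t)))\<^sup>2" for M t
  define G where "G t = (norm (blaschke_product a (of_real s * cis t) - blaschke_partial a N (of_real s * cis t)))\<^sup>2" for t
  have contF: "continuous_on UNIV (F M)" for M
    unfolding F_def by (intro continuous_intros cont hols)
  have contG: "continuous_on UNIV G"
    unfolding G_def by (intro continuous_intros cont hols)
  have [measurable]: "F M \<in> borel_measurable borel" "G \<in> borel_measurable borel" for M
    using contF contG borel_measurable_continuous_onI by blast+
  have "(\<lambda>M. integral\<^sup>L angle_measure (F M)) \<longlonglongrightarrow> integral\<^sup>L angle_measure G"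
  proof (rule integral_dominated_convergence)
    show "integrable angle_measure (\<lambda>_. 4::real)" by simp
    show "AE t in angle_measure. (\<lambda>M. F M t) \<longlonglongrightarrow> G t"
      unfolding F_def G_def using in_ball
      by (intro AE_I2 tendsto_intros blaschke_partial_tendsto[OF bs]) auto
    show "AE t in angle_measure. norm (F M t) \<le> 4" for M
    proof (intro AE_I2)
      fix t
      have z: "norm (of_real s * cis t) \<le> 1" using in_ball[of t] by simp
      have "norm (blaschke_partial a M (of_real s * cis t) - blaschke_partial a N (of_real s * cis t)) \<le> 1 + 1"
        by (rule order_trans[OF norm_triangle_ineq4 add_mono]) (intro norm_blaschke_partial_le_1[OF bs] z)+
      from power_mono[OF this, of 2] show "norm (F M t) \<le> 4" by (simp add: F_def)
    qed
  qed measurable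
  moreover have "\<forall>\<^sub>F M in sequentially. integral\<^sup>L angle_measure (F M) \<le> 2 * (\<Sum>k. 1 - norm (a (k + N)))"
    using eventually_ge_at_top[of N]
  proof eventually_elim
    case (elim M)
    have "integral\<^sup>L angle_measure (F M) \<le> 2 * (\<Sum>k\<in>{N..<M}. 1 - norm (a k))"
      unfolding F_def by (rule mean_norm_blaschke_partial_diff_sq[OF s elim])
    also have "(\<Sum>k\<in>{N..<M}. 1 - norm (a k)) = (\<Sum>k<M - N. 1 - norm (a (k + N)))"
      using elim by (intro sum.reindex_bij_witness[of _ "\<lambda>k. k + N" "\<lambda>k. k - N"]) auto
    also have "\<dots> \<le> (\<Sum>k. 1 - norm (a (k + N)))"
      using less_imp_le[OF blaschke_sequence_norm[OF bs]] blaschke_sequence_summable[OF bs]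
      by (intro sum_le_suminf) (auto simp: summable_iff_shift[of "\<lambda>k. 1 - norm (a k)"])
    finally show ?case by simp
  qed
  ultimately have "integral\<^sup>L angle_measure G \<le> 2 * (\<Sum>k. 1 - norm (a (k + N)))"
    by (rule tendsto_upperbound) auto
  moreover have "(\<integral>\<^sup>+t. ennreal (G t) \<partial>angle_measure) = ennreal (integral\<^sup>L angle_measure G)"
    by (intro nn_integral_eq_integral integrable_angle_measure_continuous contG) (auto simp: G_def)
  ultimately show ?thesis
    unfolding G_def by (simp add: ennreal_leI)
qed

text \<open>The subsequence is chosen with tail sums below \<open>(1/8) ^ i\<close>. The maximal
  inequality at level \<open>(1/2) ^ i\<close> divides by the squared level
  \<open>(1/4) ^ i\<close>, which leaves exceptional sets of measure of order
  \<open>(1/2) ^ i\<close>; Borel-Cantelli applies.\<close>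

lemma blaschke_partial_ae_uniform_on_radius:
  "\<exists>n. filterlim n at_top sequentially \<and>
    (AE \<theta> in angle_measure. \<forall>\<^sub>F i in sequentially. \<forall>r\<in>{0..<1}.
       norm (blaschke_product a (of_real r * cis \<theta>) - blaschke_partial a (n i) (of_real r * cis \<theta>)) \<le> (1/2) ^ i)"
proof -
  have "\<exists>m\<ge>i. norm (\<Sum>k. 1 - norm (a (k + m))) < (1/8) ^ i" for i :: nat
  proof -
    obtain m where "\<And>n. n \<ge> m \<Longrightarrow> norm (\<Sum>k. 1 - norm (a (k + n))) < (1/8) ^ i"
      using suminf_exist_split[OF _ blaschke_sequence_summable[OF bs], of "(1/8) ^ i"] by auto
    then show ?thesis by (intro exI[of _ "max i m"]) auto
  qed
  then obtain n where n: "\<And>i. n i \<ge> i" "\<And>i. norm (\<Sum>k. 1 - norm (a (k + n i))) < (1/8) ^ i"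
    by metis
  \<comment> \<open>Rational radii can be enumerated, as the maximal inequality requires; since they
    are dense in \<open>[0, 1)\<close>, continuity recovers all other radii.\<close>
  define D where "D = {0..<1::real} \<inter> \<rat>"
  define \<rho> where "\<rho> = from_nat_into D"
  have "0 \<in> D" "countable D"
    by (auto simp: D_def countable_rat)
  then have D: "range \<rho> = D"
    unfolding \<rho>_def by (intro range_from_nat_into) auto
  then have \<rho>: "0 \<le> \<rho> q" "\<rho> q < 1" for q
    by (auto simp: D_def set_eq_iff image_iff)
  define d where "d i z = blaschke_product a z - blaschke_partial a (n i) z" for i z
  have hol: "d i holomorphic_on ball 0 1" for i
    unfolding d_def by (intro holomorphic_intros holomorphic_on_blaschke_partial_ball[OF bs]
        holomorphic_on_blaschke_product[OF bs])
  define E where "E i = {\<theta>. \<exists>q. (1/2) ^ i < norm (d i (of_real (\<rho> q) * cis \<theta>))}" for i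
  have contd: "continuous_on A (\<lambda>x. d i (g x))" if "continuous_on A g" "\<And>x. x \<in> A \<Longrightarrow> norm (g x) < 1"
    for i and g :: "real \<Rightarrow> complex" and A
    using that by (intro continuous_on_compose2[OF holomorphic_on_imp_continuous_on[OF hol]]) auto
  have [measurable]: "(\<lambda>\<theta>. d i (of_real (\<rho> q) * cis \<theta>)) \<in> borel_measurable borel" for i q
    using \<rho> by (intro borel_measurable_continuous_onI contd continuous_intros) (auto simp: norm_mult)
  have E [measurable]: "E i \<in> sets angle_measure" for i
    unfolding E_def by measurable
  have meas: "measure angle_measure (E i) \<le> 16 * (1/2) ^ i" for i
  proof -
    have "emeasure angle_measure (E i) * ennreal (((1/2) ^ i)\<^sup>2) \<le> 8 * ennreal (2 * (\<Sum>k. 1 - norm (a (k + n i))))"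
      unfolding E_def
      by (rule radial_maximal_inequality[OF hol]) 
         (use \<rho> mean_norm_blaschke_product_diff_sq in \<open>auto simp: d_def\<close>)
    also have "\<dots> \<le> 8 * ennreal (2 * (1/8) ^ i)"
      using n(2)[of i] by (intro mult_left_mono ennreal_leI) auto
    also have "\<dots> = ennreal (16 * (1/8) ^ i)"
      by (simp flip: ennreal_numeral ennreal_mult)
    finally have "measure angle_measure (E i) * ((1/2) ^ i)\<^sup>2 \<le> 16 * (1/8) ^ i"
      by (subst (asm) angle.emeasure_eq_measure) (simp add: ennreal_mult[symmetric])
    moreover have "(1/8::real) ^ i = (1/2) ^ i * ((1/2) ^ i)\<^sup>2"
      by (simp add: power2_eq_square flip: power_mult_distrib)
    ultimately have "measure angle_measure (E i) * ((1/2) ^ i)\<^sup>2 \<le> (16 * (1/2) ^ i) * ((1/2) ^ i)\<^sup>2"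
      by simp
    then show ?thesis by (rule mult_right_le_imp_le) simp
  qed
  have "summable (\<lambda>i. measure angle_measure (E i))"
    by (rule summable_comparison_test'[of "\<lambda>i. 16 * (1/2) ^ i"]) (use meas in \<open>auto intro: summable_mult\<close>)
  then have "AE \<theta> in angle_measure. \<forall>\<^sub>F i in sequentially. \<theta> \<in> space angle_measure - E i"
    by (intro borel_cantelli_AE1 E) (auto simp: angle.emeasure_eq_measure)
  then have ae: "AE \<theta> in angle_measure. \<forall>\<^sub>F i in sequentially. \<forall>r\<in>{0..<1}.
       norm (d i (of_real r * cis \<theta>)) \<le> (1/2) ^ i"
  proof eventually_elim
    case (elim \<theta>)
    from elim show ?case
    proof eventually_elim
      case (elim i)
      have le: "norm (d i (of_real r * cis \<theta>)) \<le> (1/2) ^ i" if "r \<in> D" for r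
        using elim that unfolding D[symmetric] by (auto simp: E_def not_less)
      have dense: "r \<in> closure D" if r: "r \<in> {0..<1}" for r :: real
      proof (subst closure_approachable, intro allI impI)
        fix e :: real assume "e > 0"
        then obtain q where "q \<in> \<rat>" "r < q" "q < min 1 (r + e)"
          using r Rats_dense_in_real[of r "min 1 (r + e)"] by auto
        then show "\<exists>y\<in>D. dist y r < e"
          using r by (intro bexI[of _ q]) (auto simp: D_def dist_real_def)
      qed
      show ?case
      proof
        fix r :: real assume r: "r \<in> {0..<1}"
        then obtain x where x: "\<And>k. x k \<in> D" "x \<longlonglongrightarrow> r"
          using dense[OF r] by (auto simp: closure_sequential)
        have "continuous_on {0..<1} (\<lambda>r. norm (d i (of_real r * cis \<theta>)))"
          by (intro continuous_intros contd) (auto simp: norm_mult)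
        then have "(\<lambda>k. norm (d i (of_real (x k) * cis \<theta>))) \<longlonglongrightarrow> norm (d i (of_real r * cis \<theta>))"
          using x r unfolding continuous_on_sequentially comp_def
          by (auto simp: D_def)
        then show "norm (d i (of_real r * cis \<theta>)) \<le> (1/2) ^ i"
          by (rule tendsto_upperbound) (auto intro!: always_eventually le x)
      qed
    qed
  qed
  have "filterlim n at_top sequentially"
    by (rule filterlim_at_top_mono[OF filterlim_ident]) (use n in auto)
  with ae show ?thesis
    unfolding d_def by blast
qed

text \<open>Uniform convergence along the radius permits exchanging the limit in \<open>i\<close>
  with the radial limit, and each partial product is continuous up to the circle. The second
  conjunct is recorded because it identifies the radial limit as a limit of unimodular
  numbers.\<close>

lemma blaschke_product_ae_boundary_value:
  "\<exists>n. filterlim n at_top sequentially \<and>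
    (AE \<theta> in angle_measure. \<exists>v. boundary_value (blaschke_product a) (cis \<theta>) v \<and>
       (\<lambda>i. blaschke_partial a (n i) (cis \<theta>)) \<longlonglongrightarrow> v)"
proof -
  obtain n where n: "filterlim n at_top sequentially" and
    ae: "AE \<theta> in angle_measure. \<forall>\<^sub>F i in sequentially. \<forall>r\<in>{0..<1}.
       norm (blaschke_product a (of_real r * cis \<theta>) - blaschke_partial a (n i) (of_real r * cis \<theta>)) \<le> (1/2) ^ i"
    using blaschke_partial_ae_uniform_on_radius by blast
  from ae have "AE \<theta> in angle_measure. \<exists>v. boundary_value (blaschke_product a) (cis \<theta>) v \<and>
       (\<lambda>i. blaschke_partial a (n i) (cis \<theta>)) \<longlonglongrightarrow> v"
  proof eventually_elim
    case (elim \<theta>)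
    have at_within_Ico: "at (1::real) within {0..<1} = at_left 1"
      by (rule at_within_nhd[of _ "{0<..}"]) auto
    define F where "F i r = blaschke_partial a (n i) (of_real r * cis \<theta>)" for i and r :: real
    define B where "B r = blaschke_product a (of_real r * cis \<theta>)" for r :: real
    have ul: "uniform_limit {0..<1} F B sequentially"
    proof (rule uniform_limitI)
      fix e :: real assume "e > 0"
      have "(\<lambda>i. (1/2::real) ^ i) \<longlonglongrightarrow> 0" by (intro LIMSEQ_realpow_zero) auto
      then have "\<forall>\<^sub>F i in sequentially. (1/2::real) ^ i < e"
        using \<open>e > 0\<close> by (rule order_tendstoD)
      with elim show "\<forall>\<^sub>F i in sequentially. \<forall>r\<in>{0..<1}. dist (F i r) (B r) < e"
        by eventually_elim (auto simp: F_def B_def dist_norm norm_minus_commute intro: le_less_trans)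
    qed
    have lim: "(F i \<longlongrightarrow> F i 1) (at 1 within {0..<1})" for i
    proof -
      have "continuous_on {0..1} (F i)"
        unfolding F_def
        by (intro continuous_on_compose2[OF continuous_on_blaschke_partial[OF bs]] continuous_intros)
          (auto simp: norm_mult)
      then have "(F i \<longlongrightarrow> F i 1) (at 1 within {0..1})" by (simp add: continuous_on_def)
      then show ?thesis by (rule tendsto_within_subset) auto
    qed
    have nb: "at (1::real) within {0..<1} \<noteq> bot"
      by (simp add: at_within_Ico)
    have "uniformly_Cauchy_on {0..<1} F"
      using ul uniformly_convergent_Cauchy uniformly_convergentI by blast
    \<comment> \<open>The uniform Cauchy estimate on \<open>[0, 1)\<close> persists at the endpoint
      1 by letting the radius tend to it.\<close>
    then have "Cauchy (\<lambda>i. F i 1)"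
    proof (intro CauchyI)
      fix e :: real assume "e > 0" and uc: "uniformly_Cauchy_on {0..<1} F"
      then obtain M where M: "\<And>r m k. r \<in> {0..<1} \<Longrightarrow> m \<ge> M \<Longrightarrow> k \<ge> M \<Longrightarrow> dist (F m r) (F k r) < e / 2"
        unfolding uniformly_Cauchy_on_def by (meson half_gt_zero)
      have "norm (F m 1 - F k 1) \<le> e / 2" if "m \<ge> M" "k \<ge> M" for m k
      proof (rule tendsto_upperbound[OF tendsto_norm[OF tendsto_diff[OF lim lim]] _ nb])
        show "\<forall>\<^sub>F r in at 1 within {0..<1}. norm (F m r - F k r) \<le> e / 2"
          using M that by (auto simp: eventually_at dist_norm intro!: exI[of _ 1] less_imp_le)
      qed
      then show "\<exists>M. \<forall>m\<ge>M. \<forall>k\<ge>M. norm (F m 1 - F k 1) < e"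
        using \<open>e > 0\<close> by (intro exI[of _ M]) force
    qed
    then obtain v where v: "(\<lambda>i. F i 1) \<longlonglongrightarrow> v"
      using Cauchy_convergent convergent_def by blast
    have "(B \<longlongrightarrow> v) (at 1 within {0..<1})"
      by (rule swap_uniform_limit[OF _ v ul]) (use lim in auto)
    then have "boundary_value (blaschke_product a) (cis \<theta>) v"
      unfolding boundary_value_def B_def by (simp add: at_within_Ico)
    then show ?case using v by (auto simp: F_def)
  qed
  with n show ?thesis by blast
qed

end

section \<open>The Carleson condition\<close>

text \<open>A crude Jordan inequality, sufficient for comparing chord and arc. Up to
  \<open>pi / 3\<close> the cosine is at least \<open>1/2\<close>, so \<open>sin x - x / 4\<close>
  increases; beyond it, \<open>sin x \<ge> 1/2\<close> while \<open>x / 4 \<le> 1/2\<close>.\<close>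

lemma sin_ge_quarter:
  assumes "0 \<le> x" "x \<le> pi / 2"
  shows "x / 4 \<le> sin (x::real)"
proof (cases "x \<le> pi / 3")
  case True
  have "sin 0 - 0 / 4 \<le> sin x - x / 4"
  proof (rule DERIV_nonneg_imp_nondecreasing[OF assms(1)])
    fix y assume y: "0 \<le> y" "y \<le> x"
    have "cos (pi / 3) \<le> cos y"
      using y True by (intro cos_monotone_0_pi_le) auto
    then show "\<exists>d. ((\<lambda>x. sin x - x / 4) has_real_derivative d) (at y) \<and> 0 \<le> d"
      by (intro exI[of _ "cos y - 1 / 4"]) (auto intro!: derivative_eq_intros simp: cos_60)
  qed
  then show ?thesis by simp
next
  case False
  have "sin (pi / 6) \<le> sin x"
    using False assms by (intro sin_monotone_2pi_le) (auto intro: less_imp_le)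
  moreover have "x / 4 \<le> 1 / 2" using assms(2) pi_less_4 by linarith
  ultimately show ?thesis by (simp add: sin_30)
qed

lemma abs_le_norm_1_minus_cis:
  assumes "\<bar>\<theta>\<bar> \<le> pi"
  shows "\<bar>\<theta>\<bar> \<le> 4 * norm (1 - cis \<theta>)"
proof -
  have "\<bar>\<theta>\<bar> / 2 / 4 \<le> sin (\<bar>\<theta>\<bar> / 2)"
    by (rule sin_ge_quarter) (use assms in auto)
  also have "\<dots> \<le> \<bar>sin (\<theta> / 2)\<bar>"
    by (cases "\<theta> \<ge> 0") auto
  also have "\<dots> = norm (1 - cis \<theta>) / 2"
    using dist_exp_i_1[of \<theta>] by (simp add: cis_conv_exp norm_minus_commute)
  finally show ?thesis by simp
qed

lemma norm_cis_diff_le: "norm (cis s - cis t) \<le> \<bar>s - t\<bar>"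
proof -
  have "cis s - cis t = cis t * (cis (s - t) - 1)"
    by (simp add: algebra_simps cis_mult)
  then have "norm (cis s - cis t) = norm (cis (s - t) - 1)"
    by (simp add: norm_mult)
  also have "\<dots> = 2 * \<bar>sin ((s - t) / 2)\<bar>"
    using dist_exp_i_1[of "s - t"] by (simp add: cis_conv_exp)
  also have "\<dots> \<le> 2 * \<bar>(s - t) / 2\<bar>"
    by (intro mult_left_mono abs_sin_x_le_abs_x) auto
  finally show ?thesis by simp
qed

text \<open>A Vitali selection: keep a point with the largest \<open>h\<close>, discard everything
  within \<open>c * h\<close> of it, and recurse. Maximality makes \<open>max (h i) (h l)\<close>
  equal to \<open>h i\<close> for every later point, so the survivors are separated from the kept
  point by construction.\<close>

lemma greedy_separated_cover:
  fixes a :: "'i \<Rightarrow> 'a::metric_space" and h :: "'i \<Rightarrow> real"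
  assumes "finite E" "\<And>i. 0 \<le> h i" "0 \<le> c"
  shows "\<exists>S\<subseteq>E. (\<forall>i\<in>S. \<forall>l\<in>S. i \<noteq> l \<longrightarrow> c * max (h i) (h l) < dist (a i) (a l)) \<and>
     (\<forall>j\<in>E. \<exists>i\<in>S. dist (a j) (a i) \<le> c * h i)"
  using assms(1)
proof (induction E rule: finite_psubset_induct)
  case (psubset E)
  show ?case
  proof (cases "E = {}")
    case False
    obtain i where i: "i \<in> E" "\<And>j. j \<in> E \<Longrightarrow> h j \<le> h i"
    proof -
      have "Max (h ` E) \<in> h ` E" using psubset(1) False by (intro Max_in) auto
      then obtain i where "i \<in> E" "h i = Max (h ` E)" by auto
      then show ?thesis using psubset(1) by (intro that[of i]) auto
    qed
    define E' where "E' = {j \<in> E. c * h i < dist (a j) (a i)}"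
    have "i \<notin> E'" using assms by (auto simp: E'_def not_less)
    moreover have "E' \<subseteq> E" by (auto simp: E'_def)
    ultimately have "E' \<subset> E" using i by blast
    from psubset(2)[OF this] obtain S where S: "S \<subseteq> E'"
      "\<forall>i\<in>S. \<forall>l\<in>S. i \<noteq> l \<longrightarrow> c * max (h i) (h l) < dist (a i) (a l)"
      "\<forall>j\<in>E'. \<exists>i\<in>S. dist (a j) (a i) \<le> c * h i" by (elim exE conjE)
    have far: "c * max (h i) (h l) < dist (a i) (a l)" if "l \<in> S" for l
      using that S(1) i(2)[of l] by (auto simp: E'_def max_absorb1 dist_commute)
    have far': "c * max (h l) (h i) < dist (a l) (a i)" if "l \<in> S" for l
      by (subst dist_commute, subst max.commute) (rule far[OF that])
    show ?thesis
    proof (intro exI[of _ "insert i S"] conjI ballI impI)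
      show "insert i S \<subseteq> E" using i S(1) by (auto simp: E'_def)
      show "c * max (h k) (h l) < dist (a k) (a l)"
        if "k \<in> insert i S" "l \<in> insert i S" "k \<noteq> l" for k l
        using that far far' S(2) by auto
      show "\<exists>k\<in>insert i S. dist (a j) (a k) \<le> c * h k" if "j \<in> E" for j
        using that S(3) by (cases "j \<in> E'") (auto simp: E'_def not_less)
    qed
  qed auto
qed

lemma interpolating_imp_blaschke_sequence: "interpolating a \<Longrightarrow> blaschke_sequence a"
  by (simp add: interpolating_def)

lemma interpolating_deriv_bound:
  assumes "interpolating a"
  shows "\<exists>\<delta>>0. \<forall>j. \<delta> \<le> norm (deriv (blaschke_product a) (a j)) * (1 - norm (a j))"
proof (intro exI conjI allI)
  show "0 < (INF j. norm (deriv (blaschke_product a) (a j)) * (1 - norm (a j)))"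
    using assms by (simp add: interpolating_def)
  fix j
  have "norm (a j) < 1" for j
    using blaschke_sequence_norm[OF interpolating_imp_blaschke_sequence[OF assms]] .
  then have "bdd_below (range (\<lambda>j. norm (deriv (blaschke_product a) (a j)) * (1 - norm (a j))))"
    by (intro bdd_belowI[of _ 0]) (auto intro!: mult_nonneg_nonneg simp: less_imp_le)
  then show "(INF j. norm (deriv (blaschke_product a) (a j)) * (1 - norm (a j)))
      \<le> norm (deriv (blaschke_product a) (a j)) * (1 - norm (a j))"
    by (rule cINF_lower) simp
qed

text \<open>The separation product at \<open>a i\<close> is at least \<open>\<delta>\<close>, so
  taking logarithms bounds the sum of
  \<open>x j = 1 - (norm (blaschke_factor (a j) (a i)))\<^sup>2\<close>. For \<open>a j\<close>
  within 6 heights of \<open>a i\<close>, the denominator \<open>norm (1 - cnj (a j) * a i)\<close>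
  is at most \<open>(2 + 6) * h i\<close>, which makes \<open>x j\<close> at least
  \<open>h j / (64 * h i)\<close>.\<close>

lemma interpolating_local_mass:
  assumes int: "interpolating a"
  shows "\<exists>C\<ge>0. \<forall>i J. finite J \<longrightarrow> (\<forall>j\<in>J. dist (a j) (a i) \<le> 6 * (1 - norm (a i))) \<longrightarrow>
     (\<Sum>j\<in>J. 1 - norm (a j)) \<le> C * (1 - norm (a i))"
proof -
  note bs = interpolating_imp_blaschke_sequence[OF int]
  note a1 = blaschke_sequence_norm[OF bs]
  obtain \<delta> where \<delta>: "0 < \<delta>" "\<And>j. \<delta> \<le> norm (deriv (blaschke_product a) (a j)) * (1 - norm (a j))"
    using interpolating_deriv_bound[OF int] by blast
  define h where "h j = 1 - norm (a j)" for j
  have h: "0 < h j" for j using a1[of j] by (simp add: h_def)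
  have h_sq: "h j \<le> 1 - (norm (a j))\<^sup>2" "1 - (norm (a j))\<^sup>2 \<le> 2 * h j" for j
  proof -
    have "1 - (norm (a j))\<^sup>2 = h j * (1 + norm (a j))"
      by (simp add: h_def power2_eq_square algebra_simps)
    moreover have "h j * 1 \<le> h j * (1 + norm (a j))" "h j * (1 + norm (a j)) \<le> h j * 2"
      using h[of j] a1[of j] by (intro mult_left_mono; simp)+
    ultimately show "h j \<le> 1 - (norm (a j))\<^sup>2" "1 - (norm (a j))\<^sup>2 \<le> 2 * h j" by auto
  qed
  have nn: "(norm (a j))\<^sup>2 \<le> 1" for j
    using h_sq(1)[of j] h[of j] by linarith
  define L where "L = - 2 * ln \<delta>"
  have mass: "(\<Sum>j\<in>J. h j) \<le> 64 * L * h i"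
    if J: "finite J" "i \<notin> J" "\<And>j. j \<in> J \<Longrightarrow> dist (a j) (a i) \<le> 6 * h i" for i J
  proof -
    define x where "x j = 1 - (norm (blaschke_factor (a j) (a i)))\<^sup>2" for j
    have "\<delta> \<le> norm (deriv (blaschke_product a) (a i)) * h i" using \<delta>(2)[of i] by (simp add: h_def)
    also have "\<dots> \<le> norm (deriv (blaschke_product a) (a i)) * (1 - (norm (a i))\<^sup>2)"
      by (intro mult_left_mono h_sq) auto
    also have "\<dots> \<le> norm (\<Prod>k\<in>J. blaschke_factor (a k) (a i))"
      by (rule norm_deriv_blaschke_product_le[OF bs J(1,2)])
    finally have "\<delta>\<^sup>2 \<le> (norm (\<Prod>k\<in>J. blaschke_factor (a k) (a i)))\<^sup>2"
      using \<delta>(1) by (intro power_mono) auto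
    also have "\<dots> = (\<Prod>k\<in>J. 1 - x k)"
      by (simp add: x_def prod_norm[symmetric] prod_power_distrib)
    also have "\<dots> \<le> (\<Prod>k\<in>J. exp (- x k))"
      using exp_ge_add_one_self[of "- x k" for k]
      by (intro prod_mono) (auto simp: x_def)
    also have "\<dots> = exp (- (\<Sum>k\<in>J. x k))"
      by (simp add: exp_sum[OF J(1)] sum_negf[symmetric])
    finally have "ln (\<delta>\<^sup>2) \<le> ln (exp (- (\<Sum>k\<in>J. x k)))"
      using \<delta>(1) by (subst ln_le_cancel_iff) auto
    then have xL: "(\<Sum>k\<in>J. x k) \<le> L"
      using \<delta>(1) by (simp add: L_def ln_realpow)
    have "h j / (64 * h i) \<le> x j" if "j \<in> J" for j
    proof -
      have ne: "1 - cnj (a j) * a i \<noteq> 0"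
        by (rule one_minus_cnj_mult_neq_0) (use a1 less_imp_le in auto)
      have "1 - cnj (a j) * a i = of_real (1 - (norm (a i))\<^sup>2) + cnj (a i - a j) * a i"
        unfolding of_real_diff complex_norm_square by (simp add: algebra_simps)
      then have "norm (1 - cnj (a j) * a i) \<le> norm (of_real (1 - (norm (a i))\<^sup>2) :: complex) + norm (cnj (a i - a j) * a i)"
        by (metis norm_triangle_ineq)
      also have "norm (of_real (1 - (norm (a i))\<^sup>2) :: complex) = 1 - (norm (a i))\<^sup>2"
        unfolding norm_of_real using h_sq(1)[of i] h[of i] by simp
      also have "norm (cnj (a i - a j) * a i) = dist (a j) (a i) * norm (a i)"
        unfolding norm_mult complex_mod_cnj by (simp add: dist_norm norm_minus_commute)
      also have "\<dots> \<le> (6 * h i) * 1"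
        using J(3)[OF that] a1[of i] h[of i] by (intro mult_mono) auto
      also have "1 - (norm (a i))\<^sup>2 \<le> 2 * h i" by (rule h_sq)
      finally have "norm (1 - cnj (a j) * a i) \<le> 8 * h i" by simp
      then have "(norm (1 - cnj (a j) * a i))\<^sup>2 \<le> (8 * h i)\<^sup>2"
        by (rule power_mono) simp
      moreover have "x j = (1 - (norm (a j))\<^sup>2) * (1 - (norm (a i))\<^sup>2) / (norm (1 - cnj (a j) * a i))\<^sup>2"
        unfolding x_def by (rule one_minus_norm_blaschke_factor_sq) (use a1 less_imp_le in auto)
      moreover have "h j * h i / (8 * h i)\<^sup>2 \<le> (1 - (norm (a j))\<^sup>2) * (1 - (norm (a i))\<^sup>2) / (norm (1 - cnj (a j) * a i))\<^sup>2"
        using calculation(1) ne h h_sq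
        by (intro frac_le mult_mono mult_nonneg_nonneg) (auto intro: less_imp_le nn)
      moreover have "h j * h i / (8 * h i)\<^sup>2 = h j / (64 * h i)"
        using h[of i] by (simp add: power2_eq_square field_simps)
      ultimately show ?thesis by simp
    qed
    then have "(\<Sum>j\<in>J. h j / (64 * h i)) \<le> (\<Sum>j\<in>J. x j)" by (rule sum_mono)
    with xL have "(\<Sum>j\<in>J. h j) / (64 * h i) \<le> L" by (simp add: sum_divide_distrib)
    then show ?thesis using h[of i] by (simp add: field_simps)
  qed
  have L: "0 \<le> L" using mass[of "{}" 0] h[of 0] by (simp add: zero_le_mult_iff)
  \<comment> \<open>The extra 1 pays for \<open>a i\<close> itself, which has to be left out of the
    product.\<close>
  show ?thesis
  proof (intro exI[of _ "64 * L + 1"] conjI allI impI)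
    show "0 \<le> 64 * L + 1" using L by simp
    fix i J assume J: "finite J" "\<forall>j\<in>J. dist (a j) (a i) \<le> 6 * (1 - norm (a i))"
    have "(\<Sum>j\<in>J. h j) \<le> (\<Sum>j\<in>insert i (J - {i}). h j)"
      by (rule sum_mono2) (use J h less_imp_le in auto)
    also have "\<dots> = h i + (\<Sum>j\<in>J - {i}. h j)" by (rule sum.insert) (use J in auto)
    also have "\<dots> \<le> h i + 64 * L * h i"
      using J mass[of "J - {i}" i] by (intro add_left_mono) (auto simp: h_def)
    finally show "(\<Sum>j\<in>J. 1 - norm (a j)) \<le> (64 * L + 1) * (1 - norm (a i))"
      by (simp add: h_def algebra_simps)
  qed
qed

text \<open>Separated points have disjoint shadows: the intervals of half-width \<open>h i\<close>
  around the arguments do not meet, and all lie in \<open>[-9 * H, 9 * H]\<close>. Comparing total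
  lengths gives the bound.\<close>

lemma sum_separated_heights_le:
  fixes z :: "'i \<Rightarrow> complex"
  assumes S: "finite S" and z1: "\<And>i. i \<in> S \<Longrightarrow> norm (z i) < 1"
    and sep: "\<And>i l. i \<in> S \<Longrightarrow> l \<in> S \<Longrightarrow> i \<noteq> l \<Longrightarrow>
      6 * max (1 - norm (z i)) (1 - norm (z l)) < dist (z i) (z l)"
    and H: "\<And>i. i \<in> S \<Longrightarrow> norm (1 - z i) \<le> H" "0 \<le> H"
  shows "(\<Sum>i\<in>S. 1 - norm (z i)) \<le> 9 * H"
proof -
  define h where "h i = 1 - norm (z i)" for i
  define \<theta> where "\<theta> i = Arg (z i)" for i
  have z: "z i = of_real (norm (z i)) * cis (\<theta> i)" for i
    using rcis_cmod_Arg[of "z i"] by (simp add: rcis_def \<theta>_def)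
  have z': "z i = of_real (1 - h i) * cis (\<theta> i)" for i
  proof -
    have "1 - h i = norm (z i)" by (simp add: h_def)
    then show ?thesis by (simp only:) (rule z)
  qed
  have h: "0 < h i" "h i \<le> H" if "i \<in> S" for i
    using z1[OF that] H(1)[OF that] norm_triangle_ineq2[of 1 "z i"] by (auto simp: h_def)
  \<comment> \<open>The projection to the circle is within \<open>2 * H\<close> of 1, and arc is at
    most 4 times chord; hence \<open>8 * H\<close>, to which the half-width of the interval adds
    another \<open>H\<close>.\<close>
  have \<theta>H: "\<bar>\<theta> i\<bar> \<le> 8 * H" if "i \<in> S" for i
  proof -
    have "1 - cis (\<theta> i) = (1 - z i) - of_real (h i) * cis (\<theta> i)"
      unfolding z'[of i] by (simp add: algebra_simps)
    then have "norm (1 - cis (\<theta> i)) \<le> norm (1 - z i) + norm (of_real (h i) * cis (\<theta> i))"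
      by (metis norm_triangle_ineq4)
    also have "\<dots> \<le> H + H"
      using h[OF that] H(1)[OF that] by (intro add_mono) (auto simp: norm_mult)
    finally have "norm (1 - cis (\<theta> i)) \<le> 2 * H" by simp
    moreover have "\<bar>\<theta> i\<bar> \<le> 4 * norm (1 - cis (\<theta> i))"
      using Arg_bounded[of "z i"] by (intro abs_le_norm_1_minus_cis) (auto simp: \<theta>_def)
    ultimately show ?thesis by linarith
  qed
  \<comment> \<open>Only the inequality of chord by angle difference enters here, so the branch cut
    of \<open>Arg\<close> does no harm. Separation by 6 times the larger height leaves more than
    \<open>h i + h l\<close> after the radial difference is subtracted.\<close>
  have \<theta>sep: "h i + h l < \<bar>\<theta> i - \<theta> l\<bar>" if "i \<in> S" "l \<in> S" "i \<noteq> l" for i l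
  proof -
    have hl: "1 - h l = norm (z l)" by (simp add: h_def)
    have "z i - z l = of_real (h l - h i) * cis (\<theta> i) + of_real (1 - h l) * (cis (\<theta> i) - cis (\<theta> l))"
      unfolding z'[of i] z'[of l] by (simp add: algebra_simps)
    then have "dist (z i) (z l) \<le> norm (of_real (h l - h i) * cis (\<theta> i))
        + norm (of_real (norm (z l)) * (cis (\<theta> i) - cis (\<theta> l)))"
      unfolding dist_norm hl by (metis norm_triangle_ineq)
    also have "norm (of_real (h l - h i) * cis (\<theta> i)) = \<bar>h l - h i\<bar>"
      unfolding norm_mult norm_of_real norm_cis by simp
    also have "norm (of_real (norm (z l)) * (cis (\<theta> i) - cis (\<theta> l))) \<le> norm (cis (\<theta> i) - cis (\<theta> l))"
      using z1[OF that(2)] by (simp add: norm_mult mult_left_le_one_le)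
    also have "\<dots> \<le> \<bar>\<theta> i - \<theta> l\<bar>" by (rule norm_cis_diff_le)
    finally have "dist (z i) (z l) \<le> \<bar>h l - h i\<bar> + \<bar>\<theta> i - \<theta> l\<bar>" by simp
    moreover have "6 * max (h i) (h l) < dist (z i) (z l)" using sep[OF that] by (simp add: h_def)
    ultimately show ?thesis using h[OF that(1)] h[OF that(2)] by linarith
  qed
  define A where "A i = {\<theta> i - h i<..<\<theta> i + h i}" for i
  have disj: "disjoint_family_on A S"
    unfolding disjoint_family_on_def
  proof (intro ballI impI)
    fix i l assume "i \<in> S" "l \<in> S" "i \<noteq> l"
    then have "h i + h l < \<bar>\<theta> i - \<theta> l\<bar>" by (rule \<theta>sep)
    then show "A i \<inter> A l = {}" by (auto simp: A_def)
  qed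
  have "ennreal (2 * (\<Sum>i\<in>S. h i)) = (\<Sum>i\<in>S. ennreal (2 * h i))"
    using h by (subst sum_ennreal) (auto simp: sum_distrib_left less_imp_le)
  also have "\<dots> = (\<Sum>i\<in>S. emeasure lborel (A i))"
    using h by (intro sum.cong refl) (auto simp: A_def less_imp_le)
  also have "\<dots> = emeasure lborel (\<Union>i\<in>S. A i)"
    by (rule sum_emeasure[OF _ disj S]) (auto simp: A_def)
  also have "\<dots> \<le> emeasure lborel {-(9 * H)..9 * H}"
  proof (rule emeasure_mono)
    show "(\<Union>i\<in>S. A i) \<subseteq> {-(9 * H)..9 * H}"
    proof
      fix x assume "x \<in> (\<Union>i\<in>S. A i)"
      then obtain i where "i \<in> S" "x \<in> A i" by blast
      then show "x \<in> {-(9 * H)..9 * H}" using \<theta>H[of i] h[of i] by (auto simp: A_def)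
    qed
  qed simp
  also have "\<dots> = ennreal (18 * H)" using H(2) by simp
  finally show ?thesis using H(2) by (simp add: h_def)
qed

text \<open>Every point of \<open>J\<close> is charged to a selected representative: the local
  estimate bounds each group by a multiple of the height of its representative, and the heights of
  the separated representatives add up to at most \<open>9 * H\<close>. Multiplication by
  \<open>cnj \<zeta>\<close> first rotates \<open>\<zeta>\<close> to 1.\<close>

lemma interpolating_carleson:
  assumes int: "interpolating a"
  shows "\<exists>C>0. \<forall>\<zeta> H J. norm \<zeta> = 1 \<longrightarrow> 0 \<le> H \<longrightarrow> finite J \<longrightarrow> (\<forall>j\<in>J. norm (\<zeta> - a j) \<le> H) \<longrightarrow>
     (\<Sum>j\<in>J. 1 - norm (a j)) \<le> C * H"
proof -
  note a1 = blaschke_sequence_norm[OF interpolating_imp_blaschke_sequence[OF int]]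
  obtain C where C: "C \<ge> 0" "\<forall>i J. finite J \<longrightarrow> (\<forall>j\<in>J. dist (a j) (a i) \<le> 6 * (1 - norm (a i))) \<longrightarrow>
     (\<Sum>j\<in>J. 1 - norm (a j)) \<le> C * (1 - norm (a i))"
    using interpolating_local_mass[OF int] by (elim exE conjE)
  \<comment> \<open>The summand 1 only makes the constant strictly positive.\<close>
  show ?thesis
  proof (intro exI[of _ "C * 9 + 1"] conjI allI impI)
    show "0 < C * 9 + 1" using C by simp
    fix \<zeta> :: complex and H :: real and J :: "nat set"
    assume \<zeta>: "norm \<zeta> = 1" and H: "0 \<le> H" and J: "finite J" "\<forall>j\<in>J. norm (\<zeta> - a j) \<le> H"
    obtain S where S: "S \<subseteq> J"
      "\<And>i l. i \<in> S \<Longrightarrow> l \<in> S \<Longrightarrow> i \<noteq> l \<Longrightarrow> 6 * max (1 - norm (a i)) (1 - norm (a l)) < dist (a i) (a l)"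
      "\<And>j. j \<in> J \<Longrightarrow> \<exists>i\<in>S. dist (a j) (a i) \<le> 6 * (1 - norm (a i))"
      using greedy_separated_cover[OF J(1), of "\<lambda>i. 1 - norm (a i)" 6 a] less_imp_le[OF a1] by auto
    have finS: "finite S" using S(1) J(1) finite_subset by blast
    define z where "z j = cnj \<zeta> * a j" for j
    have nz: "norm (z j) = norm (a j)" for j using \<zeta> by (simp add: z_def norm_mult)
    have dz: "dist (z i) (z j) = dist (a i) (a j)" for i j
      using \<zeta> by (simp add: z_def dist_norm norm_mult flip: right_diff_distrib)
    have "cnj \<zeta> * \<zeta> = 1" using \<zeta> complex_norm_square[of \<zeta>] by (simp add: mult.commute)
    then have "1 - z j = cnj \<zeta> * (\<zeta> - a j)" for j by (simp add: z_def right_diff_distrib)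
    then have onez: "norm (1 - z j) = norm (\<zeta> - a j)" for j using \<zeta> by (simp add: norm_mult)
    have "(\<Sum>i\<in>S. 1 - norm (z i)) \<le> 9 * H"
      by (rule sum_separated_heights_le[OF finS]) (use S(1,2) J(2) H a1 in \<open>auto simp: nz dz onez\<close>)
    then have heights: "(\<Sum>i\<in>S. 1 - norm (a i)) \<le> 9 * H" by (simp add: nz)
    obtain s where s: "\<And>j. j \<in> J \<Longrightarrow> s j \<in> S"
      "\<And>j. j \<in> J \<Longrightarrow> dist (a j) (a (s j)) \<le> 6 * (1 - norm (a (s j)))"
      using S(3) by metis
    have "(\<Sum>j\<in>J. 1 - norm (a j)) = (\<Sum>i\<in>S. \<Sum>j\<in>{j \<in> J. s j = i}. 1 - norm (a j))"
      by (rule sum.group[symmetric]) (use s J(1) finS in auto)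
    also have "\<dots> \<le> (\<Sum>i\<in>S. C * (1 - norm (a i)))"
      by (intro sum_mono C(2)[rule_format]) (use s J(1) in auto)
    also have "\<dots> = C * (\<Sum>i\<in>S. 1 - norm (a i))" by (simp add: sum_distrib_left)
    also have "\<dots> \<le> C * (9 * H)" by (intro mult_left_mono heights C)
    also have "\<dots> \<le> (C * 9 + 1) * H" using H by (simp add: algebra_simps)
    finally show "(\<Sum>j\<in>J. 1 - norm (a j)) \<le> (C * 9 + 1) * H" .
  qed
qed

section \<open>Majorants\<close>

text \<open>The set where \<open>P\<close> fails need not be measurable, so the transfer rule for
  image measures is applied to a measurable null superset \<open>N\<close>, pulled over to the
  circle by \<open>Arg\<close>.\<close>

lemma AE_circle_measureI:
  assumes "AE \<theta> in angle_measure. P (cis \<theta>)"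
  shows "AE \<zeta> in circle_measure. P \<zeta>"
proof -
  obtain N where N: "N \<in> null_sets angle_measure" "{\<theta>. \<not> P (cis \<theta>)} \<subseteq> N"
    using assms by (auto elim!: AE_E2 simp: eventually_ae_filter)
  have Nb [measurable]: "N \<in> sets borel" using N(1) by (auto simp: null_sets_def)
  have eq: "Arg z = (if z = 0 then 0 else pi)" if "z \<in> \<real>\<^sub>\<le>\<^sub>0" for z
    using that complex_eqI[of z 0] by (auto simp: Arg_zero complex_nonpos_Reals_iff Arg_eq_pi less_le)
  have [measurable]: "Arg \<in> borel_measurable borel"
  proof -
    have 1: "(\<lambda>z. indicator (- \<real>\<^sub>\<le>\<^sub>0) z *\<^sub>R Arg z) \<in> borel_measurable borel"
      by (intro borel_measurable_continuous_on_indicator continuous_on_Arg) auto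
    have 2: "- \<real>\<^sub>\<le>\<^sub>0 \<in> sets (borel :: complex measure)" by auto
    have "Arg = (\<lambda>z. if z \<in> - \<real>\<^sub>\<le>\<^sub>0 then indicator (- \<real>\<^sub>\<le>\<^sub>0) z *\<^sub>R Arg z else if z = 0 then 0 else pi)"
      using eq by (intro ext) (auto simp: indicator_def)
    also have "\<dots> \<in> borel_measurable borel"
      using 1 2 by measurable
    finally show ?thesis .
  qed
  have cis [measurable]: "cis \<in> angle_measure \<rightarrow>\<^sub>M restrict_space borel (sphere 0 1)"
    by (intro measurable_restrict_space2)
       (auto intro!: borel_measurable_continuous_onI continuous_intros
         simp: measurable_cong_sets[OF sets_angle_measure refl])
  \<comment> \<open>The endpoint \<open>-pi\<close> is removed because \<open>Arg\<close> inverts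
    \<open>cis\<close> only on the half-open interval.\<close>
  have "AE \<theta> in angle_measure. \<theta> \<in> {-pi<..pi}"
    unfolding angle_measure_def using AE_lborel_singleton[of "-pi"]
    by (intro AE_uniform_measureI) (auto elim!: eventually_mono)
  moreover have "AE \<theta> in angle_measure. \<theta> \<notin> N"
    using N(1) by (rule AE_not_in)
  ultimately have "AE \<theta> in angle_measure. Arg (cis \<theta>) \<notin> N"
    by eventually_elim (simp add: Arg_cis)
  then have "AE \<zeta> in distr angle_measure (restrict_space borel (sphere 0 1)) cis. Arg \<zeta> \<notin> N"
  proof (subst AE_distr_iff[OF cis])
    have "{\<zeta> \<in> sphere 0 1. Arg \<zeta> \<notin> N} = {\<zeta>. norm \<zeta> = 1 \<and> Arg \<zeta> \<notin> N}" by auto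
    also have "\<dots> \<in> sets borel" by measurable
    finally show "{\<zeta> \<in> space (restrict_space borel (sphere 0 1)). Arg \<zeta> \<notin> N}
        \<in> sets (restrict_space borel (sphere 0 1))"
      by (subst sets_restrict_space_iff) (auto simp: space_restrict_space)
  qed
  then have 1: "AE \<zeta> in circle_measure. Arg \<zeta> \<notin> N"
    by (simp only: circle_measure_def angle_measure_def)
  have 2: "AE \<zeta> in circle_measure. \<zeta> \<in> sphere 0 1"
    using AE_space[of circle_measure] by (simp add: circle_measure_def space_restrict_space)
  from 1 2 show ?thesis
  proof eventually_elim
    case (elim \<zeta>)
    then have "cis (Arg \<zeta>) = \<zeta>" by (subst cis_Arg) (auto simp: sgn_eq)
    with elim N(2) show ?case by (metis (mono_tags, lifting) mem_Collect_eq subsetD)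
  qed
qed

lemma majorantD:
  assumes "majorant \<phi>"
  shows "\<And>t. 0 < t \<Longrightarrow> t \<le> 1 \<Longrightarrow> 0 < \<phi> t"
    and "\<And>s t. 0 < s \<Longrightarrow> s \<le> t \<Longrightarrow> t \<le> 1 \<Longrightarrow> \<phi> s \<le> \<phi> t"
    and "\<And>s t. 0 < s \<Longrightarrow> s \<le> t \<Longrightarrow> t \<le> 1 \<Longrightarrow> \<phi> t / t \<le> \<phi> s / s"
    and "continuous_on {0<..1} \<phi>"
proof -
  have mono: "mono_on {0<..1} \<phi>" and anti: "antimono_on {0<..1} (\<lambda>t. \<phi> t / t)"
    using assms by (auto simp: majorant_def)
  show "\<phi> s \<le> \<phi> t" if "0 < s" "s \<le> t" "t \<le> 1" for s t
    using mono_onD[OF mono, of s t] that by auto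
  show "\<phi> t / t \<le> \<phi> s / s" if "0 < s" "s \<le> t" "t \<le> 1" for s t
    using monotone_onD[OF anti, of s t] that by auto
qed (use assms in \<open>auto simp: majorant_def\<close>)

lemma geometric_scale:
  fixes q t :: real
  assumes "0 < q" "q < 1" "0 < t" "t \<le> 1"
  shows "\<exists>n. q ^ Suc n < t \<and> t \<le> q ^ n"
proof -
  obtain n where "q ^ n < t" using real_arch_pow_inv[OF assms(3,2)] by blast
  then have L: "q ^ (LEAST n. q ^ n < t) < t" by (rule LeastI)
  with assms(4) have "(LEAST n. q ^ n < t) \<noteq> 0" by (auto intro: gr0I)
  then obtain m where m: "(LEAST n. q ^ n < t) = Suc m" using not0_implies_Suc by blast
  then have "\<not> q ^ m < t" using not_less_Least[of m "\<lambda>n. q ^ n < t"] by simp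
  with L m show ?thesis by auto
qed

text \<open>On \<open>{q ^ Suc n<..q ^ n}\<close> monotonicity of \<open>\<phi>\<close> pins the
  integrand between \<open>\<phi> (q ^ Suc n) / q ^ n\<close> and
  \<open>\<phi> (q ^ n) / q ^ Suc n\<close>, and the length is \<open>q ^ n * (1 - q)\<close>. The
  ratio is left free: \<open>1/2\<close> serves the sufficiency, \<open>1/8\<close> the
  necessity.\<close>

lemma majorant_integral_finite_iff:
  assumes \<phi>: "majorant \<phi>" and q: "0 < q" "q < 1"
  shows "(\<integral>\<^sup>+t\<in>{0<..1}. ennreal (\<phi> t / t) \<partial>lborel) < \<infinity> \<longleftrightarrow> summable (\<lambda>n. \<phi> (q ^ n))"
proof -
  note \<phi>D = majorantD[OF \<phi>]
  have qn: "0 < q ^ n" "q ^ n \<le> 1" "q ^ Suc n \<le> q ^ n" for n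
    using q by (auto simp: power_le_one mult_left_le_one_le)
  define F where "F t = ennreal (\<phi> t / t) * indicator {0<..1} t" for t
  have [measurable]: "F \<in> borel_measurable borel"
  proof -
    have "continuous_on {0<..1} (\<lambda>t. \<phi> t / t)"
      by (intro continuous_intros \<phi>D(4)) auto
    then have "(\<lambda>t. indicator {0<..1} t *\<^sub>R (\<phi> t / t)) \<in> borel_measurable borel"
      by (intro borel_measurable_continuous_on_indicator) auto
    then have "(\<lambda>t. ennreal (indicator {0<..1} t *\<^sub>R (\<phi> t / t))) \<in> borel_measurable borel"
      by measurable
    also have "(\<lambda>t. ennreal (indicator {0<..1} t *\<^sub>R (\<phi> t / t))) = F"
      by (auto simp: F_def indicator_def fun_eq_iff)
    finally show ?thesis .
  qed
  define I where "I n = {q ^ Suc n<..q ^ n}" for n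
  \<comment> \<open>With the integrand as a density, splitting the integral over the pieces
    \<open>I n\<close> is countable additivity of a measure.\<close>
  define \<nu> where "\<nu> = density lborel F"
  have \<nu>: "emeasure \<nu> A = (\<integral>\<^sup>+t. F t * indicator A t \<partial>lborel)" if "A \<in> sets borel" for A
    unfolding \<nu>_def using that by (subst emeasure_density) auto
  have len: "emeasure lborel (I n) = ennreal (q ^ n * (1 - q))" for n
    unfolding I_def using qn[of n] by (subst emeasure_lborel_Ioc) (auto simp: algebra_simps)
  have I_sub: "t \<in> I n \<Longrightarrow> 0 < t \<and> t \<le> 1" for t n
    unfolding I_def using qn[of n] qn[of "Suc n"] by auto
  have lower: "ennreal ((1 - q) * \<phi> (q ^ Suc n)) \<le> emeasure \<nu> (I n)" for n
  proof -
    have "ennreal ((1 - q) * \<phi> (q ^ Suc n)) = ennreal (\<phi> (q ^ Suc n) / q ^ n) * emeasure lborel (I n)"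
      using q qn(1)[of n] less_imp_le[OF \<phi>D(1)[OF qn(1,2)[of "Suc n"]]]
      unfolding len by (subst ennreal_mult[symmetric]) (auto simp: mult.commute)
    also have "\<dots> = (\<integral>\<^sup>+t. ennreal (\<phi> (q ^ Suc n) / q ^ n) * indicator (I n) t \<partial>lborel)"
      by (subst nn_integral_cmult_indicator) (auto simp: I_def)
    also have "\<dots> \<le> (\<integral>\<^sup>+t. F t * indicator (I n) t \<partial>lborel)"
    proof (intro nn_integral_mono)
      fix t
      show "ennreal (\<phi> (q ^ Suc n) / q ^ n) * indicator (I n) t \<le> F t * indicator (I n) t"
      proof (cases "t \<in> I n")
        case True
        have "\<phi> (q ^ Suc n) / q ^ n \<le> \<phi> t / t"
          using True I_sub[OF True] \<phi>D(2)[of "q ^ Suc n" t] less_imp_le[OF \<phi>D(1)[of t]] qn(1)[of "Suc n"]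
          by (intro frac_le) (auto simp: I_def)
        then show ?thesis using True I_sub[OF True] by (auto simp: F_def ennreal_leI)
      qed simp
    qed
    finally show ?thesis by (subst \<nu>) (auto simp: I_def)
  qed
  have upper: "emeasure \<nu> (I n) \<le> ennreal ((1 - q) / q * \<phi> (q ^ n))" for n
  proof -
    have "emeasure \<nu> (I n) = (\<integral>\<^sup>+t. F t * indicator (I n) t \<partial>lborel)"
      by (subst \<nu>) (auto simp: I_def)
    also have "\<dots> \<le> (\<integral>\<^sup>+t. ennreal (\<phi> (q ^ n) / q ^ Suc n) * indicator (I n) t \<partial>lborel)"
    proof (intro nn_integral_mono)
      fix t
      show "F t * indicator (I n) t \<le> ennreal (\<phi> (q ^ n) / q ^ Suc n) * indicator (I n) t"
      proof (cases "t \<in> I n")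
        case True
        have "\<phi> t / t \<le> \<phi> (q ^ n) / q ^ Suc n"
          using True I_sub[OF True] \<phi>D(2)[of t "q ^ n"] less_imp_le[OF \<phi>D(1)[of t]] qn[of "Suc n"] qn[of n]
            less_imp_le[OF \<phi>D(1)[OF qn(1,2)[of n]]]
          by (intro frac_le) (auto simp: I_def)
        then show ?thesis using True I_sub[OF True] by (auto simp: F_def ennreal_leI)
      qed simp
    qed
    also have "\<dots> = ennreal (\<phi> (q ^ n) / q ^ Suc n) * emeasure lborel (I n)"
      by (subst nn_integral_cmult_indicator) (auto simp: I_def)
    also have "\<dots> = ennreal (\<phi> (q ^ n) / q ^ Suc n * (q ^ n * (1 - q)))"
      using q less_imp_le[OF \<phi>D(1)[OF qn(1,2)[of n]]]
      unfolding len by (subst ennreal_mult[symmetric]) auto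
    also have "\<phi> (q ^ n) / q ^ Suc n * (q ^ n * (1 - q)) = (1 - q) / q * \<phi> (q ^ n)"
      using q by (simp add: divide_simps)
    finally show ?thesis .
  qed
  have "disjoint_family I"
  proof -
    have aux: "I m \<inter> I n = {}" if "m < n" for m n
    proof -
      have "q ^ n \<le> q ^ Suc m" using that q by (intro power_decreasing) auto
      then show ?thesis by (auto simp: I_def)
    qed
    show ?thesis
      unfolding disjoint_family_on_def
    proof (intro ballI impI)
      fix m n :: nat assume "m \<noteq> n"
      then show "I m \<inter> I n = {}" using aux[of m n] aux[of n m] by (cases "m < n") auto
    qed
  qed
  then have "(\<Sum>n. emeasure \<nu> (I n)) = emeasure \<nu> (\<Union>n. I n)"
    by (rule suminf_emeasure[rotated]) (auto simp: \<nu>_def I_def)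
  also have "(\<Union>n. I n) = {0<..1}"
  proof (intro equalityI subsetI)
    fix t assume "t \<in> {0<..1::real}"
    then show "t \<in> (\<Union>n. I n)" using geometric_scale[OF q, of t] by (auto simp: I_def)
  qed (use I_sub in auto)
  also have "emeasure \<nu> {0<..1} = (\<integral>\<^sup>+t\<in>{0<..1}. ennreal (\<phi> t / t) \<partial>lborel)"
    by (subst \<nu>) (auto simp: F_def mult.assoc intro!: nn_integral_cong split: split_indicator)
  finally have eq: "(\<integral>\<^sup>+t\<in>{0<..1}. ennreal (\<phi> t / t) \<partial>lborel) = (\<Sum>n. emeasure \<nu> (I n))" ..
  show ?thesis
  proof
    assume "(\<integral>\<^sup>+t\<in>{0<..1}. ennreal (\<phi> t / t) \<partial>lborel) < \<infinity>"
    moreover have "(\<Sum>n. ennreal ((1 - q) * \<phi> (q ^ Suc n))) \<le> (\<Sum>n. emeasure \<nu> (I n))"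
      by (intro suminf_le lower) auto
    ultimately have "(\<Sum>n. ennreal ((1 - q) * \<phi> (q ^ Suc n))) \<noteq> top"
      unfolding eq by (auto simp: top_unique)
    then have "summable (\<lambda>n. (1 - q) * \<phi> (q ^ Suc n))"
      using q by (intro summable_suminf_not_top mult_nonneg_nonneg less_imp_le[OF \<phi>D(1)[OF qn(1,2)]]) auto
    then have "summable (\<lambda>n. \<phi> (q ^ Suc n))"
      using q by (subst (asm) summable_cmult_iff) auto
    then show "summable (\<lambda>n. \<phi> (q ^ n))"
      by (subst (asm) summable_Suc_iff[of "\<lambda>n. \<phi> (q ^ n)"])
  next
    assume "summable (\<lambda>n. \<phi> (q ^ n))"
    then have sm: "summable (\<lambda>n. (1 - q) / q * \<phi> (q ^ n))" by (rule summable_mult)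
    have "(\<Sum>n. emeasure \<nu> (I n)) \<le> (\<Sum>n. ennreal ((1 - q) / q * \<phi> (q ^ n)))"
      by (intro suminf_le upper) auto
    also have "\<dots> = ennreal (\<Sum>n. (1 - q) / q * \<phi> (q ^ n))"
      using q less_imp_le[OF \<phi>D(1)[OF qn(1,2)]] by (intro suminf_ennreal2 sm) auto
    finally show "(\<integral>\<^sup>+t\<in>{0<..1}. ennreal (\<phi> t / t) \<partial>lborel) < \<infinity>"
      unfolding eq by (auto simp: less_top[symmetric] top_unique)
  qed
qed

text \<open>Zeros are grouped by the dyadic size of their distance to \<open>\<zeta>\<close>. A
  height is at most that distance, and \<open>\<phi> t / t\<close> being nonincreasing gives
  \<open>\<phi> (h j) \<le> 2 * \<phi> (h j / 2)\<close>, so in group \<open>n\<close> the majorant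
  is at most \<open>2 * \<phi> ((1/2) ^ n)\<close>. The Carleson bound on the heights of the group
  cancels the reciprocal distance.\<close>

lemma interpolating_majorant_sum_bounded:
  assumes int: "interpolating a" and \<phi>: "majorant \<phi>" and sm: "summable (\<lambda>n. \<phi> ((1/2) ^ n))"
  shows "\<exists>K. \<forall>\<zeta> J. norm \<zeta> = 1 \<longrightarrow> finite J \<longrightarrow>
    (\<Sum>j\<in>J. \<phi> (1 - norm (a j)) * (1 - norm (a j)) / norm (\<zeta> - a j)) \<le> K"
proof -
  note \<phi>D = majorantD[OF \<phi>]
  define h where "h j = 1 - norm (a j)" for j
  have h: "0 < h j" "h j \<le> 1" for j
    using blaschke_sequence_norm[OF interpolating_imp_blaschke_sequence[OF int], of j] by (auto simp: h_def)
  obtain C where C: "0 < C" "\<And>\<zeta> H J. norm \<zeta> = 1 \<Longrightarrow> 0 \<le> H \<Longrightarrow> finite J \<Longrightarrow> \<forall>j\<in>J. norm (\<zeta> - a j) \<le> H \<Longrightarrow>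
     (\<Sum>j\<in>J. h j) \<le> C * H"
    using interpolating_carleson[OF int] unfolding h_def by metis
  have pos: "0 < \<phi> ((1/2) ^ n)" for n
    by (rule \<phi>D(1)) (auto simp: power_le_one)
  show ?thesis
  proof (intro exI[of _ "4 * C * (\<Sum>n. \<phi> ((1/2) ^ n))"] allI impI)
    fix \<zeta> :: complex and J :: "nat set"
    assume \<zeta>: "norm \<zeta> = 1" and J: "finite J"
    \<comment> \<open>Halving the distance, which is at most 2, puts it into the domain
      \<open>(0, 1]\<close> of \<open>\<phi>\<close> and lets the scales start at
      \<open>n = 0\<close>.\<close>
    define e where "e j = norm (\<zeta> - a j) / 2" for j
    have e: "h j / 2 \<le> e j" "e j \<le> 1" "0 < e j" for j
      using norm_triangle_ineq2[of \<zeta> "a j"] norm_triangle_ineq4[of \<zeta> "a j"] h[of j] \<zeta>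
      by (auto simp: e_def h_def)
    have "\<exists>n. (1/2) ^ Suc n < e j \<and> e j \<le> (1/2) ^ n" for j
      by (rule geometric_scale) (use e in auto)
    then obtain n where n: "(1/2) ^ Suc (n j) < e j" "e j \<le> (1/2) ^ n j" for j by metis
    have term_le: "\<phi> (h j) * h j / norm (\<zeta> - a j) \<le> \<phi> ((1/2) ^ n j) * 2 ^ Suc (n j) * h j" for j
    proof -
      have "\<phi> (h j) / h j \<le> \<phi> (h j / 2) / (h j / 2)"
        using h[of j] by (intro \<phi>D(3)) auto
      then have "\<phi> (h j) \<le> 2 * \<phi> (h j / 2)" using h[of j] by (simp add: field_simps)
      also have "\<phi> (h j / 2) \<le> \<phi> ((1/2) ^ n j)"
        using h[of j] e[of j] n(2)[of j] by (intro \<phi>D(2)) (auto simp: power_le_one)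
      finally have 1: "\<phi> (h j) \<le> 2 * \<phi> ((1/2) ^ n j)" by simp
      have "1 / e j \<le> 1 / (1/2) ^ Suc (n j)"
        using n(1)[of j] by (intro divide_left_mono mult_pos_pos e) (auto intro: less_imp_le)
      then have 2: "1 / e j \<le> 2 ^ Suc (n j)" by (simp add: power_divide)
      have "\<phi> (h j) * h j / norm (\<zeta> - a j) = (\<phi> (h j) / 2) * h j * (1 / e j)"
        by (simp add: e_def)
      also have "\<dots> \<le> \<phi> ((1/2) ^ n j) * h j * 2 ^ Suc (n j)"
        using 1 2 pos[of "n j"] h[of j] e[of j] by (intro mult_mono mult_nonneg_nonneg) (auto intro: less_imp_le)
      finally show ?thesis by (simp add: mult_ac)
    qed
    have "(\<Sum>j\<in>J. \<phi> (h j) * h j / norm (\<zeta> - a j)) \<le> (\<Sum>j\<in>J. \<phi> ((1/2) ^ n j) * 2 ^ Suc (n j) * h j)"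
      by (intro sum_mono term_le)
    also have "\<dots> = (\<Sum>m\<in>n ` J. \<Sum>j\<in>{j \<in> J. n j = m}. \<phi> ((1/2) ^ n j) * 2 ^ Suc (n j) * h j)"
      by (rule sum.image_gen[OF J])
    also have "\<dots> = (\<Sum>m\<in>n ` J. \<phi> ((1/2) ^ m) * 2 ^ Suc m * (\<Sum>j\<in>{j \<in> J. n j = m}. h j))"
      by (intro sum.cong refl) (auto simp: sum_distrib_left)
    also have "\<dots> \<le> (\<Sum>m\<in>n ` J. \<phi> ((1/2) ^ m) * 2 ^ Suc m * (C * (2 * (1/2) ^ m)))"
    proof (intro sum_mono mult_left_mono C(2) ballI)
      show "norm \<zeta> = 1" by (rule \<zeta>)
      fix m j assume "j \<in> {j \<in> J. n j = m}"
      then show "norm (\<zeta> - a j) \<le> 2 * (1/2) ^ m" using n(2)[of j] by (auto simp: e_def)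
    qed (use J pos less_imp_le in \<open>auto intro!: mult_nonneg_nonneg\<close>)
    also have "\<dots> = (\<Sum>m\<in>n ` J. 4 * C * \<phi> ((1/2) ^ m))"
      by (intro sum.cong refl) (simp add: power_divide)
    also have "\<dots> = 4 * C * (\<Sum>m\<in>n ` J. \<phi> ((1/2) ^ m))" by (simp add: sum_distrib_left)
    also have "\<dots> \<le> 4 * C * (\<Sum>n. \<phi> ((1/2) ^ n))"
      using C(1) J pos less_imp_le by (intro mult_left_mono sum_le_suminf sm) auto
    finally show "(\<Sum>j\<in>J. \<phi> (1 - norm (a j)) * (1 - norm (a j)) / norm (\<zeta> - a j))
        \<le> 4 * C * (\<Sum>n. \<phi> ((1/2) ^ n))"
      by (simp add: h_def)
  qed
qed

section \<open>Interpolation under the integral condition\<close>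

lemma holomorphic_on_suminf_disc:
  assumes hol: "\<And>j. u j holomorphic_on ball 0 1"
    and bound: "\<And>j z. norm z < 1 \<Longrightarrow> norm (u j z) \<le> m j / (1 - norm z)"
    and m: "summable m" "\<And>j. 0 \<le> m j"
  shows "(\<lambda>z. \<Sum>j. u j z :: complex) holomorphic_on ball 0 1"
proof (rule holomorphic_uniform_sequence[OF open_ball])
  show "(\<lambda>z. \<Sum>j<N. u j z) holomorphic_on ball 0 1" for N
    by (intro holomorphic_intros hol)
  fix z :: complex assume z: "z \<in> ball 0 1"
  define r where "r = (1 - norm z) / 2"
  have r: "0 < r" using z by (simp add: r_def)
  have le: "norm w \<le> 1 - r" if "w \<in> cball z r" for w
    using that norm_triangle_ineq[of z "w - z"] by (auto simp: dist_norm norm_minus_commute r_def field_simps)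
  have "uniform_limit (cball z r) (\<lambda>N w. \<Sum>j<N. u j w) (\<lambda>w. \<Sum>j. u j w) sequentially"
  proof (rule Weierstrass_m_test)
    fix j w assume "w \<in> cball z r"
    from le[OF this] have w: "norm w \<le> 1 - r" .
    then have "norm (u j w) \<le> m j / (1 - norm w)" using r by (intro bound) auto
    also have "\<dots> \<le> m j / r" using w r m(2) by (intro divide_left_mono mult_pos_pos) auto
    finally show "norm (u j w) \<le> m j / r" .
  qed (use m in \<open>auto intro: summable_divide\<close>)
  moreover have "cball z r \<subseteq> ball 0 1" using le r by fastforce
  ultimately show "\<exists>d>0. cball z d \<subseteq> ball 0 1 \<and>
      uniform_limit (cball z d) (\<lambda>N w. \<Sum>j<N. u j w) (\<lambda>w. \<Sum>j. u j w) sequentially"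
    using r by blast
qed

lemma tendsto_suminf_dominated:
  fixes u :: "nat \<Rightarrow> 'b \<Rightarrow> complex"
  assumes "\<And>j. (u j \<longlongrightarrow> b j) F" "\<forall>\<^sub>F x in F. \<forall>j. norm (u j x) \<le> m j" "summable m" "F \<noteq> bot"
  shows "((\<lambda>x. \<Sum>j. u j x) \<longlongrightarrow> (\<Sum>j. b j)) F"
proof -
  have "eventually (\<lambda>(j, x). norm (u j x) \<le> m j) (at_top \<times>\<^sub>F F)"
    unfolding eventually_prod_filter
    using assms(2) by (intro exI[of _ "\<lambda>_. True"] exI[of _ "\<lambda>x. \<forall>j. norm (u j x) \<le> m j"]) auto
  from tannerys_theorem[OF assms(1) this assms(3,4)] show ?thesis by blast
qed

lemma X_space_subset_trace_space_Kinf: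
  assumes \<phi>: "majorant \<phi>" and fin: "(\<integral>\<^sup>+t\<in>{0<..1}. ennreal (\<phi> t / t) \<partial>lborel) < \<infinity>"
    and int: "interpolating a"
  shows "X_space \<phi> a \<subseteq> trace_space (Kinf (blaschke_product a)) a"
proof
  fix w assume w: "w \<in> X_space \<phi> a"
  note bs = interpolating_imp_blaschke_sequence[OF int]
  note a1 = blaschke_sequence_norm[OF bs]
  define B where "B = blaschke_product a"
  define h where "h j = 1 - norm (a j)" for j
  have h: "0 < h j" "h j \<le> 1" for j using a1[of j] by (auto simp: h_def)
  have B0: "B (a j) = 0" for j unfolding B_def by (rule blaschke_product_zero[OF bs])
  have holB: "B holomorphic_on ball 0 1" unfolding B_def by (rule holomorphic_on_blaschke_product[OF bs])
  obtain \<delta> where \<delta>: "0 < \<delta>" "\<And>j. \<delta> \<le> norm (deriv B (a j)) * h j"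
    using interpolating_deriv_bound[OF int] unfolding B_def h_def by metis
  have dB: "deriv B (a j) \<noteq> 0" for j using \<delta>(1) \<delta>(2)[of j] by auto
  \<comment> \<open>A repeated zero would make the separation product, and with it the derivative at
    that zero, vanish.\<close>
  have inj: "a i \<noteq> a j" if "i \<noteq> j" for i j
  proof
    assume "a i = a j"
    then have "norm (deriv B (a i)) * (1 - (norm (a i))\<^sup>2) \<le> 0"
      using norm_deriv_blaschke_product_le[OF bs, of "{j}" i] that by (simp add: B_def)
    moreover have "0 < 1 - (norm (a i))\<^sup>2" using a1[of i] by (simp add: power_less_one_iff abs_square_less_1)
    ultimately show False using dB[of i] by (simp add: mult_le_0_iff)
  qed
  obtain W where W: "\<And>j. norm (w j) \<le> W"
    using w by (auto simp: X_space_def bounded_iff)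
  obtain M where M0: "\<And>j. norm (w j) / \<phi> (h j) \<le> M"
    using w by (auto simp: X_space_def bdd_above_def h_def)
  have M: "norm (w j) \<le> M * \<phi> (h j)" for j
    using M0[of j] majorantD(1)[OF \<phi> h[of j]] by (simp add: pos_divide_le_eq)
  have Wn: "0 \<le> W" using W[of 0] norm_ge_zero order_trans by blast
  have Mn: "0 \<le> M" using M[of 0] majorantD(1)[OF \<phi> h[of 0]] norm_ge_zero[of "w 0"]
    by (metis order_trans zero_le_mult_iff not_less)
  define c where "c j = w j / deriv B (a j)" for j
  have c_le: "norm (c j) \<le> norm (w j) * h j / \<delta>" for j
  proof -
    have "norm (c j) * \<delta> \<le> norm (c j) * (norm (deriv B (a j)) * h j)"
      by (intro mult_left_mono \<delta>) auto
    also have "\<dots> = norm (w j) * h j"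
      using dB[of j] by (simp add: c_def norm_divide)
    finally show ?thesis using \<delta>(1) by (simp add: field_simps)
  qed
  \<comment> \<open>This crude summability uses only that \<open>w\<close> is bounded. It gives
    convergence inside the disc; the bound uniform up to the circle comes from \<open>m\<close>
    below.\<close>
  have sum_c: "summable (\<lambda>j. norm (c j))"
  proof (rule summable_comparison_test')
    show "summable (\<lambda>j. W / \<delta> * h j)"
      unfolding h_def by (intro summable_mult blaschke_sequence_summable[OF bs])
    fix j
    have "norm (c j) \<le> norm (w j) * h j / \<delta>" by (rule c_le)
    also have "\<dots> \<le> W * h j / \<delta>"
      using W[of j] h[of j] \<delta>(1) by (intro divide_right_mono mult_right_mono) auto
    finally show "norm (norm (c j)) \<le> W / \<delta> * h j" by simp
  qed
  have "summable (\<lambda>n. \<phi> ((1/2) ^ n))"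
    using fin majorant_integral_finite_iff[OF \<phi>, of "1/2"] by simp
  then obtain K where K: "\<And>\<zeta> J. norm \<zeta> = 1 \<Longrightarrow> finite J \<Longrightarrow>
      (\<Sum>j\<in>J. \<phi> (h j) * h j / norm (\<zeta> - a j)) \<le> K"
    using interpolating_majorant_sum_bounded[OF int \<phi>] unfolding h_def by metis
  \<comment> \<open>The factor 2 is the loss in passing from \<open>\<zeta>\<close> to points
    \<open>r * \<zeta>\<close>; with it, \<open>m \<zeta>\<close> dominates both series along the
    whole radius.\<close>
  define m where "m \<zeta> j = 2 * (norm (c j) / norm (\<zeta> - a j))" for \<zeta> j
  define K' where "K' = 2 * (M / \<delta> * K)"
  have partial: "(\<Sum>j\<in>J. m \<zeta> j) \<le> K'" if \<zeta>: "norm \<zeta> = 1" and J: "finite J" for \<zeta> J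
  proof -
    have "(\<Sum>j\<in>J. m \<zeta> j) \<le> (\<Sum>j\<in>J. 2 * (M / \<delta>) * (\<phi> (h j) * h j / norm (\<zeta> - a j)))"
    proof (intro sum_mono)
      fix j
      have "norm (c j) \<le> (M * \<phi> (h j)) * h j / \<delta>"
        using M[of j] h[of j] \<delta>(1) by (intro order_trans[OF c_le] divide_right_mono mult_right_mono) auto
      then have "norm (c j) / norm (\<zeta> - a j) \<le> ((M * \<phi> (h j)) * h j / \<delta>) / norm (\<zeta> - a j)"
        by (rule divide_right_mono) simp
      from mult_left_mono[OF this, of 2]
      show "m \<zeta> j \<le> 2 * (M / \<delta>) * (\<phi> (h j) * h j / norm (\<zeta> - a j))"
        by (simp add: m_def mult_ac)
    qed
    also have "\<dots> = 2 * (M / \<delta>) * (\<Sum>j\<in>J. \<phi> (h j) * h j / norm (\<zeta> - a j))"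
      by (simp only: sum_distrib_left)
    also have "\<dots> \<le> 2 * (M / \<delta>) * K"
      using Mn \<delta>(1) by (intro mult_left_mono K \<zeta> J) auto
    finally show ?thesis by (simp add: K'_def)
  qed
  have m0: "0 \<le> m \<zeta> j" for \<zeta> j by (simp add: m_def)
  have sum_m: "summable (m \<zeta>)" "suminf (m \<zeta>) \<le> K'" if "norm \<zeta> = 1" for \<zeta>
  proof -
    show sm: "summable (m \<zeta>)"
      by (rule summableI_nonneg_bounded[of _ K']) (use m0 partial[OF that] in auto)
    show "suminf (m \<zeta>) \<le> K'"
      by (rule suminf_le_const[OF sm]) (use partial[OF that] in auto)
  qed
  define k where "k j z = 1 - cnj (a j) * z" for j z
  have k_ge: "1 - norm z \<le> norm (k j z)" if "norm z < 1" for j z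
  proof -
    have "norm (cnj (a j) * z) \<le> norm z"
      using a1[of j] by (simp add: norm_mult mult_left_le_one_le)
    then show ?thesis unfolding k_def using norm_triangle_ineq2[of 1 "cnj (a j) * z"] by simp
  qed
  have k_ne: "k j z \<noteq> 0" if "norm z \<le> 1" for j z
    unfolding k_def by (rule one_minus_cnj_mult_neq_0[OF a1 that])
  have k_circle: "k j \<zeta> = \<zeta> * cnj (\<zeta> - a j)" if "norm \<zeta> = 1" for j \<zeta>
    using that complex_norm_square[of \<zeta>] by (simp add: k_def algebra_simps)
  have radial: "norm (c j) / norm (k j (of_real r * \<zeta>)) \<le> m \<zeta> j" if "norm \<zeta> = 1" "0 \<le> r" "r < 1" for j r \<zeta>
  proof -
    have "norm (\<zeta> - a j) = norm (1 - cnj (a j) * \<zeta>)"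
      using k_circle[OF that(1), of j] that(1) unfolding k_def by (simp only: norm_mult complex_mod_cnj)
    also have "\<dots> \<le> 2 * norm (1 - of_real r * (cnj (a j) * \<zeta>))"
      using that a1[of j] by (intro norm_one_minus_le_twice) (auto simp: norm_mult)
    also have "1 - of_real r * (cnj (a j) * \<zeta>) = k j (of_real r * \<zeta>)" by (simp add: k_def)
    finally have "norm (\<zeta> - a j) \<le> 2 * norm (k j (of_real r * \<zeta>))" .
    moreover have "0 < norm (\<zeta> - a j)" using that(1) a1[of j] by auto
    moreover have "0 < norm (k j (of_real r * \<zeta>))"
      using k_ne[of "of_real r * \<zeta>" j] that by (simp add: norm_mult)
    ultimately have "norm (c j) / (2 * norm (k j (of_real r * \<zeta>))) \<le> norm (c j) / norm (\<zeta> - a j)"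
      by (intro divide_left_mono) auto
    then show ?thesis by (simp add: m_def)
  qed
  have polar: "\<exists>\<zeta> r. norm \<zeta> = 1 \<and> 0 \<le> r \<and> r < 1 \<and> z = of_real r * \<zeta>" if "norm z < 1" for z :: complex
    using that rcis_cmod_Arg[of z] by (intro exI[of _ "cis (Arg z)"] exI[of _ "norm z"]) (auto simp: rcis_def)
  \<comment> \<open>This is \<open>B / (z - a j)\<close> with its removable singularity filled in;
    the value \<open>B (a j) = 0\<close> is kept in the formula to match the difference
    quotient.\<close>
  define D where "D j z = (if z = a j then deriv B (a j) else (B z - B (a j)) / (z - a j))" for j z
  have holD: "D j holomorphic_on ball 0 1" for j
    unfolding D_def using a1[of j] by (intro pole_lemma[OF holB]) auto
  \<comment> \<open>Keeping only the factor of \<open>B\<close> at \<open>a j\<close> cancels the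
    denominator \<open>z - a j\<close> and leaves \<open>1 / norm (k j z)\<close>. Thus the terms of
    \<open>f\<close> and of \<open>g\<close> obey the same bound.\<close>
  have D_le: "norm (D j z) \<le> 1 / norm (k j z)" if z: "norm z < 1" for j z
  proof (cases "z = a j")
    case True
    have "k j z = of_real (1 - (norm (a j))\<^sup>2)"
      unfolding k_def True of_real_diff complex_norm_square by (simp add: mult.commute)
    moreover have pos: "0 < 1 - (norm (a j))\<^sup>2" using a1[of j] by (simp add: power_less_one_iff abs_square_less_1)
    ultimately have "norm (k j z) = 1 - (norm (a j))\<^sup>2" by (simp only: norm_of_real abs_of_pos)
    moreover have "norm (deriv B (a j)) * (1 - (norm (a j))\<^sup>2) \<le> 1"
      using norm_deriv_blaschke_product_le[OF bs, of "{}" j] by (simp add: B_def)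
    ultimately show ?thesis using True pos by (simp add: D_def pos_le_divide_eq)
  next
    case False
    have "norm (B z) \<le> norm (a j - z) / norm (k j z)"
      using norm_blaschke_product_le[OF bs z, of "{j}"] by (simp add: norm_blaschke_factor B_def k_def)
    then have "norm (B z) / norm (z - a j) \<le> norm (a j - z) / norm (k j z) / norm (z - a j)"
      by (rule divide_right_mono) simp
    then show ?thesis using False by (simp add: D_def B0 norm_divide norm_minus_commute)
  qed
  define f where "f z = (\<Sum>j. c j * D j z)" for z
  define g where "g z = (\<Sum>j. cnj (c j) * z / k j z)" for z
  have f_term: "norm (c j * D j z) \<le> norm (c j) / norm (k j z)" if "norm z < 1" for j z
    using mult_left_mono[OF D_le[OF that, of j], of "norm (c j)"] by (simp add: norm_mult)
  have g_term: "norm (cnj (c j) * z / k j z) \<le> norm (c j) / norm (k j z)" if "norm z < 1" for j z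
    using that by (simp add: norm_mult norm_divide divide_right_mono mult_left_le)
  have ck_le: "norm (c j) / norm (k j z) \<le> norm (c j) / (1 - norm z)" if "norm z < 1" for j z
  proof -
    have "0 < norm (k j z)" using k_ne[of z j] that by auto
    then show ?thesis using k_ge[OF that, of j] that by (intro divide_left_mono) auto
  qed
  have hol_f: "f holomorphic_on ball 0 1"
    unfolding f_def
    by (rule holomorphic_on_suminf_disc[OF _ order_trans[OF f_term ck_le] sum_c])
       (auto intro!: holomorphic_intros holD)
  have hol_g: "g holomorphic_on ball 0 1"
    unfolding g_def
  proof (rule holomorphic_on_suminf_disc[OF _ order_trans[OF g_term ck_le] sum_c])
    fix j show "(\<lambda>z. cnj (c j) * z / k j z) holomorphic_on ball 0 1"
      using k_ne less_imp_le unfolding k_def by (intro holomorphic_intros) auto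
  qed auto
  have bound: "norm (\<Sum>j. u j z) \<le> K'" if z: "norm z < 1"
    and u: "\<And>j z. norm z < 1 \<Longrightarrow> norm (u j z) \<le> norm (c j) / norm (k j z)"
    for z and u :: "nat \<Rightarrow> complex \<Rightarrow> complex"
  proof -
    obtain \<zeta> r where \<zeta>: "norm \<zeta> = 1" "0 \<le> r" "r < 1" "z = of_real r * \<zeta>" using polar[OF z] by blast
    have le: "norm (u j z) \<le> m \<zeta> j" for j
      using u[OF z, of j] radial[OF \<zeta>(1-3), of j] \<zeta>(4) by simp
    have "norm (\<Sum>j. u j z) \<le> suminf (m \<zeta>)"
      by (rule norm_suminf_le[OF le sum_m(1)[OF \<zeta>(1)]])
    also have "\<dots> \<le> K'" by (rule sum_m(2)[OF \<zeta>(1)])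
    finally show ?thesis .
  qed
  have f_Hinf: "f \<in> Hinf"
    using hol_f bound[OF _ f_term] unfolding Hinf_def bounded_iff f_def by (auto intro!: exI[of _ K'])
  have g_Hinf0: "g \<in> Hinf0"
    using hol_g bound[OF _ g_term] unfolding Hinf0_def Hinf_def bounded_iff g_def by (auto intro!: exI[of _ K'])
  have f_interp: "f (a i) = w i" for i
  proof -
    have "f (a i) = (\<Sum>j\<in>{i}. c j * D j (a i))"
      unfolding f_def using inj by (intro suminf_finite) (auto simp: D_def B0)
    also have "\<dots> = w i" using dB[of i] by (simp add: D_def c_def)
    finally show ?thesis .
  qed
  \<comment> \<open>At any circle point where \<open>B\<close> has a radial limit, domination by
    \<open>m \<zeta>\<close> allows the limit to be taken term by term in both series.\<close>
  have boundary: "\<exists>u v w. boundary_value f \<zeta> u \<and> boundary_value B \<zeta> v \<and> boundary_value g \<zeta> w \<and> u = v * cnj w"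
    if \<zeta>: "norm \<zeta> = 1" and v: "boundary_value B \<zeta> v" for \<zeta> v
  proof -
    have ne: "\<zeta> \<noteq> a j" for j using \<zeta> a1[of j] by auto
    have at1: "\<forall>\<^sub>F r in at_left (1::real). 0 \<le> r \<and> r < 1"
      using eventually_at_left_field[of "\<lambda>r. 0 \<le> r \<and> r < 1" "1::real"] by (auto intro!: exI[of _ 0])
    have in_disc: "norm (of_real r * \<zeta>) < 1" if "0 \<le> r" "r < 1" for r
      using \<zeta> that by (simp add: norm_mult)
    have to_\<zeta>: "((\<lambda>r. of_real r * \<zeta>) \<longlongrightarrow> \<zeta>) (at_left (1::real))"
      by (rule tendsto_eq_intros refl)+ simp
    have Dlim: "((\<lambda>r. D j (of_real r * \<zeta>)) \<longlongrightarrow> v / (\<zeta> - a j)) (at_left 1)" for j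
    proof (rule Lim_transform_eventually)
      show "((\<lambda>r. B (of_real r * \<zeta>) / (of_real r * \<zeta> - a j)) \<longlongrightarrow> v / (\<zeta> - a j)) (at_left 1)"
        using v ne[of j] unfolding boundary_value_def by (intro tendsto_intros to_\<zeta>) auto
      have "\<forall>\<^sub>F r in at_left (1::real). of_real r * \<zeta> \<noteq> a j"
        using to_\<zeta> ne[of j] by (rule tendsto_imp_eventually_ne)
      then show "\<forall>\<^sub>F r in at_left 1. B (of_real r * \<zeta>) / (of_real r * \<zeta> - a j) = D j (of_real r * \<zeta>)"
        by eventually_elim (simp add: D_def B0)
    qed
    have "((\<lambda>r. \<Sum>j. c j * D j (of_real r * \<zeta>)) \<longlongrightarrow> (\<Sum>j. c j * (v / (\<zeta> - a j)))) (at_left 1)"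
    proof (rule tendsto_suminf_dominated[OF _ _ sum_m(1)[OF \<zeta>]])
      show "((\<lambda>r. c j * D j (of_real r * \<zeta>)) \<longlongrightarrow> c j * (v / (\<zeta> - a j))) (at_left 1)" for j
        by (intro tendsto_intros Dlim)
      show "\<forall>\<^sub>F r in at_left 1. \<forall>j. norm (c j * D j (of_real r * \<zeta>)) \<le> m \<zeta> j"
        using at1 by eventually_elim (auto intro!: order_trans[OF f_term radial] in_disc \<zeta>)
    qed simp
    then have bf: "boundary_value f \<zeta> (\<Sum>j. c j * (v / (\<zeta> - a j)))"
      unfolding boundary_value_def f_def .
    have "((\<lambda>r. \<Sum>j. cnj (c j) * (of_real r * \<zeta>) / k j (of_real r * \<zeta>)) \<longlongrightarrow>
        (\<Sum>j. cnj (c j) * \<zeta> / k j \<zeta>)) (at_left 1)"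
    proof (rule tendsto_suminf_dominated[OF _ _ sum_m(1)[OF \<zeta>]])
      show "((\<lambda>r. cnj (c j) * (of_real r * \<zeta>) / k j (of_real r * \<zeta>)) \<longlongrightarrow> cnj (c j) * \<zeta> / k j \<zeta>) (at_left 1)" for j
        using k_ne[of \<zeta> j] \<zeta> unfolding k_def by (intro tendsto_intros to_\<zeta>) auto
      show "\<forall>\<^sub>F r in at_left 1. \<forall>j. norm (cnj (c j) * (of_real r * \<zeta>) / k j (of_real r * \<zeta>)) \<le> m \<zeta> j"
        using at1 by eventually_elim (auto intro!: order_trans[OF g_term radial] in_disc \<zeta>)
    qed simp
    then have bg: "boundary_value g \<zeta> (\<Sum>j. cnj (c j) * \<zeta> / k j \<zeta>)"
      unfolding boundary_value_def g_def .
    have "summable (\<lambda>j. c j / (\<zeta> - a j))"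
    proof (rule summable_comparison_test'[OF sum_m(1)[OF \<zeta>]])
      fix j
      have "0 \<le> norm (c j) / norm (\<zeta> - a j)" by simp
      then show "norm (c j / (\<zeta> - a j)) \<le> m \<zeta> j"
        unfolding m_def norm_divide by linarith
    qed
    then have s: "(\<lambda>j. c j / (\<zeta> - a j)) sums (\<Sum>j. c j / (\<zeta> - a j))" by (rule summable_sums)
    have "cnj (cnj (c j) * \<zeta> / k j \<zeta>) = c j / (\<zeta> - a j)" for j
      using \<zeta> unfolding k_circle[OF \<zeta>] by auto
    then have "(\<lambda>j. cnj (c j) * \<zeta> / k j \<zeta>) sums cnj (\<Sum>j. c j / (\<zeta> - a j))"
      using s by (subst sums_cnj[symmetric]) simp
    then have "cnj (\<Sum>j. cnj (c j) * \<zeta> / k j \<zeta>) = (\<Sum>j. c j / (\<zeta> - a j))"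
      by (simp add: sums_iff)
    moreover have "(\<Sum>j. c j * (v / (\<zeta> - a j))) = v * (\<Sum>j. c j / (\<zeta> - a j))"
      using sums_mult[OF s, of v] by (simp add: sums_iff mult_ac)
    ultimately show ?thesis using bf bg v by metis
  qed
  have "f \<in> Kinf B"
  proof -
    have "AE \<zeta> in circle_measure.
      \<exists>u v w. boundary_value f \<zeta> u \<and> boundary_value B \<zeta> v \<and> boundary_value g \<zeta> w \<and> u = v * cnj w"
    proof (rule AE_circle_measureI)
      obtain n :: "nat \<Rightarrow> nat" where "AE \<theta> in angle_measure. \<exists>v. boundary_value B (cis \<theta>) v \<and>
         (\<lambda>i. blaschke_partial a (n i) (cis \<theta>)) \<longlonglongrightarrow> v"
        using blaschke_product_ae_boundary_value[OF bs] unfolding B_def by blast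
      then show "AE \<theta> in angle_measure. \<exists>u v w. boundary_value f (cis \<theta>) u \<and> boundary_value B (cis \<theta>) v \<and>
          boundary_value g (cis \<theta>) w \<and> u = v * cnj w"
        by eventually_elim (use boundary in auto)
    qed
    with f_Hinf g_Hinf0 show ?thesis unfolding Kinf_def by blast
  qed
  with f_interp show "w \<in> trace_space (Kinf (blaschke_product a)) a"
    unfolding trace_space_def B_def by auto
qed

section \<open>Necessity of the integral condition\<close>

text \<open>Since \<open>dz = \<i> * z * d\<theta>\<close>, the mean of \<open>F z * z\<close> is
  the contour integral of \<open>F\<close> divided by \<open>2 * pi * \<i>\<close>. The circle path
  is parametrized over \<open>[0, 2 * pi]\<close>, so the left half of \<open>[-pi, pi]\<close> is
  shifted by a period.\<close>

lemma mean_residues: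
  assumes F: "F holomorphic_on ball 0 1 - P" and P: "finite P" "P \<subseteq> ball 0 r" and r: "0 < r" "r < 1"
  shows "(\<integral>\<theta>. F (of_real r * cis \<theta>) * (of_real r * cis \<theta>) \<partial>angle_measure) = (\<Sum>p\<in>P. residue F p)"
proof -
  define G where "G \<theta> = F (of_real r * cis \<theta>) * (of_real r * cis \<theta>)" for \<theta>
  have nP: "of_real r * cis \<theta> \<notin> P" for \<theta>
    using P(2) r by (auto dest!: subsetD simp: norm_mult)
  have cont: "continuous_on A G" for A
    unfolding G_def using nP r
    by (intro continuous_intros continuous_on_compose2[OF holomorphic_on_imp_continuous_on[OF F]])
      (auto simp: norm_mult)
  have per: "G (\<theta> + 2 * pi) = G \<theta>" for \<theta>
    by (simp add: G_def flip: cis_mult)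
  have "integral {-pi..pi} G = integral {-pi..0} G + integral {0..pi} G"
    by (rule Henstock_Kurzweil_Integration.integral_combine[symmetric]) (auto intro!: integrable_continuous_interval cont)
  also have "integral {-pi..0} G = integral {-pi..0} (G \<circ> (+) (2 * pi))"
    using per by (intro Henstock_Kurzweil_Integration.integral_cong) (simp add: add.commute)
  also have "\<dots> = integral {pi..2 * pi} G"
    by (subst integral_shift_Icc_real) simp
  also have "integral {pi..2 * pi} G + integral {0..pi} G = integral {0..2 * pi} G"
    by (subst add.commute, rule Henstock_Kurzweil_Integration.integral_combine)
      (auto intro!: integrable_continuous_interval cont)
  also have "\<dots> = contour_integral (circlepath 0 r) F / \<i>"
    unfolding circlepath_def
    by (subst contour_integral_part_circlepath_eq) (auto simp: G_def[abs_def] mult_ac simp flip: integral_divide)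
  also have "contour_integral (circlepath 0 r) F
      = 2 * pi * \<i> * (\<Sum>p\<in>P. winding_number (circlepath 0 r) p * residue F p)"
  proof (rule Residue_theorem[OF open_ball _ P(1) F])
    show "path_image (circlepath 0 r) \<subseteq> ball 0 1 - P"
      using r P(2) by (auto simp: path_image_circlepath_nonneg)
    show "\<forall>z. z \<notin> ball 0 1 \<longrightarrow> winding_number (circlepath 0 r) z = 0"
      using r by (intro allI impI winding_number_zero_outside[of _ "ball 0 1"])
        (auto simp: path_image_circlepath_nonneg)
  qed auto
  also have "(\<Sum>p\<in>P. winding_number (circlepath 0 r) p * residue F p) = (\<Sum>p\<in>P. residue F p)"
  proof (intro sum.cong refl)
    fix p assume "p \<in> P"
    then have "norm (p - 0) < r" using P(2) by auto
    then show "winding_number (circlepath 0 r) p * residue F p = residue F p"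
      by (simp add: winding_number_circlepath)
  qed
  also have "2 * pi * \<i> * (\<Sum>p\<in>P. residue F p) / \<i> = 2 * pi * (\<Sum>p\<in>P. residue F p)"
    by (subst mult.commute[of _ \<i>], subst mult.assoc) (rule nonzero_mult_div_cancel_left, rule complex_i_not_zero)
  finally have "integral {-pi..pi} G = 2 * pi * (\<Sum>p\<in>P. residue F p)" .
  then show ?thesis
    using integral_angle_measure[OF cont[of UNIV]] by (simp add: G_def[abs_def])
qed

lemma blaschke_partial_eq_0_iff:
  assumes "blaschke_sequence a" "norm z \<le> 1"
  shows "blaschke_partial a N z = 0 \<longleftrightarrow> z \<in> a ` {..<N}"
proof -
  have "blaschke_factor (a j) z = 0 \<longleftrightarrow> z = a j" for j
    using one_minus_cnj_mult_neq_0[OF blaschke_sequence_norm[OF assms(1), of j] assms(2)]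
    by (auto simp: blaschke_factor_def split: if_splits)
  then show ?thesis by (auto simp: blaschke_partial_def)
qed

lemma residue_divide_blaschke_partial:
  assumes bs: "blaschke_sequence a" and G: "G holomorphic_on ball 0 1"
    and j: "j < N" and d: "deriv (blaschke_partial a N) (a j) \<noteq> 0"
  shows "residue (\<lambda>z. G z / blaschke_partial a N z) (a j) = G (a j) / deriv (blaschke_partial a N) (a j)"
proof (rule residue_simple')
  let ?B = "blaschke_partial a N"
  let ?s = "ball 0 1 - (a ` {..<N} - {a j})"
  have aj: "a j \<in> ball 0 1" using blaschke_sequence_norm[OF bs] by simp
  show "open ?s" by (intro open_Diff finite_imp_closed) auto
  show "a j \<in> ?s" using aj by auto
  show "(\<lambda>z. G z / ?B z) holomorphic_on (?s - {a j})"
    using blaschke_partial_eq_0_iff[OF bs]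
    by (intro holomorphic_intros holomorphic_on_subset[OF G]
        holomorphic_on_subset[OF holomorphic_on_blaschke_partial_ball[OF bs]]) (auto simp: less_imp_le)
  have B0: "?B (a j) = 0"
    using j aj by (subst blaschke_partial_eq_0_iff[OF bs]) auto
  have "(?B has_field_derivative deriv ?B (a j)) (at (a j))"
    by (rule holomorphic_derivI[OF holomorphic_on_blaschke_partial_ball[OF bs] open_ball aj])
  then have "((\<lambda>w. ?B w / (w - a j)) \<longlongrightarrow> deriv ?B (a j)) (at (a j))"
    using B0 by (simp add: has_field_derivative_iff)
  moreover have "(G \<longlongrightarrow> G (a j)) (at (a j))"
    using holomorphic_on_imp_continuous_on[OF G] aj by (simp add: continuous_on_eq_continuous_at continuous_at)
  ultimately have "((\<lambda>w. G w / (?B w / (w - a j))) \<longlongrightarrow> G (a j) / deriv ?B (a j)) (at (a j))"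
    using d by (intro tendsto_divide) auto
  then show "((\<lambda>w. G w / ?B w * (w - a j)) \<longlongrightarrow> G (a j) / deriv ?B (a j)) (at (a j))"
    by simp
qed

text \<open>For \<open>f = B cnj g\<close> on the circle, the residue theorem applied to \<open>f / B\<close> recovers
  \<open>cnj (g x)\<close>; working with the partial products keeps the number of poles finite.\<close>

lemma Kinf_residue_sum_tendsto:
  assumes bs: "blaschke_sequence a" and f: "f \<in> Hinf" and g: "g \<in> Hinf0"
    and ae: "AE \<zeta> in circle_measure. \<exists>u v w. boundary_value f \<zeta> u \<and>
      boundary_value (blaschke_product a) \<zeta> v \<and> boundary_value g \<zeta> w \<and> u = v * cnj w"
    and n: "filterlim n at_top sequentially"
    and aen: "AE \<theta> in angle_measure. \<exists>v. boundary_value (blaschke_product a) (cis \<theta>) v \<and>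
       (\<lambda>i. blaschke_partial a (n i) (cis \<theta>)) \<longlonglongrightarrow> v"
    and inj: "inj a"
    and d: "\<And>j N. j < N \<Longrightarrow> deriv (blaschke_partial a N) (a j) \<noteq> 0"
    and x: "0 < x" "x < (1::real)"
  shows "(\<lambda>i. \<Sum>j<n i. f (a j) / deriv (blaschke_partial a (n i)) (a j) * (of_real x / (1 - of_real x * a j)))
    \<longlonglongrightarrow> cnj (g (of_real x))"
proof -
  define B where "B = blaschke_partial a"
  note a1 = blaschke_sequence_norm[OF bs]
  have hol: "f holomorphic_on ball 0 1" "g holomorphic_on ball 0 1" and g0: "g 0 = 0"
    using f g by (auto simp: Hinf_def Hinf0_def)
  have "\<exists>K. \<forall>z. norm z < 1 \<longrightarrow> norm (u z) \<le> K" if u: "u \<in> Hinf" for u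
  proof -
    obtain K where "\<forall>y\<in>u ` ball 0 1. norm y \<le> K"
      using u unfolding Hinf_def bounded_iff by blast
    then show ?thesis by (intro exI[of _ K]) auto
  qed
  then obtain Kf Kg where Kf: "\<And>z. norm z < 1 \<Longrightarrow> norm (f z) \<le> Kf"
    and Kg: "\<And>z. norm z < 1 \<Longrightarrow> norm (g z) \<le> Kg"
    using f g unfolding Hinf0_def by blast
  \<comment> \<open>Any sequence in \<open>(0, 1)\<close> tending to 1 would serve. Working with a
    sequence makes the boundary functions \<open>U\<close> and \<open>W\<close> measurable, as
    pointwise limits of continuous functions.\<close>
  define r where "r m = 1 - 1 / (real m + 2)" for m
  have r: "0 < r m" "r m < 1" for m by (auto simp: r_def field_simps)
  have r_lim: "r \<longlonglongrightarrow> 1" unfolding r_def by real_asymp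
  have r_left: "filterlim r (at_left 1) sequentially"
    using r_lim r less_imp_neq[OF r(2)] by (auto simp: filterlim_at intro!: always_eventually)
  have in_disc: "norm (of_real (r m) * cis \<theta>) < 1" for m \<theta>
    using r[of m] by (simp add: norm_mult)
  have cont: "continuous_on UNIV (\<lambda>\<theta>. u (of_real (r m) * cis \<theta>))" if "u holomorphic_on ball 0 1" for u m
    using in_disc by (intro continuous_on_compose2[OF holomorphic_on_imp_continuous_on[OF that]] continuous_intros) auto
  define U where "U \<theta> = lim (\<lambda>m. f (of_real (r m) * cis \<theta>))" for \<theta>
  define W where "W \<theta> = lim (\<lambda>m. g (of_real (r m) * cis \<theta>))" for \<theta>
  have [measurable]: "(\<lambda>\<theta>. f (of_real (r m) * cis \<theta>)) \<in> borel_measurable borel"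
     "(\<lambda>\<theta>. g (of_real (r m) * cis \<theta>)) \<in> borel_measurable borel" for m
    by (intro borel_measurable_continuous_onI cont hol)+
  have [measurable]: "U \<in> borel_measurable borel" "W \<in> borel_measurable borel"
    unfolding U_def W_def by measurable
  \<comment> \<open>On the circle the conjugate of \<open>\<kappa>\<close> is the Cauchy kernel at
    \<open>x\<close> minus 1. Subtracting 1 produces the factor \<open>z\<close> that the residue
    formula for means asks for, and it is harmless because \<open>g 0 = 0\<close>.\<close>
  define \<kappa> where "\<kappa> z = of_real x * z / (1 - of_real x * z)" for z :: complex
  have \<kappa>ne: "1 - of_real x * z \<noteq> 0" and \<kappa>_le: "norm (\<kappa> z) \<le> 1 / (1 - x)" if "norm z \<le> 1" for z
  proof -
    have xz: "norm (of_real x * z) \<le> x" using that x by (simp add: norm_mult mult_left_le)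
    then have ge: "1 - x \<le> norm (1 - of_real x * z)" using norm_triangle_ineq2[of 1 "of_real x * z"] by simp
    then show "1 - of_real x * z \<noteq> 0" using x by auto
    have "norm (\<kappa> z) = norm (of_real x * z) / norm (1 - of_real x * z)" unfolding \<kappa>_def norm_divide ..
    also have "\<dots> \<le> 1 / (1 - x)" using xz ge x by (intro frac_le) auto
    finally show "norm (\<kappa> z) \<le> 1 / (1 - x)" .
  qed
  have hol\<kappa>: "\<kappa> holomorphic_on ball 0 1"
    unfolding \<kappa>_def using \<kappa>ne by (intro holomorphic_intros) auto
  have cont\<kappa>: "continuous_on UNIV (\<lambda>\<theta>. \<kappa> (cis \<theta>))"
    unfolding \<kappa>_def using \<kappa>ne by (intro continuous_intros) auto
  have contB: "continuous_on UNIV (\<lambda>\<theta>. B N (cis \<theta>))" for N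
    unfolding B_def
    by (intro continuous_on_compose2[OF continuous_on_blaschke_partial[OF bs]] continuous_intros) auto
  have nB: "norm (B N (cis \<theta>)) = 1" for N \<theta>
    unfolding B_def by (rule norm_blaschke_partial_circle[OF bs]) simp
  have [measurable]: "(\<lambda>\<theta>. \<kappa> (cis \<theta>)) \<in> borel_measurable borel"
     "(\<lambda>\<theta>. B N (cis \<theta>)) \<in> borel_measurable borel" for N
    by (intro borel_measurable_continuous_onI cont\<kappa> contB)+
  have [measurable]: "cnj \<in> borel_measurable borel"
    by (intro borel_measurable_continuous_onI continuous_intros)
  have to_cis: "((\<lambda>m. of_real (r m) * cis \<theta>) \<longlonglongrightarrow> cis \<theta>)" for \<theta>
    using tendsto_mult[OF tendsto_of_real[OF r_lim] tendsto_const[of "cis \<theta>"]] by simp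
  have \<kappa>_lim: "(\<lambda>m. \<kappa> (of_real (r m) * cis \<theta>)) \<longlonglongrightarrow> \<kappa> (cis \<theta>)" for \<theta>
    unfolding \<kappa>_def using \<kappa>ne[of "cis \<theta>"] by (intro tendsto_intros to_cis) auto
  have B_lim: "(\<lambda>m. B N (of_real (r m) * cis \<theta>)) \<longlonglongrightarrow> B N (cis \<theta>)" for N \<theta>
    unfolding B_def
  proof (rule continuous_on_tendsto_compose[OF continuous_on_blaschke_partial[OF bs] to_cis])
    show "\<forall>\<^sub>F m in sequentially. of_real (r m) * cis \<theta> \<in> cball 0 1"
      by (intro always_eventually allI) (simp add: less_imp_le[OF in_disc] del: of_real_mult)
  qed simp
  have "cis \<in> angle_measure \<rightarrow>\<^sub>M restrict_space borel (sphere 0 1)"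
    by (intro measurable_restrict_space2)
       (auto intro!: borel_measurable_continuous_onI continuous_intros
         simp: measurable_cong_sets[OF sets_angle_measure refl])
  from AE_distrD[OF this ae[unfolded circle_measure_def angle_measure_def[symmetric]]]
  have ae': "AE \<theta> in angle_measure. (\<lambda>m. f (of_real (r m) * cis \<theta>)) \<longlonglongrightarrow> U \<theta> \<and>
      (\<lambda>m. g (of_real (r m) * cis \<theta>)) \<longlonglongrightarrow> W \<theta> \<and> (\<lambda>i. U \<theta> / B (n i) (cis \<theta>)) \<longlonglongrightarrow> cnj (W \<theta>)"
    using aen
  proof eventually_elim
    case (elim \<theta>)
    then obtain u v w where uvw: "boundary_value f (cis \<theta>) u" "boundary_value (blaschke_product a) (cis \<theta>) v"
      "boundary_value g (cis \<theta>) w" "u = v * cnj w" by blast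
    obtain v' where v': "boundary_value (blaschke_product a) (cis \<theta>) v'" "(\<lambda>i. B (n i) (cis \<theta>)) \<longlonglongrightarrow> v'"
      using elim(2) by (auto simp: B_def)
    have "v' = v" using v'(1) uvw(2) unfolding boundary_value_def by (intro tendsto_unique[of "at_left 1"]) auto
    have fu: "(\<lambda>m. f (of_real (r m) * cis \<theta>)) \<longlonglongrightarrow> u" and gw: "(\<lambda>m. g (of_real (r m) * cis \<theta>)) \<longlonglongrightarrow> w"
      using uvw(1,3) unfolding boundary_value_def by (auto intro: filterlim_compose[OF _ r_left])
    have uU: "U \<theta> = u" "W \<theta> = w" unfolding U_def W_def using fu gw by (auto intro: limI)
    have "(\<lambda>i. norm (B (n i) (cis \<theta>))) \<longlonglongrightarrow> norm v'" by (intro tendsto_norm v')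
    \<comment> \<open>The radial limit of \<open>B\<close> is a limit of unimodular values, hence
      nonzero, and the relation \<open>u = v * cnj w\<close> can be divided by it.\<close>
    then have "norm v' = 1" unfolding nB by (simp add: LIMSEQ_const_iff)
    then have v0: "v \<noteq> 0" using \<open>v' = v\<close> by auto
    have "(\<lambda>i. U \<theta> / B (n i) (cis \<theta>)) \<longlonglongrightarrow> u / v"
      unfolding uU using v'(2) v0 \<open>v' = v\<close> by (intro tendsto_intros) auto
    then show ?case using fu gw uU uvw(4) v0 by simp
  qed
  have "AE \<theta> in angle_measure. norm (U \<theta>) \<le> Kf"
    using ae'
  proof eventually_elim
    case (elim \<theta>)
    then have "(\<lambda>m. norm (f (of_real (r m) * cis \<theta>))) \<longlonglongrightarrow> norm (U \<theta>)" by (intro tendsto_norm) auto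
    then show ?case by (rule tendsto_upperbound) (auto intro!: always_eventually Kf in_disc)
  qed
  note U_le = this
  have Kfg: "0 \<le> Kf" "0 \<le> Kg" using order_trans[OF norm_ge_zero Kf[of 0]] order_trans[OF norm_ge_zero Kg[of 0]] by simp_all
  have x1: "0 \<le> 1 / (1 - x)" using x by simp
  define R where "R N = (\<Sum>j<N. f (a j) / deriv (B N) (a j) * (of_real x / (1 - of_real x * a j)))" for N
  \<comment> \<open>For fixed \<open>N\<close>, circles enclosing all \<open>N\<close> zeros give
    \<open>R N\<close> exactly, whatever their radius; letting the radius tend to 1 moves the
    identity to the boundary functions.\<close>
  have stepA: "(\<integral>\<theta>. U \<theta> / B N (cis \<theta>) * \<kappa> (cis \<theta>) \<partial>angle_measure) = R N" for N
  proof -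
    define F where "F z = f z * (of_real x / (1 - of_real x * z)) / B N z" for z
    define \<rho> where "\<rho> = Max (insert 0 ((\<lambda>j. norm (a j)) ` {..<N}))"
    have \<rho>: "\<rho> < 1" "\<And>j. j < N \<Longrightarrow> norm (a j) \<le> \<rho>"
      unfolding \<rho>_def using a1 by (auto simp: Max_less_iff intro!: Max_ge)
    have mean: "(\<integral>\<theta>. F (of_real (r m) * cis \<theta>) * (of_real (r m) * cis \<theta>) \<partial>angle_measure) = R N"
      if "\<rho> < r m" for m
    proof -
      have holG: "(\<lambda>z. f z * (of_real x / (1 - of_real x * z))) holomorphic_on ball 0 1"
        using \<kappa>ne by (intro holomorphic_intros hol) auto
      have "(\<integral>\<theta>. F (of_real (r m) * cis \<theta>) * (of_real (r m) * cis \<theta>) \<partial>angle_measure)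
          = (\<Sum>p\<in>a ` {..<N}. residue F p)"
      proof (rule mean_residues[OF _ _ _ r])
        show "F holomorphic_on ball 0 1 - a ` {..<N}"
          unfolding F_def B_def using blaschke_partial_eq_0_iff[OF bs]
          by (intro holomorphic_on_divide holomorphic_on_subset[OF holG]
              holomorphic_on_subset[OF holomorphic_on_blaschke_partial_ball[OF bs]]) (auto simp: less_imp_le)
        show "a ` {..<N} \<subseteq> ball 0 (r m)" using \<rho>(2) that by force
      qed auto
      also have "\<dots> = (\<Sum>j<N. residue F (a j))"
        using inj by (subst sum.reindex) (auto intro: inj_on_subset)
      also have "\<dots> = R N"
        unfolding R_def F_def B_def
        by (intro sum.cong refl, subst residue_divide_blaschke_partial[OF bs holG _ d]) auto
      finally show ?thesis .
    qed
    have "\<forall>\<^sub>F m in sequentially. \<forall>\<theta>. 1 / 2 \<le> norm (B N (of_real (r m) * cis \<theta>))"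
    proof -
      \<comment> \<open>A single partial product is unimodular on the circle and uniformly
        continuous on the closed disc, so it stays away from 0 on circles close to the boundary;
        this supplies the dominating constant.\<close>
      have "uniformly_continuous_on (cball 0 1) (B N)"
        unfolding B_def by (intro compact_uniformly_continuous continuous_on_blaschke_partial[OF bs]) auto
      then obtain e where e: "e > 0" "\<And>z z'. z \<in> cball 0 1 \<Longrightarrow> z' \<in> cball 0 1 \<Longrightarrow> dist z' z < e \<Longrightarrow> dist (B N z') (B N z) < 1 / 2"
        unfolding uniformly_continuous_on_def by (metis half_gt_zero_iff zero_less_one)
      have "\<forall>\<^sub>F m in sequentially. 1 - e < r m"
        by (rule order_tendstoD(1)[OF r_lim]) (use e in auto)
      then show ?thesis
      proof eventually_elim
        case (elim m)
        show ?case
        proof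
          fix \<theta>
          have "cis \<theta> - of_real (r m) * cis \<theta> = of_real (1 - r m) * cis \<theta>" by (simp add: algebra_simps)
          then have "dist (cis \<theta>) (of_real (r m) * cis \<theta>) = 1 - r m"
            unfolding dist_norm using r[of m] by (simp only: norm_mult norm_of_real norm_cis) simp
          then have "dist (B N (cis \<theta>)) (B N (of_real (r m) * cis \<theta>)) < 1 / 2"
            using elim in_disc[of m \<theta>] by (intro e(2)) auto
          then show "1 / 2 \<le> norm (B N (of_real (r m) * cis \<theta>))"
            using nB[of N \<theta>] norm_triangle_ineq2[of "B N (cis \<theta>)" "B N (of_real (r m) * cis \<theta>)"]
            by (simp add: dist_norm)
        qed
      qed
    qed
    moreover have "\<forall>\<^sub>F m in sequentially. \<rho> < r m"
      by (rule order_tendstoD(1)[OF r_lim \<rho>(1)])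
    ultimately have "\<forall>\<^sub>F m in sequentially. \<rho> < r m \<and> (\<forall>\<theta>. 1 / 2 \<le> norm (B N (of_real (r m) * cis \<theta>)))"
      by eventually_elim auto
    then obtain m0 where m0: "\<And>m. m \<ge> m0 \<Longrightarrow> \<rho> < r m"
      "\<And>m \<theta>. m \<ge> m0 \<Longrightarrow> 1 / 2 \<le> norm (B N (of_real (r m) * cis \<theta>))"
      unfolding eventually_sequentially by blast
    define I where "I m \<theta> = f (of_real (r m) * cis \<theta>) / B N (of_real (r m) * cis \<theta>) * \<kappa> (of_real (r m) * cis \<theta>)" for m \<theta>
    have I_eq: "I m \<theta> = F (of_real (r m) * cis \<theta>) * (of_real (r m) * cis \<theta>)" for m \<theta>
      by (simp add: I_def F_def \<kappa>_def mult.assoc mult.commute)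
    have [measurable]: "(\<lambda>\<theta>. B N (of_real (r m) * cis \<theta>)) \<in> borel_measurable borel"
      "(\<lambda>\<theta>. \<kappa> (of_real (r m) * cis \<theta>)) \<in> borel_measurable borel" for m
      unfolding B_def by (intro borel_measurable_continuous_onI cont hol\<kappa> holomorphic_on_blaschke_partial_ball[OF bs])+
    have "(\<lambda>m. \<integral>\<theta>. I (m + m0) \<theta> \<partial>angle_measure) \<longlonglongrightarrow> (\<integral>\<theta>. U \<theta> / B N (cis \<theta>) * \<kappa> (cis \<theta>) \<partial>angle_measure)"
    proof (rule integral_dominated_convergence)
      show "integrable angle_measure (\<lambda>_. Kf / (1/2) * (1 / (1 - x)))" by simp
      show "AE \<theta> in angle_measure. (\<lambda>m. I (m + m0) \<theta>) \<longlonglongrightarrow> U \<theta> / B N (cis \<theta>) * \<kappa> (cis \<theta>)"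
        using ae'
      proof eventually_elim
        case (elim \<theta>)
        have "B N (cis \<theta>) \<noteq> 0" using nB[of N \<theta>] by auto
        then have "(\<lambda>m. I m \<theta>) \<longlonglongrightarrow> U \<theta> / B N (cis \<theta>) * \<kappa> (cis \<theta>)"
          unfolding I_def using elim by (intro tendsto_intros B_lim \<kappa>_lim) auto
        then show ?case by (rule LIMSEQ_ignore_initial_segment)
      qed
      show "AE \<theta> in angle_measure. norm (I (m + m0) \<theta>) \<le> Kf / (1/2) * (1 / (1 - x))" for m
        unfolding I_def norm_mult norm_divide
        by (intro AE_I2 mult_mono frac_le Kf \<kappa>_le in_disc m0 less_imp_le[OF in_disc]) (use Kfg x1 in auto)
    qed (unfold I_def, measurable)
    moreover have "(\<lambda>m. \<integral>\<theta>. I (m + m0) \<theta> \<partial>angle_measure) = (\<lambda>m. R N)"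
      unfolding I_eq using mean m0(1) by auto
    ultimately show ?thesis by (simp add: LIMSEQ_const_iff)
  qed
  \<comment> \<open>Here \<open>N\<close> runs through the subsequence, along which the quotients
    \<open>U / B (n i)\<close> converge almost everywhere to \<open>cnj W\<close>; they are bounded
    because the denominators are unimodular.\<close>
  have stepB: "(\<lambda>i. R (n i)) \<longlonglongrightarrow> (\<integral>\<theta>. cnj (W \<theta>) * \<kappa> (cis \<theta>) \<partial>angle_measure)"
    unfolding stepA[symmetric]
  proof (rule integral_dominated_convergence)
    show "integrable angle_measure (\<lambda>_. Kf / 1 * (1 / (1 - x)))" by simp
    show "AE \<theta> in angle_measure. (\<lambda>i. U \<theta> / B (n i) (cis \<theta>) * \<kappa> (cis \<theta>)) \<longlonglongrightarrow> cnj (W \<theta>) * \<kappa> (cis \<theta>)"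
      using ae' by eventually_elim (intro tendsto_intros, auto)
    show "AE \<theta> in angle_measure. norm (U \<theta> / B (n i) (cis \<theta>) * \<kappa> (cis \<theta>)) \<le> Kf / 1 * (1 / (1 - x))" for i
      using U_le
    proof eventually_elim
      case (elim \<theta>)
      show ?case unfolding norm_mult norm_divide nB
        by (intro mult_mono divide_right_mono elim \<kappa>_le) (use Kfg x1 in auto)
    qed
  qed measurable
  \<comment> \<open>After conjugation this is the Cauchy formula for the dilates of
    \<open>g\<close>, which are holomorphic past the circle; the dilation is then removed by
    dominated convergence.\<close>
  have stepC: "(\<integral>\<theta>. cnj (W \<theta>) * \<kappa> (cis \<theta>) \<partial>angle_measure) = cnj (g (of_real x))"
  proof -
    have mean: "(\<integral>\<theta>. cnj (g (of_real (r m) * cis \<theta>)) * \<kappa> (cis \<theta>) \<partial>angle_measure) = cnj (g (of_real (r m) * of_real x))" for m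
    proof -
      define G where "G z = g (of_real (r m) * z)" for z
      have G: "G holomorphic_on ball 0 (1 / r m)"
        unfolding G_def using r[of m]
        by (intro holomorphic_on_compose_gen[OF _ hol(2), unfolded o_def] holomorphic_intros)
           (auto simp: norm_mult field_simps)
      have r1: "1 < 1 / r m" using r[of m] by simp
      have contG: "continuous_on UNIV (\<lambda>\<theta>. G (cis \<theta>))"
        unfolding G_def by (rule cont[OF hol(2)])
      have ne: "cis \<theta> - of_real x \<noteq> 0" for \<theta>
      proof
        assume "cis \<theta> - of_real x = 0"
        then have "norm (cis \<theta>) = norm (complex_of_real x)" by simp
        then show False using x by simp
      qed
      have \<kappa>_eq: "cnj (\<kappa> (cis \<theta>)) = cis \<theta> / (cis \<theta> - of_real x) - 1" for \<theta>
      proof -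
        define u where "u = cis \<theta>"
        have u0: "u \<noteq> 0" and ux: "u - of_real x \<noteq> 0"
          using ne[of \<theta>] by (simp_all only: u_def cis_neq_zero not_False_eq_True)
        have "cnj u * u = 1" by (simp add: u_def cis_cnj cis_mult)
        then have c: "cnj u = 1 / u" using u0 by (simp add: eq_divide_eq)
        have "1 - of_real x * cnj u = (u - of_real x) / u"
          unfolding c using u0 by (simp add: diff_divide_distrib)
        then have "cnj (\<kappa> u) = of_real x / (u - of_real x)"
          unfolding \<kappa>_def using u0 c by simp
        also have "\<dots> = (u - (u - of_real x)) / (u - of_real x)" by simp
        also have "\<dots> = u / (u - of_real x) - (u - of_real x) / (u - of_real x)"
          by (rule diff_divide_distrib)
        also have "(u - of_real x) / (u - of_real x) = 1"
          using ux by (rule divide_self)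
        finally show ?thesis by (simp add: u_def)
      qed
      have "(\<integral>\<theta>. G (cis \<theta>) * cnj (\<kappa> (cis \<theta>)) \<partial>angle_measure)
          = (\<integral>\<theta>. G (cis \<theta>) * (cis \<theta> / (cis \<theta> - of_real x)) - G (of_real 1 * cis \<theta>) \<partial>angle_measure)"
        unfolding \<kappa>_eq by (simp add: algebra_simps)
      also have "\<dots> = (\<integral>\<theta>. G (cis \<theta>) * (cis \<theta> / (cis \<theta> - of_real x)) \<partial>angle_measure)
          - (\<integral>\<theta>. G (of_real 1 * cis \<theta>) \<partial>angle_measure)"
        using ne contG
        by (intro Bochner_Integration.integral_diff integrable_angle_measure_continuous continuous_intros) auto
      also have "\<dots> = G (of_real x) - G 0"
        using x r1 by (subst Cauchy_integral_circle[OF G r1], simp, subst mean_value_circle[OF G]) auto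
      finally have eq: "(\<integral>\<theta>. G (cis \<theta>) * cnj (\<kappa> (cis \<theta>)) \<partial>angle_measure) = G (of_real x)"
        by (simp add: G_def g0)
      have "(\<integral>\<theta>. cnj (g (of_real (r m) * cis \<theta>)) * \<kappa> (cis \<theta>) \<partial>angle_measure)
          = (\<integral>\<theta>. cnj (G (cis \<theta>) * cnj (\<kappa> (cis \<theta>))) \<partial>angle_measure)"
        by (simp only: G_def complex_cnj_mult complex_cnj_cnj)
      also have "\<dots> = cnj (G (of_real x))"
        by (simp only: Bochner_Integration.integral_cnj eq)
      finally show ?thesis by (simp only: G_def)
    qed
    have "(\<lambda>m. \<integral>\<theta>. cnj (g (of_real (r m) * cis \<theta>)) * \<kappa> (cis \<theta>) \<partial>angle_measure)
        \<longlonglongrightarrow> (\<integral>\<theta>. cnj (W \<theta>) * \<kappa> (cis \<theta>) \<partial>angle_measure)"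
    proof (rule integral_dominated_convergence)
      show "integrable angle_measure (\<lambda>_. Kg * (1 / (1 - x)))" by simp
      show "AE \<theta> in angle_measure. (\<lambda>m. cnj (g (of_real (r m) * cis \<theta>)) * \<kappa> (cis \<theta>)) \<longlonglongrightarrow> cnj (W \<theta>) * \<kappa> (cis \<theta>)"
        using ae' by eventually_elim (intro tendsto_intros, auto)
      show "AE \<theta> in angle_measure. norm (cnj (g (of_real (r m) * cis \<theta>)) * \<kappa> (cis \<theta>)) \<le> Kg * (1 / (1 - x))" for m
        unfolding norm_mult complex_mod_cnj
        by (intro AE_I2 mult_mono Kg \<kappa>_le in_disc) (use Kfg x1 in auto)
    qed measurable
    moreover have "(\<lambda>m. cnj (g (of_real (r m) * of_real x))) \<longlonglongrightarrow> cnj (g (1 * of_real x))"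
    proof (intro tendsto_intros continuous_on_tendsto_compose[OF holomorphic_on_imp_continuous_on[OF hol(2)]])
      show "(\<lambda>m. complex_of_real (r m)) \<longlonglongrightarrow> 1" using tendsto_of_real[OF r_lim] by simp
      show "\<forall>\<^sub>F m in sequentially. complex_of_real (r m) * of_real x \<in> ball 0 1"
      proof (intro always_eventually allI)
        fix m
        have "r m * x < 1" using r[of m] x mult_strict_mono[of "r m" 1 x 1] by simp
        then show "complex_of_real (r m) * of_real x \<in> ball 0 1" using r[of m] x by (simp add: norm_mult)
      qed
    qed (use x in auto)
    ultimately show ?thesis
      unfolding mean by (metis LIMSEQ_unique mult_1)
  qed
  show ?thesis
    using stepB unfolding stepC R_def B_def .
qed

section \<open>A lacunary sequence of zeros on a radius\<close>

definition radial_zero :: "nat \<Rightarrow> real" where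
  "radial_zero j = 1 - (1/8) ^ Suc j"

abbreviation radial_zeros :: "nat \<Rightarrow> complex" where
  "radial_zeros j \<equiv> of_real (radial_zero j)"

text \<open>The exponent \<open>Suc j\<close> keeps the first zero off the origin, so the
  exceptional case of \<open>blaschke_factor\<close> never occurs.\<close>

lemma radial_zero_bounds: "0 < radial_zero j" "radial_zero j < 1"
proof -
  have "(1/8::real) ^ Suc j \<le> (1/8) ^ 1" by (intro power_decreasing) auto
  then show "0 < radial_zero j" "radial_zero j < 1" by (auto simp: radial_zero_def)
qed

lemma one_minus_norm_radial_zeros: "1 - norm (radial_zeros j) = (1/8) ^ Suc j"
proof -
  have "norm (radial_zeros j) = radial_zero j"
    using radial_zero_bounds[of j] by (simp only: norm_of_real abs_of_pos)
  then show ?thesis by (simp only: radial_zero_def)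
qed

lemma strict_mono_radial_zero: "strict_mono radial_zero"
  by (rule strict_monoI_Suc) (simp add: radial_zero_def)

lemma blaschke_sequence_radial_zeros: "blaschke_sequence radial_zeros"
proof -
  have "summable (\<lambda>j. (1/8::real) ^ Suc j)"
    by (subst summable_Suc_iff) (rule summable_geometric, simp)
  moreover have "norm (radial_zeros j) < 1" for j using radial_zero_bounds[of j] by simp
  ultimately show ?thesis
    unfolding blaschke_sequence_def one_minus_norm_radial_zeros by simp
qed

lemma blaschke_factor_radial_zeros:
  "blaschke_factor (radial_zeros k) (radial_zeros j)
    = of_real ((radial_zero k - radial_zero j) / (1 - radial_zero k * radial_zero j))"
  using radial_zero_bounds[of k] by (simp add: blaschke_factor_def)

text \<open>For zeros at distances \<open>u\<close> and \<open>u * p\<close> from 1, the right-hand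
  side is their pseudohyperbolic distance. Discarding the term \<open>u * (u * p)\<close> from the
  denominator leaves \<open>(1 - p) / (1 + p)\<close>, which is at least
  \<open>1 - 2 * p\<close>.\<close>

lemma norm_blaschke_factor_radial_zeros_ge_aux:
  fixes u p :: real
  assumes "0 < u" "u < 1" "0 < p" "p \<le> 1"
  shows "1 - 2 * p \<le> (u - u * p) / (1 - (1 - u) * (1 - u * p))"
proof -
  have up: "0 < u * p" using assms by simp
  have eq: "1 - (1 - u) * (1 - u * p) = u * (1 + p) - u * (u * p)" by (simp add: algebra_simps)
  have "u * (u * p) < u * p" using mult_strict_right_mono[of u 1 "u * p"] assms up by simp
  then have den: "0 < u * (1 + p) - u * (u * p)"
    unfolding distrib_left using assms(1) by linarith
  have "1 - 2 * p \<le> (1 - p) / (1 + p)"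
    using assms by (subst pos_le_divide_eq) (auto simp: algebra_simps power2_eq_square)
  also have "\<dots> = (u - u * p) / (u * (1 + p))"
    using assms by (simp add: right_diff_distrib[symmetric, of u 1 p, simplified])
  also have "\<dots> \<le> (u - u * p) / (u * (1 + p) - u * (u * p))"
    using assms up den by (intro divide_left_mono) (auto simp: mult_left_le intro!: mult_pos_pos)
  finally show ?thesis by (simp only: eq)
qed

lemma norm_blaschke_factor_radial_zeros_ge:
  assumes "k \<noteq> j"
  shows "1 - 2 * (1/8) ^ (if k < j then j - k else k - j)
    \<le> norm (blaschke_factor (radial_zeros k) (radial_zeros j))"
proof -
  have aux: "1 - 2 * (1/8) ^ (j - k) \<le> \<bar>(radial_zero k - radial_zero j) / (1 - radial_zero k * radial_zero j)\<bar>"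
    if "k < j" for k j
  proof -
    define u p where "u = (1/8::real) ^ Suc k" and "p = (1/8::real) ^ (j - k)"
    have up: "u * p = (1/8) ^ Suc j"
      unfolding u_def p_def using that by (simp flip: power_add)
    have u: "0 < u" "u < 1" "0 < p" "p \<le> 1"
      using radial_zero_bounds[of k] by (auto simp: u_def p_def radial_zero_def power_le_one)
    have "1 - 2 * p \<le> (u - u * p) / (1 - (1 - u) * (1 - u * p))"
      by (rule norm_blaschke_factor_radial_zeros_ge_aux[OF u])
    also have "\<dots> = - ((radial_zero k - radial_zero j) / (1 - radial_zero k * radial_zero j))"
      unfolding radial_zero_def up[symmetric] u_def[symmetric] minus_divide_left by simp
    also have "\<dots> \<le> \<bar>(radial_zero k - radial_zero j) / (1 - radial_zero k * radial_zero j)\<bar>"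
      by (rule abs_ge_minus_self)
    finally show ?thesis by (simp add: p_def)
  qed
  show ?thesis
    unfolding blaschke_factor_radial_zeros norm_of_real
    using aux[of k j] aux[of j k] assms
    by (auto simp: abs_minus_commute mult.commute)
qed

lemma sum_geometric_eighth_below: "(\<Sum>k<j. (1/8::real) ^ (j - k)) \<le> 1 / 7"
proof (induction j)
  case (Suc j)
  have "(\<Sum>k<Suc j. (1/8::real) ^ (Suc j - k)) = (\<Sum>k<j. (1/8) * (1/8) ^ (j - k)) + 1/8"
    by (simp add: Suc_diff_le)
  also have "\<dots> = (1/8) * (\<Sum>k<j. (1/8) ^ (j - k)) + 1/8" by (simp only: sum_distrib_left)
  finally show ?case using Suc by simp
qed simp

lemma sum_geometric_eighth_above: "(\<Sum>k\<in>{Suc j..<N}. (1/8::real) ^ (k - j)) \<le> 1 / 7"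
proof -
  have "(\<Sum>k\<in>{Suc j..<Suc j + n}. (1/8::real) ^ (k - j)) = (1 - (1/8) ^ n) / 7" for n
  proof (induction n)
    case (Suc n)
    have "(\<Sum>k\<in>{Suc j..<Suc j + Suc n}. (1/8::real) ^ (k - j))
        = (\<Sum>k\<in>{Suc j..<Suc j + n}. (1/8) ^ (k - j)) + (1/8) ^ Suc n" by simp
    moreover have "(1 - t) / 7 + 1 / 8 * t = (1 - 1 / 8 * t) / 7" for t :: real by (simp add: field_simps)
    ultimately show ?case unfolding Suc power_Suc by (simp only:)
  qed simp
  from this[of "N - Suc j"] show ?thesis
    by (cases "Suc j \<le> N") auto
qed

text \<open>By the Weierstrass product inequality it suffices that the deficits add up to less than
  1. The zeros on either side of \<open>a j\<close> contribute at most \<open>2 / 7\<close> each;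
  the ratio \<open>1/8\<close> is small enough for this, whereas in this estimate \<open>1/2\<close>
  would not be.\<close>

lemma norm_prod_radial_zeros_ge:
  "3 / 7 \<le> norm (\<Prod>k\<in>{..<N} - {j}. blaschke_factor (radial_zeros k) (radial_zeros j))"
proof -
  define x where "x k = 2 * (1/8::real) ^ (if k < j then j - k else k - j)" for k
  have x: "x k \<in> {0..1}" if "k \<noteq> j" for k
  proof -
    have "(1/8::real) ^ (if k < j then j - k else k - j) \<le> (1/8) ^ 1"
      using that by (intro power_decreasing) auto
    then show ?thesis unfolding x_def by auto
  qed
  have "(\<Sum>k\<in>{..<N} - {j}. x k) \<le> (\<Sum>k\<in>{..<j} \<union> {Suc j..<N}. x k)"
    by (intro sum_mono2) (auto simp: x_def)
  also have "\<dots> = (\<Sum>k<j. x k) + (\<Sum>k\<in>{Suc j..<N}. x k)"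
    by (intro sum.union_disjoint) auto
  also have "(\<Sum>k<j. x k) = 2 * (\<Sum>k<j. (1/8) ^ (j - k))"
    unfolding sum_distrib_left by (intro sum.cong) (auto simp: x_def)
  also have "(\<Sum>k\<in>{Suc j..<N}. x k) = 2 * (\<Sum>k\<in>{Suc j..<N}. (1/8) ^ (k - j))"
    unfolding sum_distrib_left by (intro sum.cong) (auto simp: x_def)
  finally have "(\<Sum>k\<in>{..<N} - {j}. x k) \<le> 4 / 7"
    using sum_geometric_eighth_below[of j] sum_geometric_eighth_above[of j N] by linarith
  then have "3 / 7 \<le> 1 - (\<Sum>k\<in>{..<N} - {j}. x k)" by simp
  also have "\<dots> \<le> (\<Prod>k\<in>{..<N} - {j}. 1 - x k)"
    by (rule Weierstrass_prod_ineq) (use x in auto)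
  also have "\<dots> \<le> (\<Prod>k\<in>{..<N} - {j}. norm (blaschke_factor (radial_zeros k) (radial_zeros j)))"
    using x norm_blaschke_factor_radial_zeros_ge unfolding x_def by (intro prod_mono) force
  finally show ?thesis by (simp add: prod_norm)
qed

lemma interpolating_radial_zeros: "interpolating radial_zeros"
proof -
  have "3 / 14 \<le> norm (deriv (blaschke_product radial_zeros) (radial_zeros j)) * (1 - norm (radial_zeros j))" for j
  proof -
    have "3 / 7 \<le> norm (deriv (blaschke_product radial_zeros) (radial_zeros j)) * (1 - (norm (radial_zeros j))\<^sup>2)"
      by (rule tendsto_lowerbound[OF norm_deriv_blaschke_product_tendsto[OF blaschke_sequence_radial_zeros]])
         (intro always_eventually allI norm_prod_radial_zeros_ge, simp)
    also have "1 - (norm (radial_zeros j))\<^sup>2 = (1 - norm (radial_zeros j)) * (1 + norm (radial_zeros j))"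
      by (simp add: power2_eq_square algebra_simps)
    also have "\<dots> \<le> (1 - norm (radial_zeros j)) * 2"
      using radial_zero_bounds[of j] by (intro mult_left_mono) auto
    finally have "3 / 7 \<le> norm (deriv (blaschke_product radial_zeros) (radial_zeros j)) * ((1 - norm (radial_zeros j)) * 2)"
      by (simp add: mult_left_mono)
    then show ?thesis unfolding mult.assoc[symmetric] by linarith
  qed
  then have "3 / 14 \<le> (INF j. norm (deriv (blaschke_product radial_zeros) (radial_zeros j)) * (1 - norm (radial_zeros j)))"
    by (intro cINF_greatest) auto
  then show ?thesis
    unfolding interpolating_def using blaschke_sequence_radial_zeros by simp
qed

text \<open>At \<open>a j\<close> the factors of the \<open>j\<close> smaller zeros are negative and
  those of the larger ones positive, so the sign of the derivative does not depend on
  \<open>N\<close>; this dictates the signs of \<open>w\<close>. The lower bound on \<open>y\<close>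
  holds because the remaining product has modulus at most 1, and it too is uniform in
  \<open>N\<close>.\<close>

lemma inverse_deriv_blaschke_partial_radial_zeros:
  assumes "j < N"
  shows "\<exists>y. (1/8) ^ Suc j \<le> y \<and>
    deriv (blaschke_partial radial_zeros N) (radial_zeros j) \<noteq> 0 \<and>
    - ((-1) ^ j) / deriv (blaschke_partial radial_zeros N) (radial_zeros j) = of_real y"
proof -
  define \<alpha> where "\<alpha> = radial_zero"
  define \<beta> where "\<beta> k = (\<alpha> k - \<alpha> j) / (1 - \<alpha> k * \<alpha> j)" for k
  have \<alpha>: "0 < \<alpha> k" "\<alpha> k < 1" for k unfolding \<alpha>_def by (rule radial_zero_bounds)+
  have den: "0 < 1 - \<alpha> k * \<alpha> j" for k
    using mult_strict_mono[of "\<alpha> k" 1 "\<alpha> j" 1] \<alpha>[of k] \<alpha>[of j] by simp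
  define p where "p = (\<Prod>k\<in>{..<N} - {j}. \<bar>\<beta> k\<bar>)"
  have prod: "(\<Prod>k\<in>{..<N} - {j}. blaschke_factor (radial_zeros k) (radial_zeros j))
      = of_real (\<Prod>k\<in>{..<N} - {j}. \<beta> k)"
    by (simp add: blaschke_factor_radial_zeros \<beta>_def \<alpha>_def)
  have norm_prod: "norm (\<Prod>k\<in>{..<N} - {j}. blaschke_factor (radial_zeros k) (radial_zeros j)) = p"
    unfolding prod norm_of_real p_def by (rule abs_prod)
  have p: "3 / 7 \<le> p" "p \<le> 1"
    unfolding norm_prod[symmetric]
    by (intro norm_prod_radial_zeros_ge norm_prod_blaschke_factor_le_1
        blaschke_sequence_norm[OF blaschke_sequence_radial_zeros]
        less_imp_le[OF blaschke_sequence_norm[OF blaschke_sequence_radial_zeros]])+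
  have split: "{..<N} - {j} = {..<j} \<union> {Suc j..<N}" using assms by auto
  have sgn_below: "\<beta> k = - \<bar>\<beta> k\<bar>" if "k < j" for k
  proof -
    have "\<alpha> k < \<alpha> j" using strict_mono_radial_zero that by (simp add: \<alpha>_def strict_mono_def)
    then have "\<beta> k \<le> 0" unfolding \<beta>_def using den[of k] by (intro divide_nonpos_pos) auto
    then show ?thesis by simp
  qed
  have sgn_above: "\<beta> k = \<bar>\<beta> k\<bar>" if "j < k" for k
  proof -
    have "\<alpha> j < \<alpha> k" using strict_mono_radial_zero that by (simp add: \<alpha>_def strict_mono_def)
    then have "0 \<le> \<beta> k" unfolding \<beta>_def using den[of k] by (intro divide_nonneg_pos) auto
    then show ?thesis by simp
  qed
  have "(\<Prod>k\<in>{..<N} - {j}. \<beta> k) = (\<Prod>k<j. \<beta> k) * (\<Prod>k\<in>{Suc j..<N}. \<beta> k)"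
    unfolding split by (intro prod.union_disjoint) auto
  also have "(\<Prod>k<j. \<beta> k) = (\<Prod>k<j. (-1) * \<bar>\<beta> k\<bar>)"
    using sgn_below by (intro prod.cong) auto
  also have "\<dots> = (-1) ^ j * (\<Prod>k<j. \<bar>\<beta> k\<bar>)"
    by (subst prod.distrib) simp
  also have "(\<Prod>k\<in>{Suc j..<N}. \<beta> k) = (\<Prod>k\<in>{Suc j..<N}. \<bar>\<beta> k\<bar>)"
    using sgn_above by (intro prod.cong) auto
  also have "(-1) ^ j * (\<Prod>k<j. \<bar>\<beta> k\<bar>) * (\<Prod>k\<in>{Suc j..<N}. \<bar>\<beta> k\<bar>) = (-1) ^ j * p"
    unfolding p_def split mult.assoc by (subst prod.union_disjoint) auto
  finally have sign: "(\<Prod>k\<in>{..<N} - {j}. \<beta> k) = (-1) ^ j * p" .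
  define y where "y = (1 - (\<alpha> j)\<^sup>2) / p"
  have sq: "0 < 1 - (\<alpha> j)\<^sup>2" using \<alpha>[of j] by (simp add: power_less_one_iff abs_square_less_1)
  have D: "deriv (blaschke_partial radial_zeros N) (radial_zeros j) = of_real (- ((-1) ^ j) / y)"
  proof -
    have "deriv (blaschke_partial radial_zeros N) (radial_zeros j)
        = - (of_real (\<alpha> j) / of_real (\<alpha> j)) / (1 - (of_real (\<alpha> j))\<^sup>2) * of_real ((-1) ^ j * p)"
      using deriv_blaschke_partial_self[OF blaschke_sequence_radial_zeros assms] \<alpha>[of j]
      unfolding prod sign by (simp add: \<alpha>_def)
    also have "\<dots> = of_real (- (\<alpha> j / \<alpha> j) / (1 - (\<alpha> j)\<^sup>2) * ((-1) ^ j * p))" by simp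
    also have "- (\<alpha> j / \<alpha> j) / (1 - (\<alpha> j)\<^sup>2) * ((-1) ^ j * p) = - ((-1) ^ j) / y"
      using \<alpha>[of j] by (simp add: y_def)
    finally show ?thesis .
  qed
  have y: "0 < y" using sq p by (simp add: y_def)
  show ?thesis
  proof (intro exI[of _ y] conjI)
    have "(1/8) ^ Suc j = 1 - \<alpha> j" by (simp add: \<alpha>_def radial_zero_def)
    also have "\<dots> \<le> 1 - (\<alpha> j)\<^sup>2"
      using \<alpha>[of j] by (simp add: power2_eq_square mult_left_le)
    also have "\<dots> \<le> y"
      unfolding y_def using sq p by (subst pos_le_divide_eq) (auto simp: mult_left_le)
    finally show "(1/8) ^ Suc j \<le> y" .
    show "deriv (blaschke_partial radial_zeros N) (radial_zeros j) \<noteq> 0"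
      unfolding D using y by simp
    show "- ((-1) ^ j) / deriv (blaschke_partial radial_zeros N) (radial_zeros j) = of_real y"
      unfolding D using y by simp
  qed
qed

lemma integral_finite_if_X_space_subset:
  assumes \<phi>: "majorant \<phi>"
    and sub: "X_space \<phi> radial_zeros \<subseteq> trace_space (Kinf (blaschke_product radial_zeros)) radial_zeros"
  shows "(\<integral>\<^sup>+t\<in>{0<..1}. ennreal (\<phi> t / t) \<partial>lborel) < \<infinity>"
proof -
  note bs = blaschke_sequence_radial_zeros
  define h where "h j = (1/8::real) ^ Suc j" for j
  have h: "0 < h j" "h j \<le> 1" for j unfolding h_def by (auto simp del: power_Suc intro: power_le_one)
  note \<phi>pos = majorantD(1)[OF \<phi> h]
  define w where "w j = of_real (\<phi> (h j)) * (- ((-1) ^ j) :: complex)" for j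
  have nw: "norm (w j) = \<phi> (h j)" for j
    using \<phi>pos[of j] by (simp add: w_def norm_mult norm_power)
  have "w \<in> X_space \<phi> radial_zeros"
  proof -
    have "norm (w j) \<le> \<phi> 1" for j
      unfolding nw by (rule majorantD(2)[OF \<phi> h]) simp
    then have "bounded (range w)" by (auto simp: bounded_iff)
    moreover have "(\<lambda>j. norm (w j) / \<phi> (1 - norm (radial_zeros j))) = (\<lambda>_. 1)"
      using \<phi>pos unfolding one_minus_norm_radial_zeros nw h_def[symmetric] by (intro ext) (simp add: less_imp_neq[symmetric])
    ultimately show ?thesis unfolding X_space_def mem_Collect_eq by (simp only:) simp
  qed
  then obtain f where f: "f \<in> Kinf (blaschke_product radial_zeros)" "\<And>j. f (radial_zeros j) = w j"
    using sub by (auto simp: trace_space_def)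
  then obtain g where fg: "f \<in> Hinf" "g \<in> Hinf0" "AE \<zeta> in circle_measure. \<exists>u v w. boundary_value f \<zeta> u \<and>
      boundary_value (blaschke_product radial_zeros) \<zeta> v \<and> boundary_value g \<zeta> w \<and> u = v * cnj w"
    unfolding Kinf_def by blast
  have "bounded (g ` ball 0 1)" using fg(2) by (simp add: Hinf_def Hinf0_def)
  then obtain G where "\<forall>y\<in>g ` ball 0 1. norm y \<le> G" unfolding bounded_iff by blast
  then have G: "norm (g z) \<le> G" if "norm z < 1" for z using that by auto
  obtain n where n: "filterlim n at_top sequentially" and
    aen: "AE \<theta> in angle_measure. \<exists>v. boundary_value (blaschke_product radial_zeros) (cis \<theta>) v \<and>
       (\<lambda>i. blaschke_partial radial_zeros (n i) (cis \<theta>)) \<longlonglongrightarrow> v"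
    using blaschke_product_ae_boundary_value[OF bs] by blast
  have inj: "inj radial_zeros"
    using strict_mono_imp_inj_on[OF strict_mono_radial_zero] by (auto simp: inj_def)
  have d: "deriv (blaschke_partial radial_zeros N) (radial_zeros j) \<noteq> 0" if "j < N" for j N
    using inverse_deriv_blaschke_partial_radial_zeros[OF that] by blast
  have partial: "(\<Sum>j<L. \<phi> (h j) * h j * (x / (1 - x * radial_zero j))) \<le> G" if x: "0 < x" "x < 1" for L x
  proof -
    define R where "R N = (\<Sum>j<N. f (radial_zeros j) / deriv (blaschke_partial radial_zeros N) (radial_zeros j)
        * (of_real x / (1 - of_real x * radial_zeros j)))" for N
    have lim: "(\<lambda>i. R (n i)) \<longlonglongrightarrow> cnj (g (of_real x))"
      unfolding R_def by (rule Kinf_residue_sum_tendsto[OF bs fg n aen inj d x])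
    have k: "0 < x / (1 - x * radial_zero j)" for j
      using x radial_zero_bounds[of j] mult_strict_mono[of x 1 "radial_zero j" 1] by simp
    \<comment> \<open>All terms are nonnegative, so a fixed number \<open>L\<close> of them is
      bounded by the whole sum for every \<open>N \<ge> L\<close>, and the bound passes to the limit
      along \<open>n\<close>.\<close>
    have le: "(\<Sum>j<L. \<phi> (h j) * h j * (x / (1 - x * radial_zero j))) \<le> Re (R N)" if "L \<le> N" for N
    proof -
      have term_le: "\<phi> (h j) * h j * (x / (1 - x * radial_zero j))
          \<le> Re (f (radial_zeros j) / deriv (blaschke_partial radial_zeros N) (radial_zeros j)
            * (of_real x / (1 - of_real x * radial_zeros j)))" if jN: "j < N" for j
      proof -
        obtain y where y: "h j \<le> y"
          "- ((-1) ^ j) / deriv (blaschke_partial radial_zeros N) (radial_zeros j) = of_real y"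
          using inverse_deriv_blaschke_partial_radial_zeros[OF jN] unfolding h_def by blast
        have "f (radial_zeros j) / deriv (blaschke_partial radial_zeros N) (radial_zeros j)
            * (of_real x / (1 - of_real x * radial_zeros j))
          = of_real (\<phi> (h j)) * (- ((-1) ^ j) / deriv (blaschke_partial radial_zeros N) (radial_zeros j))
            * (of_real x / (1 - of_real x * radial_zeros j))"
          by (simp add: f(2) w_def)
        also have "\<dots> = of_real (\<phi> (h j) * y * (x / (1 - x * radial_zero j)))"
          unfolding y(2) by simp
        finally have "Re (f (radial_zeros j) / deriv (blaschke_partial radial_zeros N) (radial_zeros j)
            * (of_real x / (1 - of_real x * radial_zeros j))) = \<phi> (h j) * y * (x / (1 - x * radial_zero j))"
          by (simp only: Re_complex_of_real)
        moreover have "\<phi> (h j) * h j * (x / (1 - x * radial_zero j)) \<le> \<phi> (h j) * y * (x / (1 - x * radial_zero j))"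
          using \<phi>pos[of j] k[of j] y(1) by (intro mult_right_mono mult_left_mono) auto
        ultimately show ?thesis by simp
      qed
      have "(\<Sum>j<L. \<phi> (h j) * h j * (x / (1 - x * radial_zero j)))
          \<le> (\<Sum>j<N. \<phi> (h j) * h j * (x / (1 - x * radial_zero j)))"
        using that \<phi>pos k h by (intro sum_mono2 mult_nonneg_nonneg) (auto intro: less_imp_le)
      also have "\<dots> \<le> Re (R N)"
        unfolding R_def Re_sum by (intro sum_mono term_le) simp
      finally show ?thesis .
    qed
    have "\<forall>\<^sub>F i in sequentially. L \<le> n i"
      using n by (simp add: filterlim_at_top)
    then have "\<forall>\<^sub>F i in sequentially. (\<Sum>j<L. \<phi> (h j) * h j * (x / (1 - x * radial_zero j))) \<le> Re (R (n i))"
      by eventually_elim (rule le)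
    then have "(\<Sum>j<L. \<phi> (h j) * h j * (x / (1 - x * radial_zero j))) \<le> Re (cnj (g (of_real x)))"
      using tendsto_Re[OF lim] by (intro tendsto_lowerbound[of _ _ sequentially]) auto
    also have "\<dots> \<le> G"
      using complex_Re_le_cmod[of "cnj (g (of_real x))"] G[of "of_real x"] x by simp
    finally show ?thesis .
  qed
  have "(\<Sum>j<L. \<phi> (h j)) \<le> G" for L
  proof (rule tendsto_upperbound)
    \<comment> \<open>As \<open>x\<close> tends to 1, the weight of \<open>\<phi> (h j)\<close>
      tends to 1, because \<open>h j\<close> is exactly \<open>1 - radial_zero j\<close>.\<close>
    have "((\<lambda>x. \<Sum>j<L. \<phi> (h j) * h j * (x / (1 - x * radial_zero j))) \<longlongrightarrow>
        (\<Sum>j<L. \<phi> (h j) * h j * (1 / (1 - 1 * radial_zero j)))) (at_left 1)"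
      using radial_zero_bounds by (intro tendsto_intros) (simp add: less_imp_neq)
    also have "(\<Sum>j<L. \<phi> (h j) * h j * (1 / (1 - 1 * radial_zero j))) = (\<Sum>j<L. \<phi> (h j))"
      by (intro sum.cong refl) (simp add: radial_zero_def h_def)
    finally show "((\<lambda>x. \<Sum>j<L. \<phi> (h j) * h j * (x / (1 - x * radial_zero j))) \<longlongrightarrow>
        (\<Sum>j<L. \<phi> (h j))) (at_left 1)" .
    show "\<forall>\<^sub>F x in at_left 1. (\<Sum>j<L. \<phi> (h j) * h j * (x / (1 - x * radial_zero j))) \<le> G"
      using eventually_at_left_field[of "\<lambda>x. (\<Sum>j<L. \<phi> (h j) * h j * (x / (1 - x * radial_zero j))) \<le> G" 1] partial
      by (auto intro!: exI[of _ 0])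
  qed simp
  then have "summable (\<lambda>j. \<phi> (h j))"
    using \<phi>pos by (intro summableI_nonneg_bounded[of _ G]) (auto intro: less_imp_le)
  then have "summable (\<lambda>j. \<phi> ((1/8) ^ j))"
    unfolding h_def by (subst (asm) summable_Suc_iff[of "\<lambda>j. \<phi> ((1/8) ^ j)"])
  then show ?thesis
    using majorant_integral_finite_iff[OF \<phi>, of "1/8"] by simp
qed

theorem theorem1p4:
  fixes \<phi> :: "real \<Rightarrow> real"
  assumes "majorant \<phi>"
  shows "(upper_type_less_1 \<phi> \<and> (\<integral>\<^sup>+t\<in>{0<..1}. ennreal (\<phi> t / t) \<partial>lborel) < \<infinity> \<longrightarrow>
           (\<forall>a. interpolating a \<longrightarrow>
              X_space \<phi> a \<subseteq> trace_space (Kinf (blaschke_product a)) a)) \<and>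
         ((\<forall>a. interpolating a \<longrightarrow>
              X_space \<phi> a \<subseteq> trace_space (Kinf (blaschke_product a)) a) \<longrightarrow>
           (\<integral>\<^sup>+t\<in>{0<..1}. ennreal (\<phi> t / t) \<partial>lborel) < \<infinity>)"
proof (intro conjI impI allI)
  fix a
  assume "upper_type_less_1 \<phi> \<and> (\<integral>\<^sup>+t\<in>{0<..1}. ennreal (\<phi> t / t) \<partial>lborel) < \<infinity>" "interpolating a"
  then show "X_space \<phi> a \<subseteq> trace_space (Kinf (blaschke_product a)) a"
    using X_space_subset_trace_space_Kinf[OF assms] by blast
next
  assume "\<forall>a. interpolating a \<longrightarrow> X_space \<phi> a \<subseteq> trace_space (Kinf (blaschke_product a)) a"
  then show "(\<integral>\<^sup>+t\<in>{0<..1}. ennreal (\<phi> t / t) \<partial>lborel) < \<infinity>"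
    using integral_finite_if_X_space_subset[OF assms] interpolating_radial_zeros by blast
qed

end
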